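(* Let $\Phi(z;\tau)$ be a meromorphic elliptic function on $\mathbb C\times\mathbf H$ which is modular of weight $k\in\mathbb Z$, defining a meromorphic function $\Phi(-;\tau)$ on $E_\tau$ for each $\tau\in\mathbf H$, and such that $\varphi=\Phi(z;\tau)\,dz$ is a 2nd kind Abelian differential on $E_\tau$ (i.e. $\Phi(-;\tau)$ has no residue at any pole). Then the $A$-cycle integral $\int_A\varphi$ is quasi-modular of weight $k$, and its modular completion is given by the regularized integral $$\operatorname{Reg}\!\int_{E_\tau}\frac{d^2z}{\operatorname{im}\tau}\Phi=\int_A\varphi-\frac1{2i\operatorname{im}\tau}\cdot2\pi i\,\langle\varphi,dz\rangle_{\mathrm P}.$$
   Context: $\mathbf H$ is the upper half-plane, $\Lambda_\tau=\mathbb Z\oplus\mathbb Z\tau$, $E_\tau=\mathbb C/\Lambda_\tau$, $d^2z=\frac i2dz\wedge d\bar z$. *Elliptic*: $\Phi(z+\lambda;\tau)=\Phi(z;\tau)$ for all $\lambda\in\Lambda_\tau$. *Modular of weight $k$*: $\Phi(\frac z{c\tau+d};\frac{a\tau+b}{c\tau+d})=(c\tau+d)^k\Phi(z;\tau)$ for all $\begin{pmatrix}a&b\\c&d\end{pmatrix}\in\mathrm{SL}_2(\mathbb Z)$; a function $f$ on $\mathbf H$ is modular of weight $k$ if $f(\frac{a\tau+b}{c\tau+d})=(c\tau+d)^kf(\tau)$. A meromorphic $f$ on $\mathbf H$ is *quasi-modular of weight $k$* if there are $\ell\ge0$ and holomorphic $f_1,\dots,f_\ell$ on $\mathbf H$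 with $f(\frac{a\tau+b}{c\tau+d})=(c\tau+d)^kf(\tau)+\sum_{i=1}^\ell c^i(c\tau+d)^{k-i}f_i(\tau)$ for all $\begin{pmatrix}a&b\\c&d\end{pmatrix}\in\mathrm{SL}_2(\mathbb Z)$. $A$ is a representative of the class of the segment from $\tau$ to $\tau+1$ which does not meet the poles of $\Phi(-;\tau)$ (the value of $\int_A\varphi$ does not depend on the representative). The Poincaré residue pairing is $\langle\varphi,dz\rangle_{\mathrm P}=-\sum_p\operatorname{Res}_p(z\varphi)$, the sum being over representatives in $\mathbb{C}$ of the poles of $\varphi$ on $E_\tau$ (independent of representatives because residues of $\varphi$ vanish). *Modular completion* of a quasi-modular function $f_0$ of weight $k$: the function of the form $f=\sum_{i=0}^Nf_i(\tau)(\operatorname{im}\tau)^{-i}$, with $f_i$ meromorphic in $\tau$, that is modular of weight $k$ and whose holomorphic limit $\lim_{\bar\tau\to\infty}f:=f_0$ is the given function. *Regularized integral.* For a finite $S\subset E_\tau$, every $2$-form $\omega$, smooth on $E_\tau\setminus S$ and near each $p\in S$ of the form smooth$/w^N$ ($w$ a local holomorphic coordinate with $w(p)=0$), can be written $\omega=\alpha+\partial\beta$ where $\alpha$ is near points of $S$ of the form $\frac{dw}w\wedge\beta_0$, $\beta_0$ smooth, and $\beta$ is a $(0,1)$-form of the form smooth$/w^N$ near $S$; $\operatorname{Reg}\!\int_{E_\tau}\omega:=\int_{E_\tau}\alpha$, which is absolutely convergent and independent of choices. *)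

theory Defs
  imports "HOL-Complex_Analysis.Complex_Analysis"
begin

definition upper_half_plane :: "complex set" where
  "upper_half_plane = {\<tau>. Im \<tau> > 0}"

definition period_lattice :: "complex \<Rightarrow> complex set" where
  "period_lattice \<tau> = {of_int m + of_int n * \<tau> | m n. True}"


section \<open>Meromorphic functions of two variables\<close>

text \<open>Holomorphy on an open subset of \<open>\<complex>\<^sup>2\<close>: real differentiability with a complex linear
  derivative.\<close>

definition holomorphic2_on :: "(complex \<times> complex \<Rightarrow> complex) \<Rightarrow> (complex \<times> complex) set \<Rightarrow> bool" where
  "holomorphic2_on f U \<longleftrightarrow>
     (\<forall>p\<in>U. \<exists>a b. (f has_derivative (\<lambda>(u, v). a * u + b * v)) (at p))"

definition quotient_rep ::
    "(complex \<Rightarrow> complex \<Rightarrow> complex) \<Rightarrow> complex \<times> complex \<Rightarrow> (complex \<times> complex) set \<Rightarrow>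
     (complex \<times> complex \<Rightarrow> complex) \<Rightarrow> (complex \<times> complex \<Rightarrow> complex) \<Rightarrow> bool" where
  "quotient_rep \<Phi> p U g h \<longleftrightarrow>
     open U \<and> connected U \<and> p \<in> U \<and> holomorphic2_on g U \<and> holomorphic2_on h U \<and>
     (\<forall>z \<tau>. (z, \<tau>) \<in> U \<and> h (z, \<tau>) \<noteq> 0 \<longrightarrow> \<Phi> z \<tau> = g (z, \<tau>) / h (z, \<tau>))"

definition meromorphic2_on :: "(complex \<Rightarrow> complex \<Rightarrow> complex) \<Rightarrow> (complex \<times> complex) set \<Rightarrow> bool" where
  "meromorphic2_on \<Phi> W \<longleftrightarrow>
     (\<forall>p\<in>W. \<exists>U g h. quotient_rep \<Phi> p U g h \<and> (\<exists>q\<in>U. h q \<noteq> 0))"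

text \<open>\<open>\<Phi>\<close> restricts to a meromorphic function on the line \<open>\<complex> \<times> {\<tau>}\<close>, i.e. this line is not
  contained in the polar divisor: near each of its points some denominator does not vanish
  identically on the line. (Without this clause, a function with poles along \<open>\<complex> \<times> {\<tau>}\<close> could be
  given unrelated values there.) The second clause only fixes the value of the restriction at its
  isolated singularities, by the library's convention: the limit where it exists, and 0 at
  poles. With this convention an identity between meromorphic functions such as ellipticity or
  modularity holds at every point as soon as it holds off the poles.\<close>

definition restricts_to_fibre :: "(complex \<Rightarrow> complex \<Rightarrow> complex) \<Rightarrow> complex \<Rightarrow> bool" where
  "restricts_to_fibre \<Phi> \<tau> \<longleftrightarrow>
     (\<forall>z0. \<exists>U g h. quotient_rep \<Phi> (z0, \<tau>) U g h \<and> (\<forall>\<^sub>F z in at z0. h (z, \<tau>) \<noteq> 0)) \<and>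
     (\<lambda>z. \<Phi> z \<tau>) nicely_meromorphic_on UNIV"

definition elliptic :: "(complex \<Rightarrow> complex \<Rightarrow> complex) \<Rightarrow> bool" where
  "elliptic \<Phi> \<longleftrightarrow>
     (\<forall>\<tau>\<in>upper_half_plane. \<forall>l\<in>period_lattice \<tau>. \<forall>z. \<Phi> (z + l) \<tau> = \<Phi> z \<tau>)"


section \<open>Modularity\<close>

definition modular2 :: "int \<Rightarrow> (complex \<Rightarrow> complex \<Rightarrow> complex) \<Rightarrow> bool" where
  "modular2 k \<Phi> \<longleftrightarrow>
     (\<forall>a b c d :: int. a * d - b * c = 1 \<longrightarrow>
       (\<forall>\<tau>\<in>upper_half_plane. \<forall>z.
          \<Phi> (z / (of_int c * \<tau> + of_int d)) ((of_int a * \<tau> + of_int b) / (of_int c * \<tau> + of_int d)) =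
          (of_int c * \<tau> + of_int d) powi k * \<Phi> z \<tau>))"

definition modular :: "int \<Rightarrow> (complex \<Rightarrow> complex) \<Rightarrow> bool" where
  "modular k f \<longleftrightarrow>
     (\<forall>a b c d :: int. a * d - b * c = 1 \<longrightarrow>
       (\<forall>\<tau>\<in>upper_half_plane.
          f ((of_int a * \<tau> + of_int b) / (of_int c * \<tau> + of_int d)) =
          (of_int c * \<tau> + of_int d) powi k * f \<tau>))"

text \<open>Meromorphic functions of \<open>\<tau>\<close> follow the same value convention as above. The functions
  \<open>f\<^sub>1, \<dots>, f\<^sub>\<ell>\<close> are \<open>F 1, \<dots>, F \<ell>\<close>; the identity is one of meromorphic functions, so the
  poles of \<open>f\<close> (where \<open>f\<close> takes the conventional value 0) are left out.\<close>

definition quasi_modular :: "int \<Rightarrow> (complex \<Rightarrow> complex) \<Rightarrow> bool" where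
  "quasi_modular k f \<longleftrightarrow>
     f nicely_meromorphic_on upper_half_plane \<and>
     (\<exists>(l :: nat) (F :: nat \<Rightarrow> complex \<Rightarrow> complex).
        (\<forall>i\<in>{1..l}. F i holomorphic_on upper_half_plane) \<and>
        (\<forall>a b c d :: int. a * d - b * c = 1 \<longrightarrow>
          (\<forall>\<tau>\<in>upper_half_plane. \<not> is_pole f \<tau> \<longrightarrow>
             f ((of_int a * \<tau> + of_int b) / (of_int c * \<tau> + of_int d)) =
             (of_int c * \<tau> + of_int d) powi k * f \<tau> +
             (\<Sum>i=1..l. of_int c ^ i * (of_int c * \<tau> + of_int d) powi (k - int i) * F i \<tau>))))"

text \<open>\<open>f\<close> is the modular completion of \<open>f0\<close>. The holomorphic limit \<open>\<tau>\<close>-bar \<open>\<rightarrow> \<infinity>\<close> of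
  \<open>f = (\<Sum>i\<le>N. F i \<tau> / (Im \<tau>) ^ i)\<close> is by definition the coefficient \<open>F 0\<close>.\<close>

definition is_modular_completion :: "int \<Rightarrow> (complex \<Rightarrow> complex) \<Rightarrow> (complex \<Rightarrow> complex) \<Rightarrow> bool" where
  "is_modular_completion k f0 f \<longleftrightarrow>
     modular k f \<and>
     (\<exists>(N :: nat) (F :: nat \<Rightarrow> complex \<Rightarrow> complex).
        (\<forall>i\<le>N. F i nicely_meromorphic_on upper_half_plane) \<and>
        (\<forall>\<tau>\<in>upper_half_plane. (\<forall>i\<le>N. \<not> is_pole (F i) \<tau>) \<longrightarrow>
           f \<tau> = (\<Sum>i\<le>N. F i \<tau> / of_real (Im \<tau>) ^ i)) \<and>
        (\<forall>\<tau>\<in>upper_half_plane. F 0 \<tau> = f0 \<tau>))"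


section \<open>The A-cycle and the residue pairing\<close>

text \<open>A loop on \<open>\<complex>/\<Lambda>\<^sub>\<tau>\<close> in the class of the segment from \<open>\<tau>\<close> to \<open>\<tau> + 1\<close> is the image of a path
  in \<open>\<complex>\<close> from some point \<open>p\<close> to \<open>p + 1\<close>; \<open>p\<close> is left free because \<open>\<tau>\<close> itself may be a pole.\<close>

definition A_cycle :: "(complex \<Rightarrow> complex) \<Rightarrow> (real \<Rightarrow> complex) \<Rightarrow> bool" where
  "A_cycle f \<gamma> \<longleftrightarrow>
     valid_path \<gamma> \<and> pathfinish \<gamma> = pathstart \<gamma> + 1 \<and> (\<forall>z\<in>path_image \<gamma>. \<not> is_pole f z)"

definition pole_representatives :: "complex \<Rightarrow> (complex \<Rightarrow> complex) \<Rightarrow> complex set \<Rightarrow> bool" where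
  "pole_representatives \<tau> f R \<longleftrightarrow>
     (\<forall>r\<in>R. is_pole f r) \<and>
     (\<forall>p. is_pole f p \<longrightarrow> (\<exists>!r. r \<in> R \<and> p - r \<in> period_lattice \<tau>))"

text \<open>The pairing of \<open>f dz\<close> with \<open>dz\<close>, computed with the representatives \<open>R\<close> of the poles.\<close>

definition poincare_pairing :: "(complex \<Rightarrow> complex) \<Rightarrow> complex set \<Rightarrow> complex" where
  "poincare_pairing f R = - (\<Sum>p\<in>R. residue (\<lambda>z. z * f z) p)"


section \<open>The regularized integral\<close>

text \<open>Real \<open>C\<^sup>n\<close> and \<open>C\<^sup>\<infinity>\<close> functions on an open subset of the plane; the recursion runs over the
  partial derivatives in the directions 1 and \<open>\<i>\<close>.\<close>

primrec Ck_on :: "nat \<Rightarrow> (complex \<Rightarrow> complex) \<Rightarrow> complex set \<Rightarrow> bool" where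
  "Ck_on 0 f U \<longleftrightarrow> continuous_on U f"
| "Ck_on (Suc n) f U \<longleftrightarrow>
     (\<forall>z\<in>U. f differentiable (at z)) \<and>
     Ck_on n (\<lambda>z. frechet_derivative f (at z) 1) U \<and>
     Ck_on n (\<lambda>z. frechet_derivative f (at z) \<i>) U"

definition smooth_fun_on :: "(complex \<Rightarrow> complex) \<Rightarrow> complex set \<Rightarrow> bool" where
  "smooth_fun_on f U \<longleftrightarrow> (\<forall>n. Ck_on n f U)"

text \<open>The Wirtinger derivative \<open>\<partial>/\<partial>z = (\<partial>/\<partial>x - \<i> \<partial>/\<partial>y) / 2\<close>.\<close>

definition wirtinger_deriv :: "(complex \<Rightarrow> complex) \<Rightarrow> complex \<Rightarrow> complex" where
  "wirtinger_deriv f z =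
     (frechet_derivative f (at z) 1 - \<i> * frechet_derivative f (at z) \<i>) / 2"

text \<open>A function on \<open>\<complex>/\<Lambda>\<^sub>\<tau>\<close> minus a finite set is a periodic function off the preimage \<open>S\<close> of
  that set; its values on \<open>S\<close> are irrelevant.\<close>

definition lattice_orbit :: "complex \<Rightarrow> complex set \<Rightarrow> complex set" where
  "lattice_orbit \<tau> P = {p + l | p l. p \<in> P \<and> l \<in> period_lattice \<tau>}"

definition smooth_over_power_at :: "(complex \<Rightarrow> complex) \<Rightarrow> complex \<Rightarrow> nat \<Rightarrow> bool" where
  "smooth_over_power_at f p N \<longleftrightarrow>
     (\<exists>U g. open U \<and> p \<in> U \<and> smooth_fun_on g U \<and> (\<forall>z\<in>U - {p}. f z = g z / (z - p) ^ N))"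

definition smooth_off :: "complex \<Rightarrow> complex set \<Rightarrow> (complex \<Rightarrow> complex) \<Rightarrow> bool" where
  "smooth_off \<tau> S f \<longleftrightarrow>
     smooth_fun_on f (- S) \<and> (\<forall>z\<in>- S. \<forall>l\<in>period_lattice \<tau>. f (z + l) = f z)"

text \<open>A decomposition \<open>\<omega> = \<alpha> + \<partial>\<beta>\<close> in coordinates: \<open>\<omega> = f d\<^sup>2z\<close>, \<open>\<alpha> = a d\<^sup>2z\<close> and \<open>\<beta> = b dz\<close>-bar.
  As \<open>d\<^sup>2z = \<i>/2 dz \<and> dz\<close>-bar, \<open>\<partial>\<beta> = - 2\<i> (\<partial>b/\<partial>z) d\<^sup>2z\<close>; and \<open>\<alpha>\<close> is locally
  \<open>dw/w \<and> \<beta>\<^sub>0\<close> with \<open>\<beta>\<^sub>0\<close> smooth iff \<open>a\<close> is locally a smooth function over \<open>w\<close>. Since any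
  local coordinate at \<open>p\<close> is \<open>z - p\<close> times a holomorphic unit, only \<open>w = z - p\<close> is used.\<close>

definition reg_decomposition ::
    "complex \<Rightarrow> (complex \<Rightarrow> complex) \<Rightarrow> complex set \<Rightarrow> (complex \<Rightarrow> complex) \<Rightarrow> (complex \<Rightarrow> complex) \<Rightarrow> bool" where
  "reg_decomposition \<tau> f S a b \<longleftrightarrow>
     (\<exists>P. finite P \<and> S = lattice_orbit \<tau> P) \<and>
     smooth_off \<tau> S f \<and> (\<forall>p\<in>S. \<exists>N. smooth_over_power_at f p N) \<and>
     smooth_off \<tau> S a \<and> (\<forall>p\<in>S. smooth_over_power_at a p 1) \<and>
     smooth_off \<tau> S b \<and> (\<forall>p\<in>S. \<exists>N. smooth_over_power_at b p N) \<and>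
     (\<forall>z\<in>- S. f z = a z + (- 2 * \<i>) * wirtinger_deriv b z)"

definition fundamental_parallelogram :: "complex \<Rightarrow> complex set" where
  "fundamental_parallelogram \<tau> =
     {of_real s + of_real t * \<tau> | s t. s \<in> {0..<1} \<and> t \<in> {0..<1}}"

text \<open>The regularized integral of \<open>f d\<^sup>2z\<close> over \<open>\<complex>/\<Lambda>\<^sub>\<tau>\<close>; note that \<open>d\<^sup>2z\<close> is Lebesgue measure.
  The definite description refers to the value common to all decompositions.\<close>

definition reg_integral :: "complex \<Rightarrow> (complex \<Rightarrow> complex) \<Rightarrow> complex" where
  "reg_integral \<tau> f =
     (THE I. \<exists>S a b. reg_decomposition \<tau> f S a b \<and>
        I = set_lebesgue_integral lborel (fundamental_parallelogram \<tau>) a)"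

end

theory Submission
  imports Defs
begin

text \<open>
  Fix \<open>\<tau>\<close> and let \<open>f = \<Phi>(-;\<tau>)\<close>. As \<open>f\<close> has no residues, it has a meromorphic primitive \<open>G\<close>, which
  is additive under the lattice; let \<open>A\<close> and \<open>B\<close> be its periods for \<open>1\<close> and \<open>\<tau>\<close>. For suitable
  constants \<open>\<alpha>\<close>, \<open>\<beta>\<close>, subtracting \<open>\<alpha> z\<close> and \<open>\<beta>\<close> times the conjugate of \<open>z\<close> makes \<open>G\<close> periodic, and
  \<open>f = \<alpha> + \<partial>(\<dots>)\<close> exhibits the regularized integral of \<open>f/Im \<tau>\<close> as \<open>\<alpha>\<close>, which differs from \<open>A\<close> by
  \<open>(B - \<tau> A)/(2\<i> Im \<tau>)\<close>. The residue theorem for \<open>z f(z)\<close> on a period parallelogram identifies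
  \<open>B - \<tau> A\<close> with the residue pairing (Legendre's relation), and modularity of \<open>\<Phi>\<close> makes \<open>(B, A)\<close>
  a vector-valued modular form of weight \<open>k - 1\<close>, which gives the transformation laws.

  That the regularized integral is well defined means that the integral of \<open>\<partial>c\<close> over the torus
  vanishes whenever \<open>c\<close> is smooth up to poles and \<open>\<partial>c\<close> has at most simple poles. After cutting off
  small discs it remains to see that \<open>c = g/w\<^sup>N\<close> with \<open>g\<close> smooth pairs to something small with the
  derivative of a radial cut-off function. This pairing only sees the part of \<open>g\<close> on which rotations
  act with weight \<open>N + 1\<close>, and that part vanishes to order \<open>N + 1\<close>.
\<close>


section \<open>Lebesgue measure on a period parallelogram\<close>

text \<open>The obstacle is the definite description in \<open>reg_integral\<close>: any two
  decompositions must be compared, and their difference \<open>c\<close> may have poles of any order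
  \<open>N\<close> although its derivative has at most simple ones. Paired with the derivative of a
  cut-off of radius \<open>e\<close>, such a \<open>c\<close> is naively of size
  \<open>e ^ 2 / e ^ (N + 1)\<close>, which does not tend to 0 for positive \<open>N\<close>.
  Cancellation under rotation improves the factor \<open>e ^ 2\<close> to
  \<open>e ^ (N + 2)\<close>, so that one power of \<open>e\<close> survives. Smoothness means
  iterated real differentiability here, and integration by parts along the rotation field takes the
  place of a Taylor formula, at the cost of one derivative per power of \<open>e\<close>. In the
  modular parameter, only the period for 1 needs analysis: it is an integral over a horizontal
  segment, and the height of the segment can be chosen off the bad points because these are
  countable in each fibre. The period for \<tau> is, up to a power of \<tau>, the period for 1 at
  \<open>- 1 / \<tau>\<close>, hence holomorphic as well.\<close>

lemma lborel_eq_shear: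
  fixes \<tau> :: complex
  assumes "Im \<tau> > 0"
  shows "(lborel :: complex measure) =
    density (distr (lborel \<Otimes>\<^sub>M lborel) borel (\<lambda>(s, t). of_real s + of_real t * \<tau>)) (\<lambda>_. ennreal (Im \<tau>))"
    (is "_ = density (distr _ _ ?T) _")
proof (rule lborel_eqI)
  fix l u :: complex
  assume lu: "\<And>b. b \<in> Basis \<Longrightarrow> l \<bullet> b \<le> u \<bullet> b"
  have le: "Re l \<le> Re u" "Im l \<le> Im u"
    using lu[of 1] lu[of \<i>] by (auto simp: Basis_complex_def)
  have [measurable]: "?T \<in> borel_measurable (lborel \<Otimes>\<^sub>M lborel)"
    by (auto simp: case_prod_unfold)
  have [measurable]: "box l u \<in> sets borel" by simp
  \<comment> \<open>For fixed \<open>t\<close> the box cuts out an interval in \<open>s\<close> that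
    is merely translated by \<open>- t * Re \<tau>\<close>, so its length does not depend on
    \<open>t\<close>. Only the rescaling of \<open>t\<close> by \<open>Im \<tau>\<close> changes the
    measure.\<close>
  have inner: "(\<integral>\<^sup>+ s. indicator (box l u) (of_real s + of_real t * \<tau>) \<partial>lborel) =
      ennreal (Re u - Re l) * indicator {Im l / Im \<tau> <..< Im u / Im \<tau>} t" for t
  proof -
    have "(\<integral>\<^sup>+ s. indicator (box l u) (of_real s + of_real t * \<tau>) \<partial>lborel) =
        (\<integral>\<^sup>+ s. indicator {Im l / Im \<tau> <..< Im u / Im \<tau>} t *
                 indicator {Re l - t * Re \<tau> <..< Re u - t * Re \<tau>} s \<partial>(lborel :: real measure))"
      using assms
      by (intro nn_integral_cong) (auto simp: indicator_def in_box_complex_iff field_simps)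
    also have "\<dots> = indicator {Im l / Im \<tau> <..< Im u / Im \<tau>} t * ennreal (Re u - Re l)"
      using le by (subst nn_integral_cmult) auto
    finally show ?thesis by (simp add: mult.commute)
  qed
  have "emeasure (density (distr (lborel \<Otimes>\<^sub>M lborel) borel ?T) (\<lambda>_. ennreal (Im \<tau>))) (box l u)
      = ennreal (Im \<tau>) * emeasure (distr (lborel \<Otimes>\<^sub>M lborel) borel ?T) (box l u)"
    by (simp add: emeasure_density_const)
  also have "emeasure (distr (lborel \<Otimes>\<^sub>M lborel) borel ?T) (box l u) =
      (\<integral>\<^sup>+ x. indicator (box l u) x \<partial>distr (lborel \<Otimes>\<^sub>M lborel) borel ?T)"
    by simp
  also have "\<dots> = (\<integral>\<^sup>+ z. indicator (box l u) (?T z) \<partial>(lborel \<Otimes>\<^sub>M lborel))"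
    by (subst nn_integral_distr) auto
  also have "\<dots> = (\<integral>\<^sup>+ t. (\<integral>\<^sup>+ s. indicator (box l u) (?T (s, t)) \<partial>lborel) \<partial>lborel)"
    by (subst lborel_pair.nn_integral_snd) auto
  also have "\<dots> = (\<integral>\<^sup>+ t. ennreal (Re u - Re l) * indicator {Im l / Im \<tau> <..< Im u / Im \<tau>} t \<partial>lborel)"
    by (simp add: inner)
  also have "\<dots> = ennreal (Re u - Re l) * ennreal (Im u / Im \<tau> - Im l / Im \<tau>)"
    using le assms by (subst nn_integral_cmult) (auto simp: field_simps)
  also have "ennreal (Im \<tau>) * \<dots> = ennreal (Im \<tau> * ((Re u - Re l) * (Im u / Im \<tau> - Im l / Im \<tau>)))"
    using le assms by (simp add: ennreal_mult'[symmetric] divide_right_mono)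
  also have "Im \<tau> * ((Re u - Re l) * (Im u / Im \<tau> - Im l / Im \<tau>)) = (\<Prod>b\<in>Basis. (u - l) \<bullet> b)"
    using assms by (simp add: Basis_complex_def right_diff_distrib)
  finally show "emeasure (density (distr (lborel \<Otimes>\<^sub>M lborel) borel ?T) (\<lambda>_. ennreal (Im \<tau>))) (box l u)
    = ennreal (\<Prod>b\<in>Basis. (u - l) \<bullet> b)" .
qed simp

lemma integrable_scaleR_iff:
  fixes f :: "'b \<Rightarrow> 'a :: {banach, second_countable_topology}"
  assumes "c \<noteq> 0"
  shows "integrable M (\<lambda>x. c *\<^sub>R f x) \<longleftrightarrow> integrable M f"
  using integrable_scaleR_right[of c M f] integrable_scaleR_right[of "1 / c" M "\<lambda>x. c *\<^sub>R f x"] assms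
  by auto

lemma
  fixes f :: "complex \<Rightarrow> 'a :: {banach, second_countable_topology}"
  assumes "Im \<tau> > 0" and [measurable]: "f \<in> borel_measurable borel"
  shows integrable_shear_iff: "integrable lborel f \<longleftrightarrow>
      integrable (lborel \<Otimes>\<^sub>M lborel) (\<lambda>(s, t). f (of_real s + of_real t * \<tau>))"
    and integral_shear: "(\<integral>z. f z \<partial>lborel) =
      Im \<tau> *\<^sub>R (\<integral>(s, t). f (of_real s + of_real t * \<tau>) \<partial>(lborel \<Otimes>\<^sub>M lborel))"
proof -
  have [measurable]: "(\<lambda>(s, t). of_real s + of_real t * \<tau>) \<in> borel_measurable (lborel \<Otimes>\<^sub>M lborel)"
    by (auto simp: case_prod_unfold)
  show "integrable lborel f \<longleftrightarrow>
      integrable (lborel \<Otimes>\<^sub>M lborel) (\<lambda>(s, t). f (of_real s + of_real t * \<tau>))"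
    using assms(1)
    by (subst lborel_eq_shear[OF assms(1)])
       (simp add: integrable_density integrable_distr_eq case_prod_unfold integrable_scaleR_iff)
  show "(\<integral>z. f z \<partial>lborel) =
      Im \<tau> *\<^sub>R (\<integral>(s, t). f (of_real s + of_real t * \<tau>) \<partial>(lborel \<Otimes>\<^sub>M lborel))"
    using assms(1)
    by (subst lborel_eq_shear[OF assms(1)])
       (simp add: integral_density integral_distr case_prod_unfold)
qed


lemma
  fixes f :: "complex \<Rightarrow> 'a :: {banach, second_countable_topology}"
  shows integrable_lborel_translate: "integrable lborel f \<Longrightarrow> integrable lborel (\<lambda>z. f (c + z))"
    and integral_lborel_translate: "f \<in> borel_measurable borel \<Longrightarrow>
      (\<integral>z. f (c + z) \<partial>lborel) = (\<integral>z. f z \<partial>lborel)"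
proof -
  show "integrable lborel (\<lambda>z. f (c + z))" if "integrable lborel f"
  proof -
    have "integrable (distr lborel borel ((+) c)) f"
      using that by (simp add: lborel_distr_plus)
    then show ?thesis
      using borel_measurable_integrable[OF that] by (subst (asm) integrable_distr_eq) auto
  qed
  show "(\<integral>z. f (c + z) \<partial>lborel) = (\<integral>z. f z \<partial>lborel)" if "f \<in> borel_measurable borel"
  proof -
    have "(\<integral>z. f z \<partial>lborel) = (\<integral>z. f z \<partial>distr lborel borel ((+) c))"
      by (simp add: lborel_distr_plus)
    also have "\<dots> = (\<integral>z. f (c + z) \<partial>lborel)"
      using that by (subst integral_distr) auto
    finally show ?thesis by simp
  qed
qed

text \<open>The two coordinate functions of the real basis \<open>1, \<tau>\<close> of the plane.
  Membership in parallelograms becomes a pair of inequalities, membership in the lattice a pair of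
  integrality conditions.\<close>

definition coord1 :: "complex \<Rightarrow> complex \<Rightarrow> real" where
  "coord1 \<tau> z = Re z - Im z / Im \<tau> * Re \<tau>"

definition coord2 :: "complex \<Rightarrow> complex \<Rightarrow> real" where
  "coord2 \<tau> z = Im z / Im \<tau>"

lemma coord_eq: "Im \<tau> > 0 \<Longrightarrow> z = of_real (coord1 \<tau> z) + of_real (coord2 \<tau> z) * \<tau>"
  by (auto simp: coord1_def coord2_def complex_eq_iff)

lemma coord1_simps [simp]:
  assumes "Im \<tau> > 0"
  shows "coord1 \<tau> (of_real s) = s" "coord1 \<tau> (of_real t * \<tau>) = 0" "coord1 \<tau> (z + w) = coord1 \<tau> z + coord1 \<tau> w"
    "coord1 \<tau> (z - w) = coord1 \<tau> z - coord1 \<tau> w"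
  using assms by (auto simp: coord1_def field_simps)

lemma coord2_simps [simp]:
  assumes "Im \<tau> > 0"
  shows "coord2 \<tau> (of_real s) = 0" "coord2 \<tau> (of_real t * \<tau>) = t" "coord2 \<tau> (z + w) = coord2 \<tau> z + coord2 \<tau> w"
    "coord2 \<tau> (z - w) = coord2 \<tau> z - coord2 \<tau> w"
  using assms by (auto simp: coord2_def field_simps)

lemma continuous_on_coord [continuous_intros]:
  "continuous_on A (coord1 \<tau>)" "continuous_on A (coord2 \<tau>)"
  unfolding coord1_def coord2_def divide_inverse by (intro continuous_intros)+

lemma fundamental_parallelogram_iff:
  assumes "Im \<tau> > 0"
  shows "z \<in> fundamental_parallelogram \<tau> \<longleftrightarrow> coord1 \<tau> z \<in> {0..<1} \<and> coord2 \<tau> z \<in> {0..<1}"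
proof
  show "coord1 \<tau> z \<in> {0..<1} \<and> coord2 \<tau> z \<in> {0..<1}" if "z \<in> fundamental_parallelogram \<tau>"
    using that assms by (auto simp: fundamental_parallelogram_def)
  show "z \<in> fundamental_parallelogram \<tau>" if "coord1 \<tau> z \<in> {0..<1} \<and> coord2 \<tau> z \<in> {0..<1}"
    using that coord_eq[OF assms, of z] by (auto simp: fundamental_parallelogram_def)
qed

lemma fundamental_parallelogram_borel [measurable]:
  assumes "Im \<tau> > 0"
  shows "fundamental_parallelogram \<tau> \<in> sets borel"
proof -
  have [measurable]: "coord1 \<tau> \<in> borel_measurable borel" "coord2 \<tau> \<in> borel_measurable borel"
    by (auto intro!: borel_measurable_continuous_onI continuous_intros)
  have "fundamental_parallelogram \<tau> = {z \<in> space borel. coord1 \<tau> z \<in> {0..<1} \<and> coord2 \<tau> z \<in> {0..<1}}"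
    using fundamental_parallelogram_iff[OF assms] by auto
  also have "\<dots> \<in> sets borel" by measurable
  finally show ?thesis .
qed

text \<open>The corner \<open>q\<close> is left free so that the boundary can later be moved off a
  countable set of singularities.\<close>

definition parallelogram :: "complex \<Rightarrow> complex \<Rightarrow> complex set" where
  "parallelogram \<tau> q = {z. z - q \<in> fundamental_parallelogram \<tau>}"

definition closed_parallelogram :: "complex \<Rightarrow> complex \<Rightarrow> complex set" where
  "closed_parallelogram \<tau> q = (\<lambda>(s, t). q + of_real s + of_real t * \<tau>) ` ({0..1} \<times> {0..1})"

lemma parallelogram_0 [simp]: "parallelogram \<tau> 0 = fundamental_parallelogram \<tau>"
  by (auto simp: parallelogram_def)

lemma compact_closed_parallelogram: "compact (closed_parallelogram \<tau> q)"
  unfolding closed_parallelogram_def case_prod_unfold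
  by (intro compact_continuous_image compact_Times continuous_intros) auto

lemma parallelogram_subset: "parallelogram \<tau> q \<subseteq> closed_parallelogram \<tau> q"
proof
  fix z assume "z \<in> parallelogram \<tau> q"
  then obtain s t where "z - q = of_real s + of_real t * \<tau>" "s \<in> {0..<1}" "t \<in> {0..<1}"
    by (auto simp: parallelogram_def fundamental_parallelogram_def)
  then have "z = (\<lambda>(s, t). q + of_real s + of_real t * \<tau>) (s, t)" "(s, t) \<in> {0..1} \<times> {0..1}"
    by (auto simp: algebra_simps)
  then show "z \<in> closed_parallelogram \<tau> q" unfolding closed_parallelogram_def by blast
qed

lemma parallelogram_borel [measurable]:
  assumes "Im \<tau> > 0"
  shows "parallelogram \<tau> q \<in> sets borel"
proof -
  note [measurable] = fundamental_parallelogram_borel[OF assms]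
  have "parallelogram \<tau> q = {z \<in> space borel. z - q \<in> fundamental_parallelogram \<tau>}"
    by (auto simp: parallelogram_def)
  also have "\<dots> \<in> sets borel" by measurable
  finally show ?thesis .
qed

lemma continuous_closed_parallelogram_integrable:
  fixes h :: "complex \<Rightarrow> complex"
  assumes "Im \<tau> > 0" "continuous_on (closed_parallelogram \<tau> q) h"
  shows "set_integrable lborel (parallelogram \<tau> q) h"
proof (rule set_integrable_subset)
  show "set_integrable lborel (closed_parallelogram \<tau> q) h"
    using borel_integrable_compact[OF compact_closed_parallelogram assms(2)]
    by (simp add: set_integrable_def)
qed (use parallelogram_subset parallelogram_borel[OF assms(1)] in auto)

text \<open>Fubini in sheared coordinates. Both orders are kept because a derivative in direction 1
  is integrated out along \<open>s\<close> and one in direction \<tau> along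
  \<open>t\<close>.\<close>

lemma parallelogram_integral_iterated:
  fixes h :: "complex \<Rightarrow> complex"
  assumes \<tau>: "Im \<tau> > 0" and h: "continuous_on (closed_parallelogram \<tau> q) h"
  defines "H \<equiv> \<lambda>s t. indicator {0..<1} s *\<^sub>R indicator {0..<1} t *\<^sub>R h (q + of_real s + of_real t * \<tau>)"
  shows "set_lebesgue_integral lborel (parallelogram \<tau> q) h =
      Im \<tau> *\<^sub>R (\<integral>t. (\<integral>s. H s t \<partial>lborel) \<partial>lborel)" (is ?A)
    and "set_lebesgue_integral lborel (parallelogram \<tau> q) h =
      Im \<tau> *\<^sub>R (\<integral>s. (\<integral>t. H s t \<partial>lborel) \<partial>lborel)" (is ?B)
proof -
  define f where "f = (\<lambda>z. indicator (parallelogram \<tau> q) z *\<^sub>R h z)"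
  have int: "integrable lborel f"
    using continuous_closed_parallelogram_integrable[OF \<tau> h] by (simp add: f_def set_integrable_def)
  then have int': "integrable lborel (\<lambda>z. f (q + z))" by (rule integrable_lborel_translate)
  have H: "f (q + (of_real s + of_real t * \<tau>)) = H s t" for s t
    using \<tau> by (auto simp: f_def H_def parallelogram_def fundamental_parallelogram_iff indicator_def add_ac)
  have meas: "f \<in> borel_measurable borel" "(\<lambda>z. f (q + z)) \<in> borel_measurable borel"
    using borel_measurable_integrable[OF int] borel_measurable_integrable[OF int'] by simp_all
  have intH: "integrable (lborel \<Otimes>\<^sub>M lborel) (\<lambda>(s, t). H s t)"
    using int' by (subst (asm) integrable_shear_iff[OF \<tau> meas(2)]) (simp add: H)
  have "set_lebesgue_integral lborel (parallelogram \<tau> q) h = (\<integral>z. f (q + z) \<partial>lborel)"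
    by (simp add: integral_lborel_translate[OF meas(1)]) (simp add: f_def set_lebesgue_integral_def)
  also have "\<dots> = Im \<tau> *\<^sub>R (\<integral>(s, t). H s t \<partial>(lborel \<Otimes>\<^sub>M lborel))"
    by (subst integral_shear[OF \<tau> meas(2)]) (simp add: H)
  finally have *: "set_lebesgue_integral lborel (parallelogram \<tau> q) h =
    Im \<tau> *\<^sub>R (\<integral>(s, t). H s t \<partial>(lborel \<Otimes>\<^sub>M lborel))" .
  show ?A using * lborel_pair.integral_snd[OF intH] by simp
  show ?B using * lborel_pair.integral_fst'[OF intH] by simp
qed

text \<open>The half-open interval comes from parallelograms that tile the plane; the endpoint it
  lacks is a null set.\<close>

lemma integral_FTC_Ico_closed:
  fixes F :: "real \<Rightarrow> complex"
  assumes "\<And>x. x \<in> {0..1} \<Longrightarrow> (F has_vector_derivative f x) (at x within {0..1})"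
    and "continuous_on {0..1} f" "F 0 = F 1"
  shows "(\<integral>x. indicator {0..<1} x *\<^sub>R f x \<partial>lborel) = 0"
proof -
  have "(\<integral>x. indicator {0..<1} x *\<^sub>R f x \<partial>lborel) = (\<integral>x. indicator {0..1} x *\<^sub>R f x \<partial>lborel)"
    unfolding set_lebesgue_integral_def[symmetric]
    by (rule set_integral_discrete_difference[of "{1}"]) auto
  also have "\<dots> = F 1 - F 0"
    using assms by (intro integral_FTC_Icc) auto
  finally show ?thesis using assms by simp
qed

lemma has_vector_derivative_along_line:
  fixes u :: "complex \<Rightarrow> complex"
  assumes "u differentiable (at (a + of_real s * v))"
  shows "((\<lambda>s. u (a + of_real s * v)) has_vector_derivative
    frechet_derivative u (at (a + of_real s * v)) v) (at s within A)"
proof -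
  have u: "(u has_derivative frechet_derivative u (at (a + of_real s * v)))
      (at (a + of_real s * v) within (\<lambda>s. a + of_real s * v) ` A)"
    using assms frechet_derivative_works has_derivative_at_withinI by blast
  have "((\<lambda>s. a + of_real s * v) has_vector_derivative v) (at s within A)"
    by (auto intro!: derivative_eq_intros simp: has_vector_derivative_def scaleR_conv_of_real)
  from vector_derivative_diff_chain_within[OF this u] show ?thesis by (simp add: o_def)
qed

lemma frechet_derivative_lincomb:
  fixes u :: "complex \<Rightarrow> complex"
  assumes "u differentiable (at z)"
  shows "frechet_derivative u (at z) (of_real a * v + of_real b * w) =
    of_real a * frechet_derivative u (at z) v + of_real b * frechet_derivative u (at z) w"
proof -
  have l: "linear (frechet_derivative u (at z))"
    using assms by (simp add: linear_frechet_derivative)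
  show ?thesis
    using linear_add[OF l, of "a *\<^sub>R v" "b *\<^sub>R w"] linear_scale[OF l]
    by (simp add: scaleR_conv_of_real)
qed

lemma frechet_derivative_combine:
  fixes u :: "complex \<Rightarrow> complex"
  assumes "u differentiable (at z)"
  shows "frechet_derivative u (at z) v =
    of_real (Re v) * frechet_derivative u (at z) 1 + of_real (Im v) * frechet_derivative u (at z) \<i>"
proof -
  have "of_real (Re v) * 1 + of_real (Im v) * \<i> = v" by (simp add: complex_eq_iff)
  then show ?thesis
    using frechet_derivative_lincomb[OF assms, of "Re v" 1 "Im v" \<i>] by simp
qed

text \<open>Green's theorem in the form needed for tori. Only the values on opposite sides are
  compared, so \<open>u\<close> need not be periodic elsewhere; this matters because it is applied
  to functions cut off only at the singularities inside one parallelogram.\<close>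

lemma integral_derivative_parallelogram_0:
  fixes u :: "complex \<Rightarrow> complex"
  assumes \<tau>: "Im \<tau> > 0"
    and diff: "\<And>z. z \<in> closed_parallelogram \<tau> q \<Longrightarrow> u differentiable (at z)"
    and cont: "continuous_on (closed_parallelogram \<tau> q) (\<lambda>z. frechet_derivative u (at z) 1)"
      "continuous_on (closed_parallelogram \<tau> q) (\<lambda>z. frechet_derivative u (at z) \<i>)"
    and sides: "\<And>t. t \<in> {0..1} \<Longrightarrow> u (q + 1 + of_real t * \<tau>) = u (q + of_real t * \<tau>)"
      "\<And>s. s \<in> {0..1} \<Longrightarrow> u (q + of_real s + \<tau>) = u (q + of_real s)"
  shows "set_lebesgue_integral lborel (parallelogram \<tau> q) (\<lambda>z. frechet_derivative u (at z) v) = 0"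
proof -
  let ?C = "closed_parallelogram \<tau> q"
  have cont': "continuous_on ?C (\<lambda>z. frechet_derivative u (at z) w)" for w
    using diff by (subst continuous_on_cong[OF refl frechet_derivative_combine])
      (auto intro!: continuous_intros cont)
  have inC: "q + of_real s + of_real t * \<tau> \<in> ?C" if "s \<in> {0..1}" "t \<in> {0..1}" for s t
    using that by (force simp: closed_parallelogram_def)
  have 1: "set_lebesgue_integral lborel (parallelogram \<tau> q) (\<lambda>z. frechet_derivative u (at z) 1) = 0"
  proof -
    have "(\<integral>s. indicator {0..<1} s *\<^sub>R indicator {0..<1} t *\<^sub>R
        frechet_derivative u (at (q + of_real s + of_real t * \<tau>)) 1 \<partial>lborel) = 0" for t :: real
    proof (cases "t \<in> {0..<1}")
      case True
      have "(\<integral>s. indicator {0..<1} s *\<^sub>R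
          frechet_derivative u (at (q + of_real s + of_real t * \<tau>)) 1 \<partial>lborel) = 0"
      proof (rule integral_FTC_Ico_closed[where F = "\<lambda>s. u (q + of_real s + of_real t * \<tau>)"])
        fix s :: real assume s: "s \<in> {0..1}"
        have e: "q + of_real t * \<tau> + of_real s * 1 = q + of_real s + of_real t * \<tau>" for s :: real by simp
        show "((\<lambda>s. u (q + of_real s + of_real t * \<tau>)) has_vector_derivative
          frechet_derivative u (at (q + of_real s + of_real t * \<tau>)) 1) (at s within {0..1})"
          using has_vector_derivative_along_line[of u "q + of_real t * \<tau>" s 1 "{0..1}"] diff[OF inC[of s t]] s True
          by (simp add: e del: mult_1_right)
      next
        show "continuous_on {0..1} (\<lambda>s. frechet_derivative u (at (q + of_real s + of_real t * \<tau>)) 1)"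
          using True inC by (intro continuous_on_compose2[OF cont(1)] continuous_intros) auto
      qed (use sides(1)[of t] True in \<open>auto simp: add_ac\<close>)
      then show ?thesis using True by simp
    qed simp
    then show ?thesis
      by (subst parallelogram_integral_iterated(1)[OF \<tau> cont']) simp
  qed
  have 2: "set_lebesgue_integral lborel (parallelogram \<tau> q) (\<lambda>z. frechet_derivative u (at z) \<tau>) = 0"
  proof -
    have "(\<integral>t. indicator {0..<1} s *\<^sub>R indicator {0..<1} t *\<^sub>R
        frechet_derivative u (at (q + of_real s + of_real t * \<tau>)) \<tau> \<partial>lborel) = 0" for s :: real
    proof (cases "s \<in> {0..<1}")
      case True
      have "(\<integral>t. indicator {0..<1} t *\<^sub>R
          frechet_derivative u (at (q + of_real s + of_real t * \<tau>)) \<tau> \<partial>lborel) = 0"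
      proof (rule integral_FTC_Ico_closed[where F = "\<lambda>t. u (q + of_real s + of_real t * \<tau>)"])
        fix t :: real assume t: "t \<in> {0..1}"
        show "((\<lambda>t. u (q + of_real s + of_real t * \<tau>)) has_vector_derivative
          frechet_derivative u (at (q + of_real s + of_real t * \<tau>)) \<tau>) (at t within {0..1})"
          using has_vector_derivative_along_line[of u "q + of_real s" t \<tau> "{0..1}"] diff[OF inC[of s t]] t True
          by simp
      next
        show "continuous_on {0..1} (\<lambda>t. frechet_derivative u (at (q + of_real s + of_real t * \<tau>)) \<tau>)"
          using True inC by (intro continuous_on_compose2[OF cont'[of \<tau>]] continuous_intros) auto
      qed (use sides(2)[of s] True in auto)
      then show ?thesis using True by simp
    qed simp
    then show ?thesis
      by (subst parallelogram_integral_iterated(2)[OF \<tau> cont']) simp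
  qed
  \<comment> \<open>The derivative is real-linear in its direction, so the directions 1 and \<tau>
    suffice.\<close>
  define a b where "a = complex_of_real (coord1 \<tau> v)" and "b = complex_of_real (coord2 \<tau> v)"
  have eq: "frechet_derivative u (at z) v =
      a * frechet_derivative u (at z) 1 + b * frechet_derivative u (at z) \<tau>"
    if "z \<in> parallelogram \<tau> q" for z
  proof -
    have "u differentiable (at z)"
      using diff that parallelogram_subset by blast
    from frechet_derivative_lincomb[OF this, of "coord1 \<tau> v" 1 "coord2 \<tau> v" \<tau>] show ?thesis
      by (simp add: a_def b_def coord_eq[OF \<tau>, symmetric])
  qed
  have int: "set_integrable lborel (parallelogram \<tau> q) (\<lambda>z. c * frechet_derivative u (at z) w)" for c w
    by (intro continuous_closed_parallelogram_integrable[OF \<tau>] continuous_intros cont')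
  have "set_lebesgue_integral lborel (parallelogram \<tau> q) (\<lambda>z. frechet_derivative u (at z) v) =
    set_lebesgue_integral lborel (parallelogram \<tau> q)
      (\<lambda>z. a * frechet_derivative u (at z) 1 + b * frechet_derivative u (at z) \<tau>)"
    using eq parallelogram_borel[OF \<tau>] by (intro set_lebesgue_integral_cong) auto
  also have "\<dots> = a * set_lebesgue_integral lborel (parallelogram \<tau> q) (\<lambda>z. frechet_derivative u (at z) 1) +
      b * set_lebesgue_integral lborel (parallelogram \<tau> q) (\<lambda>z. frechet_derivative u (at z) \<tau>)"
    by (subst set_integral_add(2)[OF int int]) simp
  finally show ?thesis by (simp add: 1 2)
qed



section \<open>Integrability of the singularity \<open>1 / norm z\<close> in the plane\<close>

lemma nn_integral_shear:
  fixes f :: "complex \<Rightarrow> ennreal"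
  assumes "Im \<tau> > 0" and [measurable]: "f \<in> borel_measurable borel"
  shows "(\<integral>\<^sup>+z. f z \<partial>lborel) =
    ennreal (Im \<tau>) * (\<integral>\<^sup>+t. (\<integral>\<^sup>+s. f (of_real s + of_real t * \<tau>) \<partial>lborel) \<partial>lborel)"
proof -
  have [measurable]: "(\<lambda>(s, t). of_real s + of_real t * \<tau>) \<in> borel_measurable (lborel \<Otimes>\<^sub>M lborel)"
    by (auto simp: case_prod_unfold)
  have "(\<integral>\<^sup>+z. f z \<partial>lborel) =
      ennreal (Im \<tau>) * (\<integral>\<^sup>+(s, t). f (of_real s + of_real t * \<tau>) \<partial>(lborel \<Otimes>\<^sub>M lborel))"
    by (subst lborel_eq_shear[OF assms(1)])
       (simp add: nn_integral_density nn_integral_distr nn_integral_cmult case_prod_unfold)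
  also have "(\<integral>\<^sup>+(s, t). f (of_real s + of_real t * \<tau>) \<partial>(lborel \<Otimes>\<^sub>M lborel)) =
      (\<integral>\<^sup>+t. (\<integral>\<^sup>+s. f (of_real s + of_real t * \<tau>) \<partial>lborel) \<partial>lborel)"
    by (subst lborel_pair.nn_integral_snd[symmetric]) (auto simp: case_prod_unfold)
  finally show ?thesis .
qed

lemma nn_integral_abs_powr_half:
  assumes "c \<ge> 0"
  shows "(\<integral>\<^sup>+x. ennreal (indicator {-c..c} x * \<bar>x\<bar> powr (-1/2)) \<partial>lborel) = ennreal (4 * sqrt c)"
proof -
  have *: "((\<lambda>x. x powr (-1/2)) has_integral 2 * sqrt c) {0..c}"
    using has_integral_powr_from_0[of "-1/2" c] assms by (simp add: powr_half_sqrt mult.commute)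
  then have r: "((\<lambda>x. \<bar>x\<bar> powr (-1/2)) has_integral 2 * sqrt c) {0..c}"
    by (rule has_integral_eq[rotated]) auto
  then have "((\<lambda>x. \<bar>-x\<bar> powr (-1/2)) has_integral 2 * sqrt c) {-c..-0}"
    by (rule has_integral_reflect_real[THEN iffD2])
  then have "((\<lambda>x. \<bar>x\<bar> powr (-1/2)) has_integral 2 * sqrt c) {-c..0}" by simp
  from has_integral_combine[OF _ _ this r] assms
  have "((\<lambda>x. \<bar>x\<bar> powr (-1/2)) has_integral 4 * sqrt c) {-c..c}" by simp
  then have "(\<integral>\<^sup>+x. ennreal (\<bar>x\<bar> powr (-1/2)) * indicator {-c..c} x \<partial>lborel) = ennreal (4 * sqrt c)"
    by (rule nn_integral_has_integral_lebesgue'[rotated]) auto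
  moreover have "ennreal (indicator {-c..c} x * \<bar>x\<bar> powr (-1/2)) = ennreal (\<bar>x\<bar> powr (-1/2)) * indicator {-c..c} x" for x
    by (simp add: indicator_def)
  ultimately show ?thesis by simp
qed

text \<open>From \<open>\<bar>s\<bar> * \<bar>t\<bar> \<le> s\<^sup>2 + t\<^sup>2\<close>. The bound
  is a product of integrable functions of one variable each, which replaces polar
  coordinates.\<close>

lemma inverse_norm_le_powr:
  assumes "s \<noteq> 0" "t \<noteq> 0"
  shows "1 / norm (Complex s t) \<le> \<bar>s\<bar> powr (-1/2) * \<bar>t\<bar> powr (-1/2)"
proof -
  have "\<bar>s\<bar> * \<bar>t\<bar> \<le> s\<^sup>2 + t\<^sup>2"
    using sum_squares_bound[of "\<bar>s\<bar>" "\<bar>t\<bar>"] mult_nonneg_nonneg[OF abs_ge_zero[of s] abs_ge_zero[of t]]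
    unfolding power2_abs by linarith
  then have "sqrt (\<bar>s\<bar> * \<bar>t\<bar>) \<le> norm (Complex s t)"
    by (simp add: complex_norm)
  moreover have "sqrt (\<bar>s\<bar> * \<bar>t\<bar>) > 0" using assms by simp
  ultimately have "1 / norm (Complex s t) \<le> 1 / sqrt (\<bar>s\<bar> * \<bar>t\<bar>)"
    by (intro divide_left_mono) (auto intro!: mult_pos_pos)
  also have "\<dots> = \<bar>s\<bar> powr (-1/2) * \<bar>t\<bar> powr (-1/2)"
  proof -
    have *: "\<bar>x\<bar> powr (-1/2) = 1 / sqrt \<bar>x\<bar>" for x :: real
      using powr_minus_divide[of "\<bar>x\<bar>" "1/2"] by (simp add: powr_half_sqrt)
    show ?thesis unfolding * by (simp add: real_sqrt_mult)
  qed
  finally show ?thesis .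
qed

text \<open>The constant is \<open>(4 * sqrt e)\<^sup>2\<close>, from the product bound on the
  square around the disc. The exact factor would be \<open>2 * pi\<close>; only linearity in
  \<open>e\<close> matters.\<close>

lemma nn_integral_inverse_norm:
  fixes p :: complex
  assumes "e \<ge> 0"
  shows "(\<integral>\<^sup>+z. ennreal (indicator (ball p e) z / norm (z - p)) \<partial>lborel) \<le> ennreal (16 * e)"
proof -
  let ?g = "\<lambda>z::complex. ennreal (indicator (ball 0 e) z / norm z)"
  have [measurable]: "ball q e \<in> sets borel" for q :: complex by simp
  let ?h = "\<lambda>s::real. ennreal (indicator {-e..e} s * \<bar>s\<bar> powr (-1/2))"
  have "(\<integral>\<^sup>+z. ennreal (indicator (ball p e) z / norm (z - p)) \<partial>lborel) =
    (\<integral>\<^sup>+z. ennreal (indicator (ball p e) z / norm (z - p)) \<partial>distr lborel borel ((+) p))"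
    by (simp add: lborel_distr_plus)
  also have "\<dots> = (\<integral>\<^sup>+z. ?g z \<partial>lborel)"
    by (subst nn_integral_distr) (auto intro!: nn_integral_cong simp: indicator_def dist_norm)
  \<comment> \<open>For \<tau> equal to \<open>\<i>\<close> the shear is the usual identification of
    the plane with pairs of reals.\<close>
  also have "\<dots> = (\<integral>\<^sup>+t. (\<integral>\<^sup>+s. ?g (of_real s + of_real t * \<i>) \<partial>lborel) \<partial>lborel)"
    by (subst nn_integral_shear[of \<i>]) auto
  also have "\<dots> \<le> (\<integral>\<^sup>+t. (\<integral>\<^sup>+s. ?h s * ?h t \<partial>lborel) \<partial>lborel)"
  proof (rule nn_integral_mono_AE)
    show "AE t in lborel. (\<integral>\<^sup>+s. ?g (of_real s + of_real t * \<i>) \<partial>lborel) \<le> (\<integral>\<^sup>+s. ?h s * ?h t \<partial>lborel)"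
      using AE_lborel_singleton[of "0::real"]
    proof eventually_elim
      case (elim t)
      show ?case
      proof (rule nn_integral_mono_AE)
        show "AE s in lborel. ?g (of_real s + of_real t * \<i>) \<le> ?h s * ?h t"
          using AE_lborel_singleton[of "0::real"]
        proof eventually_elim
          case s: (elim s)
          have e: "of_real s + of_real t * \<i> = Complex s t" by (simp add: complex_eq_iff)
          show ?case
          proof (cases "Complex s t \<in> ball 0 e")
            case True
            then have "\<bar>s\<bar> \<le> e" "\<bar>t\<bar> \<le> e"
              using abs_Re_le_cmod[of "Complex s t"] abs_Im_le_cmod[of "Complex s t"] by auto
            then show ?thesis
              using inverse_norm_le_powr[OF s elim] True
              by (simp add: e ennreal_mult'[symmetric] indicator_def abs_le_iff)
          qed (simp add: e)
        qed
      qed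
    qed
  qed
  also have "\<dots> = (\<integral>\<^sup>+t. (\<integral>\<^sup>+s. ?h s \<partial>lborel) * ?h t \<partial>lborel)"
    by (intro nn_integral_cong nn_integral_multc) auto
  also have "\<dots> = (\<integral>\<^sup>+s. ?h s \<partial>lborel) * (\<integral>\<^sup>+t. ?h t \<partial>lborel)"
    by (rule nn_integral_cmult) auto
  also have "\<dots> = ennreal (4 * sqrt e) * ennreal (4 * sqrt e)"
    unfolding nn_integral_abs_powr_half[OF assms] ..
  also have "\<dots> = ennreal (16 * e)"
    using assms by (simp add: ennreal_mult'[symmetric] )
  finally show ?thesis .
qed

text \<open>The bound is linear in the radius, so whatever has at most a simple pole contributes
  nothing in the limit of shrinking discs.\<close>

lemma
  fixes f :: "complex \<Rightarrow> complex"
  assumes [measurable]: "f \<in> borel_measurable borel" and "e \<ge> 0" "C \<ge> 0"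
    and le: "\<And>z. z \<in> ball p e \<Longrightarrow> z \<noteq> p \<Longrightarrow> norm (f z) \<le> C / norm (z - p)"
  shows set_integrable_ball_inverse_norm: "set_integrable lborel (ball p e) f"
    and norm_integral_ball_inverse_norm: "norm (set_lebesgue_integral lborel (ball p e) f) \<le> 16 * C * e"
proof -
  let ?f = "\<lambda>z. indicator (ball p e) z *\<^sub>R f z"
  have [measurable]: "ball p e \<in> sets borel" by simp
  have "(\<integral>\<^sup>+z. ennreal (norm (?f z)) \<partial>lborel) \<le>
      (\<integral>\<^sup>+z. ennreal C * ennreal (indicator (ball p e) z / norm (z - p)) \<partial>lborel)"
  proof (rule nn_integral_mono_AE)
    show "AE z in lborel. ennreal (norm (?f z)) \<le> ennreal C * ennreal (indicator (ball p e) z / norm (z - p))"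
      using AE_lborel_singleton[of p]
    proof eventually_elim
      case (elim z)
      then show ?case
        using le[of z] \<open>C \<ge> 0\<close> by (auto simp: ennreal_mult'[symmetric] indicator_def intro!: ennreal_leI)
    qed
  qed
  also have "\<dots> = ennreal C * (\<integral>\<^sup>+z. ennreal (indicator (ball p e) z / norm (z - p)) \<partial>lborel)"
    by (rule nn_integral_cmult) auto
  also have "\<dots> \<le> ennreal C * ennreal (16 * e)"
    by (intro mult_left_mono nn_integral_inverse_norm assms) auto
  also have "\<dots> = ennreal (16 * C * e)"
    using assms by (simp add: ennreal_mult'[symmetric] mult_ac)
  finally have le': "(\<integral>\<^sup>+z. ennreal (norm (?f z)) \<partial>lborel) \<le> ennreal (16 * C * e)" .
  also have "\<dots> < \<infinity>" by simp
  finally have int: "integrable lborel ?f"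
    by (intro integrableI_bounded) auto
  then show "set_integrable lborel (ball p e) f" by (simp add: set_integrable_def)
  have "ennreal (norm (\<integral>z. ?f z \<partial>lborel)) \<le> ennreal (16 * C * e)"
    using integral_norm_bound_ennreal[OF int] le' by (rule order_trans)
  then show "norm (set_lebesgue_integral lborel (ball p e) f) \<le> 16 * C * e"
    using assms by (simp add: set_lebesgue_integral_def)
qed

section \<open>The period lattice and its tilings by parallelograms\<close>

lemma period_lattice_iff:
  assumes "Im \<tau> > 0"
  shows "l \<in> period_lattice \<tau> \<longleftrightarrow> coord1 \<tau> l \<in> \<int> \<and> coord2 \<tau> l \<in> \<int>"
proof
  assume "l \<in> period_lattice \<tau>"
  then obtain m n where "l = of_int m + of_int n * \<tau>" by (auto simp: period_lattice_def)
  then have "l = of_real (of_int m) + of_real (of_int n) * \<tau>" by simp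
  then show "coord1 \<tau> l \<in> \<int> \<and> coord2 \<tau> l \<in> \<int>" using assms by (simp del: of_real_of_int_eq)
next
  assume "coord1 \<tau> l \<in> \<int> \<and> coord2 \<tau> l \<in> \<int>"
  then obtain m n where "coord1 \<tau> l = of_int m" "coord2 \<tau> l = of_int n" by (auto elim!: Ints_cases)
  with coord_eq[OF assms, of l] have "l = of_int m + of_int n * \<tau>" by simp
  then show "l \<in> period_lattice \<tau>" by (auto simp: period_lattice_def)
qed

lemma coord_eqI: "Im \<tau> > 0 \<Longrightarrow> coord1 \<tau> z = coord1 \<tau> w \<Longrightarrow> coord2 \<tau> z = coord2 \<tau> w \<Longrightarrow> z = w"
  by (metis coord_eq)

lemma period_lattice_add: "l \<in> period_lattice \<tau> \<Longrightarrow> m \<in> period_lattice \<tau> \<Longrightarrow> l + m \<in> period_lattice \<tau>"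
  unfolding period_lattice_def
proof clarify
  fix a b c d :: int
  show "\<exists>m n. of_int a + of_int b * \<tau> + (of_int c + of_int d * \<tau>) = of_int m + of_int n * \<tau> \<and> True"
    by (intro exI[of _ "a + c"] exI[of _ "b + d"]) (simp add: algebra_simps)
qed

lemma period_lattice_uminus: "l \<in> period_lattice \<tau> \<Longrightarrow> - l \<in> period_lattice \<tau>"
  unfolding period_lattice_def
proof clarify
  fix a b :: int
  show "\<exists>m n. - (of_int a + of_int b * \<tau>) = of_int m + of_int n * \<tau> \<and> True"
    by (intro exI[of _ "- a"] exI[of _ "- b"]) (simp add: algebra_simps)
qed

lemma period_lattice_diff: "l \<in> period_lattice \<tau> \<Longrightarrow> m \<in> period_lattice \<tau> \<Longrightarrow> l - m \<in> period_lattice \<tau>"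
  using period_lattice_add[of l \<tau> "- m"] period_lattice_uminus[of m \<tau>] by simp

lemma period_lattice_basic [simp]: "0 \<in> period_lattice \<tau>" "1 \<in> period_lattice \<tau>" "\<tau> \<in> period_lattice \<tau>"
proof -
  show "0 \<in> period_lattice \<tau>" unfolding period_lattice_def by clarify (intro exI[of _ 0], simp)
  show "1 \<in> period_lattice \<tau>" unfolding period_lattice_def
    by clarify (intro exI[of _ 1] exI[of _ 0], simp)
  show "\<tau> \<in> period_lattice \<tau>" unfolding period_lattice_def
    by clarify (intro exI[of _ 0] exI[of _ 1], simp)
qed

lemma countable_period_lattice: "countable (period_lattice \<tau>)"
proof -
  have "period_lattice \<tau> = (\<lambda>(m, n). of_int m + of_int n * \<tau>) ` (UNIV :: (int \<times> int) set)"
    by (auto simp: period_lattice_def)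
  then show ?thesis by simp
qed

text \<open>The integer parts of the two coordinates of \<open>z - q\<close> give the lattice
  vector; half-openness of the parallelogram makes it unique.\<close>

lemma parallelogram_tiling:
  assumes "Im \<tau> > 0"
  shows "\<exists>!l. l \<in> period_lattice \<tau> \<and> z - l \<in> parallelogram \<tau> q"
proof -
  define m n where "m = \<lfloor>coord1 \<tau> (z - q)\<rfloor>" and "n = \<lfloor>coord2 \<tau> (z - q)\<rfloor>"
  define l where "l = of_real (of_int m) + of_real (of_int n) * \<tau>"
  have c: "coord1 \<tau> l = of_int m" "coord2 \<tau> l = of_int n"
    using assms by (simp_all add: l_def del: of_real_of_int_eq)
  have frac: "x \<in> \<int> \<Longrightarrow> y - x \<in> {0..<1} \<Longrightarrow> x = of_int \<lfloor>y\<rfloor>" for x y :: real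
    by (auto elim!: Ints_cases) (metis floor_unique add.commute diff_ge_0_iff_ge less_diff_eq diff_less_eq)
  show ?thesis
  proof (rule ex1I[of _ l])
    show "l \<in> period_lattice \<tau> \<and> z - l \<in> parallelogram \<tau> q"
      using assms c unfolding parallelogram_def mem_Collect_eq fundamental_parallelogram_iff[OF assms] period_lattice_iff[OF assms]
      by (simp add: m_def n_def) linarith
  next
    fix l' assume l': "l' \<in> period_lattice \<tau> \<and> z - l' \<in> parallelogram \<tau> q"
    have "coord1 \<tau> l' = of_int m" "coord2 \<tau> l' = of_int n"
      unfolding m_def n_def using l' assms
      by (auto intro!: frac simp: period_lattice_iff parallelogram_def fundamental_parallelogram_iff)
    then show "l' = l" using c by (intro coord_eqI[OF assms]) auto
  qed
qed

lemma finite_period_lattice_parallelograms: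
  assumes "Im \<tau> > 0"
  shows "finite {l \<in> period_lattice \<tau>. \<exists>z. z \<in> parallelogram \<tau> p \<and> z - l \<in> parallelogram \<tau> q}" (is "finite ?L")
proof -
  define a b where "a = \<lceil>\<bar>coord1 \<tau> (p - q)\<bar> + 1\<rceil>" and "b = \<lceil>\<bar>coord2 \<tau> (p - q)\<bar> + 1\<rceil>"
  have "?L \<subseteq> (\<lambda>(m, n). of_int m + of_int n * \<tau>) ` ({-a..a} \<times> {-b..b})"
  proof
    fix l assume "l \<in> ?L"
    then obtain z where l: "l \<in> period_lattice \<tau>"
      and z: "z - p \<in> fundamental_parallelogram \<tau>" "z - l - q \<in> fundamental_parallelogram \<tau>"
      by (auto simp: parallelogram_def)
    from l obtain m n where m: "coord1 \<tau> l = of_int m" and n: "coord2 \<tau> l = of_int n"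
      unfolding period_lattice_iff[OF assms] by (auto elim!: Ints_cases)
    have "\<bar>of_int m\<bar> \<le> \<bar>coord1 \<tau> (p - q)\<bar> + 1" "\<bar>of_int n\<bar> \<le> \<bar>coord2 \<tau> (p - q)\<bar> + 1"
      using z assms by (auto simp: fundamental_parallelogram_iff m n)
    then have "\<bar>m\<bar> \<le> a" "\<bar>n\<bar> \<le> b" unfolding a_def b_def by linarith+
    moreover have "l = of_int m + of_int n * \<tau>"
      using coord_eq[OF assms, of l] by (simp add: m n)
    ultimately show "l \<in> (\<lambda>(m, n). of_int m + of_int n * \<tau>) ` ({-a..a} \<times> {-b..b})"
      by (intro image_eqI[of _ _ "(m, n)"]) auto
  qed
  then show ?thesis by (rule finite_subset) auto
qed


text \<open>Scissors congruence: lattice translates of the second parallelogram cut the first into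
  finitely many pieces, and these pieces, moved back by lattice vectors, fill the second one exactly
  once. Periodicity preserves the integrand.\<close>

lemma parallelogram_integral_periodic:
  fixes v :: "complex \<Rightarrow> complex"
  assumes \<tau>: "Im \<tau> > 0"
    and per: "\<And>z l. l \<in> period_lattice \<tau> \<Longrightarrow> v (z + l) = v z"
    and int: "set_integrable lborel (parallelogram \<tau> p) v"
  shows "set_lebesgue_integral lborel (parallelogram \<tau> p) v =
    set_lebesgue_integral lborel (parallelogram \<tau> q) v"
proof -
  define f where "f = (\<lambda>z. indicator (parallelogram \<tau> p) z *\<^sub>R v z)"
  define L where "L = {l \<in> period_lattice \<tau>. \<exists>z. z \<in> parallelogram \<tau> p \<and> z - l \<in> parallelogram \<tau> q}"
  \<comment> \<open>The part of the first parallelogram that lies in the translate by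
    \<open>l\<close> of the second one, moved back by \<open>l\<close>.\<close>
  define g where "g = (\<lambda>l z. indicator (parallelogram \<tau> q) z *\<^sub>R f (z + l))"
  note [measurable] = parallelogram_borel[OF \<tau>]
  have minus_add_eq: "- l + z = z - l" for l z :: complex by simp
  have L: "finite L" unfolding L_def by (rule finite_period_lattice_parallelograms[OF \<tau>])
  have f: "integrable lborel f" using int by (simp add: f_def set_integrable_def)
  have g: "integrable lborel (g l)" for l
    using integrable_mult_indicator[OF _ integrable_lborel_translate[OF f, of l], of "parallelogram \<tau> q"]
    by (simp add: g_def add.commute)
  then have g': "integrable lborel (\<lambda>z. g l (z - l))" for l
    using integrable_lborel_translate[OF g[of l], of "- l"] by (simp only: minus_add_eq)
  have translate: "(\<integral>z. g l (z - l) \<partial>lborel) = (\<integral>z. g l z \<partial>lborel)" for l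
    using integral_lborel_translate[of "g l" "- l"] borel_measurable_integrable[OF g[of l]]
    by (simp only: minus_add_eq measurable_lborel2)
  have one: "(\<Sum>l\<in>L. g l (z - l)) = f z" for z
  proof (cases "z \<in> parallelogram \<tau> p")
    case True
    obtain l where l: "l \<in> period_lattice \<tau>" "z - l \<in> parallelogram \<tau> q"
      and uniq: "\<And>m. m \<in> period_lattice \<tau> \<Longrightarrow> z - m \<in> parallelogram \<tau> q \<Longrightarrow> m = l"
      using parallelogram_tiling[OF \<tau>, of z q] unfolding Ex1_def by meson
    have "l \<in> L" using l True by (auto simp: L_def)
    have "(\<Sum>l\<in>L. g l (z - l)) = (\<Sum>m\<in>L. if m = l then f z else 0)"
    proof (intro sum.cong refl)
      fix m assume "m \<in> L"
      then have "m \<noteq> l \<Longrightarrow> z - m \<notin> parallelogram \<tau> q"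
        using uniq[of m] by (auto simp: L_def)
      then show "g m (z - m) = (if m = l then f z else 0)"
        using l by (cases "m = l") (simp_all add: g_def)
    qed
    then show ?thesis using L \<open>l \<in> L\<close> by simp
  qed (simp add: g_def f_def)
  have two: "(\<Sum>l\<in>L. g l z) = indicator (parallelogram \<tau> q) z *\<^sub>R v z" for z
  proof (cases "z \<in> parallelogram \<tau> q")
    case True
    obtain l where l: "l \<in> period_lattice \<tau>" "z - l \<in> parallelogram \<tau> p"
      and uniq: "\<And>m. m \<in> period_lattice \<tau> \<Longrightarrow> z - m \<in> parallelogram \<tau> p \<Longrightarrow> m = l"
      using parallelogram_tiling[OF \<tau>, of z p] unfolding Ex1_def by meson
    have "- l \<in> L" using l True period_lattice_uminus by (auto simp: L_def intro!: exI[of _ "z - l"])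
    have "(\<Sum>l\<in>L. g l z) = (\<Sum>m\<in>L. if m = - l then v z else 0)"
    proof (intro sum.cong refl)
      fix m assume m: "m \<in> L"
      then have m': "m \<in> period_lattice \<tau>" by (simp add: L_def)
      show "g m z = (if m = - l then v z else 0)"
      proof (cases "m = - l")
        case True
        then show ?thesis using l \<open>z \<in> _\<close> per[OF m', of z] by (simp add: g_def f_def)
      next
        case False
        then have "z + m \<notin> parallelogram \<tau> p"
          using uniq[of "- m"] period_lattice_uminus[OF m'] by auto
        then show ?thesis using False by (simp add: g_def f_def)
      qed
    qed
    then show ?thesis using L \<open>- l \<in> L\<close> True by simp
  qed (simp add: g_def)
  have "set_lebesgue_integral lborel (parallelogram \<tau> p) v = (\<integral>z. (\<Sum>l\<in>L. g l (z - l)) \<partial>lborel)"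
    by (simp add: one) (simp add: f_def set_lebesgue_integral_def)
  also have "\<dots> = (\<Sum>l\<in>L. \<integral>z. g l (z - l) \<partial>lborel)"
    by (rule Bochner_Integration.integral_sum[OF g'])
  also have "\<dots> = (\<Sum>l\<in>L. \<integral>z. g l z \<partial>lborel)"
    by (simp only: translate)
  also have "\<dots> = (\<integral>z. (\<Sum>l\<in>L. g l z) \<partial>lborel)"
    by (rule Bochner_Integration.integral_sum[OF g, symmetric])
  also have "\<dots> = set_lebesgue_integral lborel (parallelogram \<tau> q) v"
    by (simp add: two set_lebesgue_integral_def)
  finally show ?thesis .
qed


section \<open>Real differentiability classes on the plane\<close>

lemma frechet_derivative_cong_open:
  assumes "open U" "z \<in> U" "\<And>w. w \<in> U \<Longrightarrow> f w = g w"
  shows "frechet_derivative f (at z) = frechet_derivative g (at z)"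
proof -
  have "(f has_derivative D) (at z) \<longleftrightarrow> (g has_derivative D) (at z)" for D
    using assms by (metis has_derivative_transform_within_open)
  then show ?thesis unfolding frechet_derivative_def by simp
qed

lemma differentiable_cong_open:
  assumes "open U" "z \<in> U" "\<And>w. w \<in> U \<Longrightarrow> f w = g w" "f differentiable (at z)"
  shows "g differentiable (at z)"
  using assms unfolding differentiable_def by (metis has_derivative_transform_within_open)

lemma frechet_derivative_eqI: "(f has_derivative D) (at z) \<Longrightarrow> frechet_derivative f (at z) = D"
  by (metis frechet_derivative_at)

lemma Ck_on_cong:
  assumes "open U" "\<And>z. z \<in> U \<Longrightarrow> f z = g z" "Ck_on n f U"
  shows "Ck_on n g U"
  using assms(2,3)
proof (induction n arbitrary: f g)
  case 0
  then show ?case by (simp cong: continuous_on_cong)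
next
  case (Suc n)
  have D: "frechet_derivative f (at z) = frechet_derivative g (at z)" if "z \<in> U" for z
    using assms(1) that Suc.prems(1) by (rule frechet_derivative_cong_open)
  have "g differentiable (at z)" if "z \<in> U" for z
    using differentiable_cong_open[OF assms(1) that, of f g] Suc.prems that by auto
  moreover have "Ck_on n (\<lambda>z. frechet_derivative g (at z) v) U"
    if "Ck_on n (\<lambda>z. frechet_derivative f (at z) v) U" for v
    by (rule Suc.IH[OF _ that]) (simp add: D)
  ultimately show ?case using Suc.prems by simp
qed

lemma Ck_on_subset: "Ck_on n f U \<Longrightarrow> V \<subseteq> U \<Longrightarrow> Ck_on n f V"
  by (induction n arbitrary: f) (auto intro: continuous_on_subset)

lemma Ck_on_imp_continuous_on: "Ck_on n f U \<Longrightarrow> continuous_on U f"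
  by (cases n) (auto intro!: continuous_at_imp_continuous_on differentiable_imp_continuous_within)

lemma Ck_on_Suc_imp: "Ck_on (Suc n) f U \<Longrightarrow> Ck_on n f U"
proof (induction n arbitrary: f)
  case 0
  then show ?case using Ck_on_imp_continuous_on[of "Suc 0" f U] by (simp only: Ck_on.simps(1))
next
  case (Suc n)
  then show ?case using Ck_on.simps(2) by blast
qed

text \<open>Differentiability is local on open sets. This is how functions multiplied by cut-offs
  are recognised as differentiable on the whole plane: one open piece carries the formula, the
  others a constant.\<close>

lemma Ck_on_Un:
  assumes "open U" "open V"
  shows "Ck_on n f U \<Longrightarrow> Ck_on n f V \<Longrightarrow> Ck_on n f (U \<union> V)"
  using assms by (induction n arbitrary: f) (auto intro: continuous_on_open_Un)

lemma Ck_on_const: "Ck_on n (\<lambda>_. c) U"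
  by (induction n arbitrary: c) (auto simp: frechet_derivative_const)

lemma Ck_on_add:
  assumes "open U"
  shows "Ck_on n f U \<Longrightarrow> Ck_on n g U \<Longrightarrow> Ck_on n (\<lambda>z. f z + g z) U"
proof (induction n arbitrary: f g)
  case (Suc n)
  have D: "frechet_derivative (\<lambda>z. f z + g z) (at z) v = frechet_derivative f (at z) v + frechet_derivative g (at z) v"
    if "z \<in> U" for z v
  proof -
    have "f differentiable (at z)" "g differentiable (at z)" using Suc.prems that by auto
    then have "((\<lambda>z. f z + g z) has_derivative
        (\<lambda>v. frechet_derivative f (at z) v + frechet_derivative g (at z) v)) (at z)"
      by (intro has_derivative_add) (simp_all add: frechet_derivative_works[symmetric])
    then show ?thesis by (simp add: frechet_derivative_eqI)
  qed
  have "Ck_on n (\<lambda>z. frechet_derivative (\<lambda>z. f z + g z) (at z) v) U"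
    if "Ck_on n (\<lambda>z. frechet_derivative f (at z) v) U" "Ck_on n (\<lambda>z. frechet_derivative g (at z) v) U" for v
    by (rule Ck_on_cong[OF assms D[symmetric] Suc.IH[OF that]])
  then show ?case using Suc.prems by simp
qed (auto intro: continuous_intros)

lemma has_derivative_mult_complex:
  fixes f g :: "complex \<Rightarrow> complex"
  assumes "f differentiable (at z)" "g differentiable (at z)"
  shows "((\<lambda>z. f z * g z) has_derivative
    (\<lambda>v. f z * frechet_derivative g (at z) v + frechet_derivative f (at z) v * g z)) (at z)"
  using assms by (intro has_derivative_mult) (simp_all add: frechet_derivative_works[symmetric])

lemma frechet_derivative_mult_complex:
  fixes f g :: "complex \<Rightarrow> complex"
  assumes "f differentiable (at z)" "g differentiable (at z)"
  shows "frechet_derivative (\<lambda>z. f z * g z) (at z) v =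
    f z * frechet_derivative g (at z) v + frechet_derivative f (at z) v * g z"
  by (simp add: frechet_derivative_eqI[OF has_derivative_mult_complex[OF assms]])

lemma Ck_on_mult:
  assumes "open U"
  shows "Ck_on n f U \<Longrightarrow> Ck_on n g U \<Longrightarrow> Ck_on n (\<lambda>z. f z * g z) U"
proof (induction n arbitrary: f g)
  case (Suc n)
  have D: "frechet_derivative (\<lambda>z. f z * g z) (at z) v =
      f z * frechet_derivative g (at z) v + frechet_derivative f (at z) v * g z"
    if "z \<in> U" for z v
    using Suc.prems that by (simp add: frechet_derivative_mult_complex)
  have *: "Ck_on n (\<lambda>z. f z * frechet_derivative g (at z) v + frechet_derivative f (at z) v * g z) U"
    if "v = 1 \<or> v = \<i>" for v
    using that Suc.prems Ck_on_Suc_imp[OF Suc.prems(1)] Ck_on_Suc_imp[OF Suc.prems(2)]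
    by (intro Ck_on_add[OF assms] Suc.IH) auto
  have "Ck_on n (\<lambda>z. frechet_derivative (\<lambda>z. f z * g z) (at z) v) U" if "v = 1 \<or> v = \<i>" for v
    by (rule Ck_on_cong[OF assms D[symmetric] *[OF that]])
  then show ?case using Suc.prems by (auto intro: differentiable_mult)
qed (auto intro: continuous_intros)

lemma Ck_on_diff:
  assumes "open U" "Ck_on n f U" "Ck_on n g U"
  shows "Ck_on n (\<lambda>z. f z - g z) U"
  using Ck_on_add[OF assms(1,2) Ck_on_mult[OF assms(1) Ck_on_const[of n "-1"] assms(3)]] by simp

lemma holomorphic_imp_has_derivative:
  "f holomorphic_on U \<Longrightarrow> open U \<Longrightarrow> z \<in> U \<Longrightarrow> (f has_derivative (\<lambda>v. deriv f z * v)) (at z)"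
  using holomorphic_derivI[of f U z UNIV] by (simp add: has_field_derivative_def)

lemma holomorphic_imp_Ck_on:
  assumes "open U"
  shows "f holomorphic_on U \<Longrightarrow> Ck_on n f U"
proof (induction n arbitrary: f)
  case 0
  then show ?case by (simp add: holomorphic_on_imp_continuous_on)
next
  case (Suc n)
  have D: "(f has_derivative (\<lambda>v. deriv f z * v)) (at z)" if "z \<in> U" for z
    using holomorphic_imp_has_derivative[OF Suc.prems assms that] .
  have "Ck_on n (\<lambda>z. frechet_derivative f (at z) v) U" for v
    by (rule Ck_on_cong[OF assms _ Ck_on_mult[OF assms Suc.IH[of "deriv f"] Ck_on_const[of n v]]])
       (use assms Suc.prems in \<open>auto simp: frechet_derivative_eqI[OF D] holomorphic_deriv\<close>)
  moreover have "f differentiable (at z)" if "z \<in> U" for z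
    using D[OF that] by (rule differentiableI)
  ultimately show ?case by simp
qed

lemma has_derivative_cnj: "(cnj has_derivative cnj) (at z)"
  by (rule bounded_linear_imp_has_derivative[OF bounded_linear_cnj])

lemma has_derivative_imp_Ck_1:
  assumes "\<And>z. z \<in> U \<Longrightarrow> (f has_derivative D z) (at z)"
    and "continuous_on U (\<lambda>z. D z 1)" "continuous_on U (\<lambda>z. D z \<i>)"
  shows "Ck_on 1 f U"
proof -
  have "continuous_on U (\<lambda>z. frechet_derivative f (at z) v) \<longleftrightarrow> continuous_on U (\<lambda>z. D z v)" for v
    by (intro continuous_on_cong refl) (simp add: frechet_derivative_eqI[OF assms(1)])
  then show ?thesis using assms by (auto intro: differentiableI)
qed

lemma Ck_on_cnj: "Ck_on n cnj U"
proof (cases n)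
  case (Suc m)
  then show ?thesis
    by (auto simp: frechet_derivative_eqI[OF has_derivative_cnj] Ck_on_const intro!: differentiableI[OF has_derivative_cnj])
qed (auto intro: continuous_intros)

lemma Ck_1D:
  assumes "Ck_on 1 f U" "open U"
  shows "z \<in> U \<Longrightarrow> f differentiable (at z)" "continuous_on U (\<lambda>z. frechet_derivative f (at z) v)"
proof -
  show *: "z \<in> U \<Longrightarrow> f differentiable (at z)" for z using assms by simp
  show "continuous_on U (\<lambda>z. frechet_derivative f (at z) v)"
    using assms by (subst continuous_on_cong[OF refl frechet_derivative_combine[OF *]]) (auto intro!: continuous_intros)
qed


section \<open>Pairing with kernels of fixed rotation weight\<close>

text \<open>The bound on \<open>r\<close> makes the support fit into the open unit square centred at
  \<open>p\<close>, the parallelogram of \<open>\<i>\<close> with corner \<open>q\<close>. Since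
  \<open>u\<close> vanishes on its boundary, opposite sides agree trivially.\<close>

lemma integral_derivative_compact_support:
  fixes u :: "complex \<Rightarrow> complex"
  assumes u: "Ck_on 1 u UNIV" and supp: "\<And>z. norm (z - p) \<ge> r \<Longrightarrow> u z = 0" and r: "r < 1/2"
  shows "integrable lborel (\<lambda>z. frechet_derivative u (at z) v)"
    and "(\<integral>z. frechet_derivative u (at z) v \<partial>lborel) = 0"
proof -
  define q where "q = p - (1 + \<i>) / 2"
  have out: "u z = 0 \<and> frechet_derivative u (at z) v = 0" if "z \<notin> box q (q + 1 + \<i>)" for z
  proof -
    have "norm (z - p) \<ge> 1 / 2"
      using that abs_Re_le_cmod[of "z - p"] abs_Im_le_cmod[of "z - p"]
      by (auto simp: in_box_complex_iff q_def abs_le_iff)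
    then have "z \<in> - cball p r" using r by (auto simp: dist_norm norm_minus_commute)
    moreover have "u w = 0" if "w \<in> - cball p r" for w
      using that supp[of w] by (auto simp: dist_norm norm_minus_commute)
    ultimately have "frechet_derivative u (at z) = frechet_derivative (\<lambda>_. 0) (at z)"
      by (intro frechet_derivative_cong_open[of "- cball p r"]) auto
    then show ?thesis using supp[of z] r \<open>norm (z - p) \<ge> 1 / 2\<close> by (auto simp: frechet_derivative_const)
  qed
  have par: "box q (q + 1 + \<i>) \<subseteq> parallelogram \<i> q"
    by (auto simp: parallelogram_def fundamental_parallelogram_iff in_box_complex_iff coord1_def coord2_def)
  have eq: "indicator (parallelogram \<i> q) z *\<^sub>R frechet_derivative u (at z) v = frechet_derivative u (at z) v" for z
    using out[of z] par by (cases "z \<in> box q (q + 1 + \<i>)") (auto simp: indicator_def)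
  note D = Ck_1D[OF u open_UNIV]
  have "set_integrable lborel (parallelogram \<i> q) (\<lambda>z. frechet_derivative u (at z) v)"
    by (intro continuous_closed_parallelogram_integrable continuous_on_subset[OF D(2)]) auto
  then show "integrable lborel (\<lambda>z. frechet_derivative u (at z) v)"
    by (simp add: set_integrable_def eq)
  have "set_lebesgue_integral lborel (parallelogram \<i> q) (\<lambda>z. frechet_derivative u (at z) v) = 0"
  proof (rule integral_derivative_parallelogram_0)
    fix t :: real
    have "u (q + 1 + of_real t * \<i>) = 0" "u (q + of_real t * \<i>) = 0" "u (q + of_real t + \<i>) = 0" "u (q + of_real t) = 0"
      by (auto intro!: conjunct1[OF out] simp: in_box_complex_iff)
    then show "u (q + 1 + of_real t * \<i>) = u (q + of_real t * \<i>)" "u (q + of_real t + \<i>) = u (q + of_real t)"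
      by simp_all
  qed (use D in \<open>auto intro!: continuous_on_subset[OF D(2)]\<close>)
  then show "(\<integral>z. frechet_derivative u (at z) v \<partial>lborel) = 0"
    by (simp add: set_lebesgue_integral_def eq)
qed

lemma has_derivative_of_Re: "((\<lambda>z. complex_of_real (Re z)) has_derivative (\<lambda>v. of_real (Re v))) (at z)"
  and has_derivative_of_Im: "((\<lambda>z. complex_of_real (Im z)) has_derivative (\<lambda>v. of_real (Im v))) (at z)"
  by (auto intro!: derivative_eq_intros)

text \<open>The rotation field, with value \<open>\<i> * z\<close> at \<open>z\<close>, is free of
  divergence: the derivative of \<open>u\<close> along it is the derivative of
  \<open>Re z * u\<close> in direction \<open>\<i>\<close> minus that of \<open>Im z * u\<close> in
  direction 1.\<close>

lemma integral_rotation_derivative_0: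
  fixes u :: "complex \<Rightarrow> complex"
  assumes u: "Ck_on 1 u UNIV" and supp: "\<And>z. norm z \<ge> r \<Longrightarrow> u z = 0" and r: "r < 1/2"
  shows "(\<integral>z. frechet_derivative u (at z) (\<i> * z) \<partial>lborel) = 0"
proof -
  let ?X = "\<lambda>z. complex_of_real (Re z)" and ?Y = "\<lambda>z. complex_of_real (Im z)"
  have X: "Ck_on 1 ?X UNIV"
    by (rule has_derivative_imp_Ck_1[OF has_derivative_of_Re]) (auto intro!: continuous_intros)
  have Y: "Ck_on 1 ?Y UNIV"
    by (rule has_derivative_imp_Ck_1[OF has_derivative_of_Im]) (auto intro!: continuous_intros)
  note D = Ck_1D(1)[OF u open_UNIV UNIV_I]
  have 1: "Ck_on 1 (\<lambda>z. ?Y z * u z) UNIV" and 2: "Ck_on 1 (\<lambda>z. ?X z * u z) UNIV"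
    by (intro Ck_on_mult open_UNIV X Y u)+
  have e1: "frechet_derivative (\<lambda>z. ?Y z * u z) (at z) 1 = ?Y z * frechet_derivative u (at z) 1" for z
    using differentiableI[OF has_derivative_of_Im] D
    by (simp add: frechet_derivative_mult_complex frechet_derivative_eqI[OF has_derivative_of_Im])
  have e2: "frechet_derivative (\<lambda>z. ?X z * u z) (at z) \<i> = ?X z * frechet_derivative u (at z) \<i>" for z
    using differentiableI[OF has_derivative_of_Re] D
    by (simp add: frechet_derivative_mult_complex frechet_derivative_eqI[OF has_derivative_of_Re])
  have s: "norm (z - 0) \<ge> r \<Longrightarrow> ?Y z * u z = 0" "norm (z - 0) \<ge> r \<Longrightarrow> ?X z * u z = 0" for z
    using supp[of z] by auto
  note S1 = integral_derivative_compact_support[where p = 0 and v = 1, OF 1 s(1) r]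
  note S2 = integral_derivative_compact_support[where p = 0 and v = \<i>, OF 2 s(2) r]
  have "frechet_derivative u (at z) (\<i> * z) =
      frechet_derivative (\<lambda>z. ?X z * u z) (at z) \<i> - frechet_derivative (\<lambda>z. ?Y z * u z) (at z) 1" for z
    by (subst frechet_derivative_combine[OF D]) (simp add: e1 e2)
  then show ?thesis using S1 S2 by simp
qed

text \<open>The second expression is the derivative with respect to the conjugate of
  \<open>z\<close>; it has no name because it occurs only in the rotation argument.\<close>

lemma Ck_on_wirtinger:
  assumes "open U" "Ck_on (Suc n) g U"
  shows "Ck_on n (wirtinger_deriv g) U"
    and "Ck_on n (\<lambda>z. (frechet_derivative g (at z) 1 + \<i> * frechet_derivative g (at z) \<i>) / 2) U"
proof -
  have "Ck_on n (\<lambda>z. (1/2) * (frechet_derivative g (at z) 1 - \<i> * frechet_derivative g (at z) \<i>)) U"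
    using assms by (intro Ck_on_mult Ck_on_diff Ck_on_const) auto
  then show "Ck_on n (wirtinger_deriv g) U"
    by (rule Ck_on_cong[OF assms(1), rotated]) (simp add: wirtinger_deriv_def)
  have "Ck_on n (\<lambda>z. (1/2) * (frechet_derivative g (at z) 1 + \<i> * frechet_derivative g (at z) \<i>)) U"
    using assms by (intro Ck_on_mult Ck_on_add Ck_on_const) auto
  then show "Ck_on n (\<lambda>z. (frechet_derivative g (at z) 1 + \<i> * frechet_derivative g (at z) \<i>) / 2) U"
    by (rule Ck_on_cong[OF assms(1), rotated]) simp
qed

text \<open>A kernel of weight \<open>- j\<close> under rotations, i.e. an eigenfunction of the rotation field.\<close>

definition rotation_kernel :: "nat \<Rightarrow> real \<Rightarrow> real \<Rightarrow> (complex \<Rightarrow> complex) \<Rightarrow> bool" where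
  "rotation_kernel j e B K \<longleftrightarrow> Ck_on 1 K UNIV \<and> (\<forall>z. norm z \<ge> e \<longrightarrow> K z = 0) \<and>
     (\<forall>z. frechet_derivative K (at z) (\<i> * z) = - \<i> * of_nat j * K z) \<and> (\<forall>z. norm (K z) \<le> B)"

text \<open>The function \<open>z\<close> has rotation weight 1 and norm at most \<open>e\<close> on
  the support, so it lowers the index by one and gains a factor \<open>e\<close>. The conjugate, of
  weight \<open>- 1\<close>, raises the index with the same gain.\<close>

lemma rotation_kernel_mult_z:
  assumes "rotation_kernel (Suc j) e B K" "e \<ge> 0"
  shows "rotation_kernel j e (e * B) (\<lambda>z. z * K z)"
proof -
  have K: "Ck_on 1 K UNIV" "\<And>z. norm z \<ge> e \<Longrightarrow> K z = 0" "\<And>z. norm (K z) \<le> B"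
    "\<And>z. frechet_derivative K (at z) (\<i> * z) = - \<i> * of_nat (Suc j) * K z"
    using assms by (auto simp: rotation_kernel_def)
  have id: "Ck_on 1 (\<lambda>z. z) UNIV" by (intro holomorphic_imp_Ck_on) (auto intro: holomorphic_intros)
  have "frechet_derivative (\<lambda>z. z * K z) (at z) (\<i> * z) = - \<i> * of_nat j * (z * K z)" for z
    using Ck_1D(1)[OF K(1)]
    by (subst frechet_derivative_mult_complex) (simp_all add: K(4) algebra_simps)
  moreover have "norm (z * K z) \<le> e * B" for z
    using K(2)[of z] K(3)[of z] assms(2) order_trans[OF norm_ge_zero K(3)[of 0]]
    by (cases "norm z \<ge> e") (auto simp: norm_mult intro!: mult_mono)
  ultimately show ?thesis unfolding rotation_kernel_def
    using Ck_on_mult[OF open_UNIV id K(1)] K(2) by simp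
qed

lemma rotation_kernel_mult_cnj:
  assumes "rotation_kernel j e B K" "e \<ge> 0"
  shows "rotation_kernel (Suc j) e (e * B) (\<lambda>z. cnj z * K z)"
proof -
  have K: "Ck_on 1 K UNIV" "\<And>z. norm z \<ge> e \<Longrightarrow> K z = 0" "\<And>z. norm (K z) \<le> B"
    "\<And>z. frechet_derivative K (at z) (\<i> * z) = - \<i> * of_nat j * K z"
    using assms by (auto simp: rotation_kernel_def)
  have "frechet_derivative (\<lambda>z. cnj z * K z) (at z) (\<i> * z) = - \<i> * of_nat (Suc j) * (cnj z * K z)" for z
    using Ck_1D(1)[OF K(1)] differentiableI[OF has_derivative_cnj]
    by (subst frechet_derivative_mult_complex)
       (simp_all add: frechet_derivative_eqI[OF has_derivative_cnj] K(4) algebra_simps)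
  moreover have "norm (cnj z * K z) \<le> e * B" for z
    using K(2)[of z] K(3)[of z] assms(2) order_trans[OF norm_ge_zero K(3)[of 0]]
    by (cases "norm z \<ge> e") (auto simp: norm_mult intro!: mult_mono)
  ultimately show ?thesis unfolding rotation_kernel_def
    using Ck_on_mult[OF open_UNIV Ck_on_cnj[of 1] K(1)] K(2) by simp
qed

text \<open>What \<open>g\<close> does outside its disc is irrelevant: the product vanishes on the
  complement of the smaller closed disc, and the two open sets cover the plane.\<close>

lemma Ck_on_mult_compact_support:
  assumes "Ck_on n g (ball 0 r)" "Ck_on n K UNIV" "\<And>z. norm z \<ge> e \<Longrightarrow> K z = (0 :: complex)" "e < r"
  shows "Ck_on n (\<lambda>z. g z * K z) UNIV"
proof -
  have "Ck_on n (\<lambda>z. g z * K z) (ball 0 r)"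
    using assms by (intro Ck_on_mult) (auto intro: Ck_on_subset)
  moreover have "Ck_on n (\<lambda>z. g z * K z) (- cball 0 e)"
    by (rule Ck_on_cong[OF _ _ Ck_on_const[of n 0]]) (use assms(3) in auto)
  moreover have "ball 0 r \<union> - cball 0 e = (UNIV :: complex set)"
    using assms(4) by auto
  ultimately show ?thesis using Ck_on_Un[of "ball 0 r" "- cball 0 e" n] by auto
qed

text \<open>Pairing with a kernel of weight \<open>- j\<close> only sees the Taylor coefficients of weight \<open>j\<close>, which
  have order at least \<open>j\<close>. Integrating by parts along the rotation field avoids the Taylor
  expansion.\<close>

lemma rotation_kernel_bound:
  assumes "Ck_on (Suc m) g (ball 0 r)" "r' < r" "r \<le> 1/2"
  shows "\<exists>C\<ge>0. \<forall>j\<ge>m. \<forall>e B K. 0 < e \<longrightarrow> e \<le> r' \<longrightarrow> rotation_kernel j e B K \<longrightarrow>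
    norm (\<integral>z. g z * K z \<partial>lborel) \<le> C * e ^ (m + 2) * B"
  using assms(1)
proof (induction m arbitrary: g)
  case 0
  have cont: "continuous_on (cball 0 r') g"
    using assms(2) by (intro continuous_on_subset[OF Ck_on_imp_continuous_on[OF 0]]) auto
  then have "bounded (g ` cball 0 r')"
    using compact_continuous_image compact_cball compact_imp_bounded by blast
  then obtain M where M: "M > 0" "\<And>z. norm z \<le> r' \<Longrightarrow> norm (g z) \<le> M"
    by (auto simp: bounded_pos)
  show ?case
  proof (intro exI[of _ "16 * M"] conjI allI impI)
    fix j e B K assume e: "0 < e" "e \<le> r'" and rk: "rotation_kernel j e B K"
    have K: "Ck_on 1 K UNIV" "\<And>z. norm z \<ge> e \<Longrightarrow> K z = 0" "\<And>z. norm (K z) \<le> B"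
      using rk by (auto simp: rotation_kernel_def)
    have B: "B \<ge> 0" using order_trans[OF norm_ge_zero K(3)[of 0]] .
    have "Ck_on 1 (\<lambda>z. g z * K z) UNIV"
      using Ck_on_mult_compact_support[of 1 g r K e] 0 K e assms(2) by simp
    then have meas: "(\<lambda>z. g z * K z) \<in> borel_measurable borel"
      using Ck_on_imp_continuous_on borel_measurable_continuous_onI by blast
    \<comment> \<open>On the disc \<open>1 \<le> e / norm z\<close>, so the estimate for simple
      poles also yields the area bound of order \<open>e ^ 2\<close> for a bounded
      integrand.\<close>
    have le: "norm (g z * K z) \<le> (M * B * e) / norm (z - 0)" if "z \<in> ball 0 e" "z \<noteq> 0" for z
    proof -
      have "norm (g z * K z) \<le> M * B"
        unfolding norm_mult using that e M(1) B by (intro mult_mono M K) auto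
      also have "\<dots> \<le> M * B * (e / norm z)"
        using that M(1) B mult_left_mono[of 1 "e / norm z" "M * B"] by (simp add: field_simps)
      finally show ?thesis by simp
    qed
    have "(\<integral>z. g z * K z \<partial>lborel) = set_lebesgue_integral lborel (ball 0 e) (\<lambda>z. g z * K z)"
      unfolding set_lebesgue_integral_def using K(2)
      by (intro Bochner_Integration.integral_cong refl) (auto simp: indicator_def not_less)
    also have "norm \<dots> \<le> 16 * (M * B * e) * e"
      by (rule norm_integral_ball_inverse_norm[OF meas _ _ le]) (use e M B in auto)
    finally show "norm (\<integral>z. g z * K z \<partial>lborel) \<le> 16 * M * e ^ (0 + 2) * B"
      by (simp add: power2_eq_square mult_ac)
  qed (use M in auto)
next
  case (Suc m)
  let ?g1 = "wirtinger_deriv g"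
  let ?g2 = "\<lambda>z. (frechet_derivative g (at z) 1 + \<i> * frechet_derivative g (at z) \<i>) / 2"
  have ck: "Ck_on (Suc m) ?g1 (ball 0 r)" "Ck_on (Suc m) ?g2 (ball 0 r)"
    using Ck_on_wirtinger[OF open_ball Suc.prems] by auto
  have g1: "Ck_on 1 g (ball 0 r)"
    using Suc.prems by (induction m) (auto simp del: Ck_on.simps intro: Ck_on_Suc_imp)
  obtain C1 where C1: "C1 \<ge> 0" "\<And>j e B K. j \<ge> m \<Longrightarrow> 0 < e \<Longrightarrow> e \<le> r' \<Longrightarrow> rotation_kernel j e B K \<Longrightarrow>
    norm (\<integral>z. ?g1 z * K z \<partial>lborel) \<le> C1 * e ^ (m + 2) * B"
    using Suc.IH[OF ck(1)] by blast
  obtain C2 where C2: "C2 \<ge> 0" "\<And>j e B K. j \<ge> m \<Longrightarrow> 0 < e \<Longrightarrow> e \<le> r' \<Longrightarrow> rotation_kernel j e B K \<Longrightarrow>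
    norm (\<integral>z. ?g2 z * K z \<partial>lborel) \<le> C2 * e ^ (m + 2) * B"
    using Suc.IH[OF ck(2)] by blast
  show ?case
  proof (intro exI[of _ "C1 + C2"] conjI allI impI)
    fix j e B K assume j: "Suc m \<le> j" and e: "0 < e" "e \<le> r'" and rk: "rotation_kernel j e B K"
    obtain i where i: "j = Suc i" "i \<ge> m" using j by (cases j) auto
    have K: "Ck_on 1 K UNIV" "\<And>z. norm z \<ge> e \<Longrightarrow> K z = 0"
      "\<And>z. frechet_derivative K (at z) (\<i> * z) = - \<i> * of_nat j * K z"
      using rk by (auto simp: rotation_kernel_def)
    \<comment> \<open>The new kernels have indices \<open>j - 1\<close> and \<open>j + 1\<close>,
      both at least \<open>m\<close>. This is why the claim is made for every \<open>j\<close> from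
      \<open>m\<close> on: the induction would not close for \<open>j = m\<close> alone.\<close>
    have rk1: "rotation_kernel i e (e * B) (\<lambda>z. z * K z)"
      using rotation_kernel_mult_z rk i e by simp
    have rk2: "rotation_kernel (Suc j) e (e * B) (\<lambda>z. cnj z * K z)"
      using rotation_kernel_mult_cnj rk i e by simp
    have er: "e < r" using e assms by simp
    have int: "integrable lborel (\<lambda>z. h z * L z)" if "Ck_on (Suc m) h (ball 0 r)" "rotation_kernel j' e B' L" for h L j' B'
    proof -
      have "Ck_on 0 (\<lambda>z. h z * L z) UNIV"
        using that er by (intro Ck_on_mult_compact_support[of 0 h r L e])
          (auto simp: rotation_kernel_def Ck_on_imp_continuous_on simp del: Ck_on.simps(2) intro!: Ck_on.simps(1)[THEN iffD2] intro: Ck_on_imp_continuous_on)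
      then have c: "continuous_on A (\<lambda>z. h z * L z)" for A by (auto intro: continuous_on_subset)
      have "(\<lambda>z. indicator (cball 0 e) z *\<^sub>R (h z * L z)) = (\<lambda>z. h z * L z)"
        using that by (auto simp: rotation_kernel_def indicator_def fun_eq_iff)
      then show ?thesis using borel_integrable_compact[OF compact_cball c, of 0 e] by simp
    qed
    have u: "Ck_on 1 (\<lambda>z. g z * K z) UNIV"
      using Ck_on_mult_compact_support[OF g1 K(1) K(2) er] .
    \<comment> \<open>Along rotations \<open>g\<close> changes by \<open>\<i>\<close> times
      \<open>z\<close> times its \<open>z\<close>-derivative minus the conjugate of \<open>z\<close>
      times its conjugate derivative, while \<open>K\<close> reproduces itself with factor
      \<open>- \<i> * j\<close>. Integrating the total derivative to 0 therefore expresses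
      \<open>j\<close> times the pairing of \<open>g\<close> through pairings of its derivatives
      with kernels smaller by a factor \<open>e\<close>.\<close>
    have eq: "frechet_derivative (\<lambda>z. g z * K z) (at z) (\<i> * z) =
      \<i> * (?g1 z * (z * K z) - ?g2 z * (cnj z * K z) - of_nat j * (g z * K z))" for z
    proof (cases "norm z < r")
      case True
      then have d: "g differentiable (at z)" using Ck_1D(1)[OF g1] by simp
      have alg: "of_real (Re (\<i> * z)) * a + of_real (Im (\<i> * z)) * b =
        \<i> * ((a - \<i> * b) / 2 * z - (a + \<i> * b) / 2 * cnj z)" for a b
        by (simp add: complex_eq_iff field_simps)
      have "frechet_derivative g (at z) (\<i> * z) = \<i> * (?g1 z * z - ?g2 z * cnj z)"
        unfolding wirtinger_deriv_def by (subst frechet_derivative_combine[OF d]) (rule alg)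
      note Dg = this
      have "frechet_derivative (\<lambda>z. g z * K z) (at z) (\<i> * z) =
        g z * frechet_derivative K (at z) (\<i> * z) + frechet_derivative g (at z) (\<i> * z) * K z"
        by (rule frechet_derivative_mult_complex[OF d Ck_1D(1)[OF K(1) open_UNIV]]) simp
      also have "\<dots> = g z * (- \<i> * of_nat j * K z) + \<i> * (?g1 z * z - ?g2 z * cnj z) * K z"
        by (simp only: K(3) Dg)
      finally show ?thesis by (simp only: algebra_simps) simp
    next
      case False
      have "frechet_derivative (\<lambda>z. g z * K z) (at z) = frechet_derivative (\<lambda>z. 0) (at z)"
        using False er K(2) by (intro frechet_derivative_cong_open[of "- cball 0 e"]) auto
      then show ?thesis using K(2)[of z] False er by (simp add: frechet_derivative_const)
    qed
    have "0 = (\<integral>z. frechet_derivative (\<lambda>z. g z * K z) (at z) (\<i> * z) \<partial>lborel)"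
      by (rule integral_rotation_derivative_0[OF u, of e, symmetric]) (use K(2) er assms in auto)
    also have "\<dots> = \<i> * ((\<integral>z. ?g1 z * (z * K z) \<partial>lborel) - (\<integral>z. ?g2 z * (cnj z * K z) \<partial>lborel)
        - of_nat j * (\<integral>z. g z * K z \<partial>lborel))"
      unfolding eq using int[OF ck(1) rk1] int[OF ck(2) rk2] int[OF Ck_on_Suc_imp[OF Suc.prems] rk] by simp
    finally have "of_nat j * (\<integral>z. g z * K z \<partial>lborel) =
      (\<integral>z. ?g1 z * (z * K z) \<partial>lborel) - (\<integral>z. ?g2 z * (cnj z * K z) \<partial>lborel)"
      by simp
    then have "norm (of_nat j * (\<integral>z. g z * K z \<partial>lborel)) \<le> C1 * e ^ (m + 2) * (e * B) + C2 * e ^ (m + 2) * (e * B)"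
      using C1(2)[OF _ e rk1] C2(2)[OF _ e rk2] i norm_triangle_ineq4 by (smt (verit) le_SucI)
    \<comment> \<open>Here \<open>j\<close> is at least 1, so dividing by it does not worsen the
      bound.\<close>
    moreover have "norm (\<integral>z. g z * K z \<partial>lborel) \<le> norm (of_nat j * (\<integral>z. g z * K z \<partial>lborel))"
      using i mult_right_mono[of 1 "real j" "norm (\<integral>z. g z * K z \<partial>lborel)"]
      unfolding norm_mult norm_of_nat by simp
    ultimately show "norm (\<integral>z. g z * K z \<partial>lborel) \<le> (C1 + C2) * e ^ (Suc m + 2) * B"
      by (simp add: algebra_simps)
  qed (use C1 C2 in auto)
qed


section \<open>Radial cut-off functions\<close>

text \<open>Only the point 0 is delicate: there the difference quotient is again a positive power of
  \<open>max 0 h\<close>, hence tends to 0.\<close>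

lemma DERIV_max_power:
  "((\<lambda>x::real. max 0 x ^ Suc (Suc n)) has_real_derivative (real (Suc (Suc n)) * max 0 x ^ Suc n)) (at x)"
proof (cases x "0 :: real" rule: linorder_cases)
  case less
  have "((\<lambda>x::real. 0) has_real_derivative 0) (at x)" by simp
  then have "((\<lambda>x::real. max 0 x ^ Suc (Suc n)) has_real_derivative 0) (at x)"
    by (rule has_field_derivative_transform_within_open[of _ _ _ "{..<0}"]) (use less in auto)
  then show ?thesis using less by simp
next
  case greater
  have "((\<lambda>x::real. x ^ Suc (Suc n)) has_real_derivative (real (Suc (Suc n)) * x ^ Suc n)) (at x)"
    using DERIV_pow[of "Suc (Suc n)" x] by simp
  then have "((\<lambda>x::real. max 0 x ^ Suc (Suc n)) has_real_derivative (real (Suc (Suc n)) * x ^ Suc n)) (at x)"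
    by (rule has_field_derivative_transform_within_open[of _ _ _ "{0<..}"]) (use greater in auto)
  then show ?thesis using greater by simp
next
  case equal
  have "((\<lambda>h::real. max 0 h ^ Suc n) \<longlongrightarrow> max 0 0 ^ Suc n) (at 0)"
    by (intro tendsto_intros)
  then have "((\<lambda>h::real. max 0 h ^ Suc n) \<longlongrightarrow> 0) (at 0)" by simp
  moreover have "\<forall>\<^sub>F h in at 0. max 0 h ^ Suc n = (max 0 (0 + h) ^ Suc (Suc n) - max 0 0 ^ Suc (Suc n)) / (h :: real)"
    by (auto intro!: eventually_at_filter[THEN iffD2] always_eventually simp: max_def)
  ultimately have "((\<lambda>h::real. (max 0 (0 + h) ^ Suc (Suc n) - max 0 0 ^ Suc (Suc n)) / h) \<longlongrightarrow> 0) (at 0)"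
    by (rule Lim_transform_eventually)
  then show ?thesis using equal by (simp add: DERIV_def)
qed

text \<open>A transition from 1 on \<open>t \<le> 1/4\<close> to 0 on \<open>t \<ge> 1\<close>.
  Third powers give two continuous derivatives, as needed because the pairing kernel contains
  \<open>bump'\<close> and must itself be differentiable. The argument will be the square of a
  relative radius, so \<open>1/4\<close> stands for half the radius.\<close>

definition bump :: "real \<Rightarrow> real" where
  "bump t = max 0 (1 - t) ^ 3 / (max 0 (t - 1/4) ^ 3 + max 0 (1 - t) ^ 3)"

definition bump' :: "real \<Rightarrow> real" where
  "bump' t = - 3 * max 0 (1 - t) ^ 2 * max 0 (t - 1/4) ^ 2 * (max 0 (t - 1/4) + max 0 (1 - t)) /
     (max 0 (t - 1/4) ^ 3 + max 0 (1 - t) ^ 3) ^ 2"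

lemma DERIV_max_power':
  assumes "(f has_real_derivative f') (at x)" "m = Suc (Suc n)"
  shows "((\<lambda>x. max 0 (f x) ^ m) has_real_derivative (real m * max 0 (f x) ^ (m - 1)) * f') (at x)"
  unfolding assms(2) using DERIV_chain2[OF DERIV_max_power assms(1), of n] by simp

lemma bump_denominator_pos: "max 0 (t - 1/4) ^ 3 + max 0 (1 - t) ^ 3 > (0 :: real)"
proof (cases "t < 1")
  case True
  then show ?thesis by (intro add_nonneg_pos) auto
next
  case False
  then show ?thesis by (intro add_pos_nonneg) auto
qed

lemma DERIV_bump: "(bump has_real_derivative bump' t) (at t)"
proof -
  let ?p = "max 0 (t - 1/4)" and ?q = "max 0 (1 - t)"
  have p: "((\<lambda>t. max 0 (t - 1/4) ^ 3) has_real_derivative 3 * ?p ^ 2) (at t)"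
    by (rule DERIV_cong, rule DERIV_max_power'[where n = 1 and f' = 1]) (auto intro!: derivative_eq_intros)
  have q: "((\<lambda>t. max 0 (1 - t) ^ 3) has_real_derivative - 3 * ?q ^ 2) (at t)"
    by (rule DERIV_cong, rule DERIV_max_power'[where n = 1 and f' = "-1"]) (auto intro!: derivative_eq_intros)
  have "(bump has_real_derivative
      ((- 3 * ?q ^ 2) * (?p ^ 3 + ?q ^ 3) - ?q ^ 3 * (3 * ?p ^ 2 + (- 3 * ?q ^ 2))) / ((?p ^ 3 + ?q ^ 3) * (?p ^ 3 + ?q ^ 3))) (at t)"
    unfolding bump_def by (intro DERIV_divide DERIV_add p q) (use bump_denominator_pos[of t] in simp)
  moreover have "(- 3 * ?q ^ 2) * (?p ^ 3 + ?q ^ 3) - ?q ^ 3 * (3 * ?p ^ 2 + (- 3 * ?q ^ 2)) =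
      - 3 * ?q ^ 2 * ?p ^ 2 * (?p + ?q)"
    by (simp add: algebra_simps power2_eq_square power3_eq_cube)
  ultimately show ?thesis by (simp add: bump'_def power2_eq_square)
qed

lemma bump'_C1: "\<exists>d. (\<forall>t. (bump' has_real_derivative d t) (at t)) \<and> continuous_on UNIV d"
proof -
  define P Q where "P = (\<lambda>t::real. max 0 (t - 1/4))" and "Q = (\<lambda>t::real. max 0 (1 - t))"
  have pos: "P t ^ 3 + Q t ^ 3 > 0" for t unfolding P_def Q_def by (rule bump_denominator_pos)
  have p: "((\<lambda>t. P t ^ m) has_real_derivative real m * P t ^ (m - 1)) (at t)" if "m = Suc (Suc n)" for t m n
    unfolding P_def
    by (rule DERIV_cong, rule DERIV_max_power'[where f' = 1]) (use that in \<open>auto intro!: derivative_eq_intros\<close>)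
  have q: "((\<lambda>t. Q t ^ m) has_real_derivative - real m * Q t ^ (m - 1)) (at t)" if "m = Suc (Suc n)" for t m n
    unfolding Q_def
    by (rule DERIV_cong, rule DERIV_max_power'[where f' = "-1"])
       (use that in \<open>auto intro!: derivative_eq_intros simp: algebra_simps\<close>)
  have p': "((\<lambda>t. P t ^ 2) has_real_derivative 2 * P t) (at t)" "((\<lambda>t. P t ^ 3) has_real_derivative 3 * P t ^ 2) (at t)" for t
    using p[of 2 0 t] p[of 3 1 t] by (simp_all add: eval_nat_numeral)
  have q': "((\<lambda>t. Q t ^ 2) has_real_derivative - 2 * Q t) (at t)" "((\<lambda>t. Q t ^ 3) has_real_derivative - 3 * Q t ^ 2) (at t)" for t
    using q[of 2 0 t] q[of 3 1 t] by (simp_all add: eval_nat_numeral)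
  \<comment> \<open>Expanded so that only squares and cubes of \<open>P\<close> and \<open>Q\<close>
    occur: these powers are differentiable at the corners, the first powers are not.\<close>
  have eq: "bump' = (\<lambda>t. - 3 * (Q t ^ 2 * P t ^ 3 + Q t ^ 3 * P t ^ 2) / ((P t ^ 3 + Q t ^ 3) * (P t ^ 3 + Q t ^ 3)))"
    unfolding bump'_def P_def[symmetric] Q_def[symmetric]
    by (rule ext) (simp add: P_def Q_def power2_eq_square power3_eq_cube algebra_simps)
  have c: "continuous_on UNIV P" "continuous_on UNIV Q" unfolding P_def Q_def by (intro continuous_intros)+
  show ?thesis
    unfolding eq
    apply (rule exI, rule conjI, rule allI)
     apply (rule DERIV_divide DERIV_cmult DERIV_add DERIV_mult p' q')+
    subgoal for t using pos[of t] by simp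
    apply (intro continuous_intros c)
    subgoal using pos by (metis less_irrefl mult_pos_pos UNIV_I)
    done
qed

lemma bump_eq_1: "t \<le> 1/4 \<Longrightarrow> bump t = 1" and bump_eq_0: "t \<ge> 1 \<Longrightarrow> bump t = 0"
  and bump'_eq_0: "t \<le> 1/4 \<or> t \<ge> 1 \<Longrightarrow> bump' t = 0"
  by (auto simp: bump_def bump'_def)

lemma bump_bounds: "0 \<le> bump t" "bump t \<le> 1"
  using bump_denominator_pos[of t] by (auto simp: bump_def field_simps)

lemma bump'_bounded: "\<exists>M>0. \<forall>t. \<bar>bump' t\<bar> \<le> M"
proof -
  obtain d where "\<And>t. (bump' has_real_derivative d t) (at t)" using bump'_C1 by auto
  then have "continuous_on {1/4..1} bump'"
    by (intro DERIV_continuous_on) (auto intro: has_field_derivative_at_within)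
  then have "compact (bump' ` {1/4..1})" by (intro compact_continuous_image) auto
  then obtain M where M: "M > 0" "\<And>t. t \<in> {1/4..1} \<Longrightarrow> \<bar>bump' t\<bar> \<le> M"
    using compact_imp_bounded bounded_pos[of "bump' ` {1/4..1}"] by auto
  moreover have "\<bar>bump' t\<bar> \<le> M" if "t \<notin> {1/4..1}" for t
    using that bump'_eq_0[of t] M(1) by auto
  ultimately show ?thesis by blast
qed

lemma has_derivative_radial:
  assumes "(f has_real_derivative f' ((norm z)\<^sup>2 / e)) (at ((norm z)\<^sup>2 / e))"
  shows "((\<lambda>z. of_real (f ((norm z)\<^sup>2 / e))) has_derivative
    (\<lambda>v. of_real (f' ((norm z)\<^sup>2 / e) * (2 * (z \<bullet> v) / e)) :: complex)) (at (z :: complex))"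
proof -
  have "((\<lambda>z. (norm z)\<^sup>2 / e) has_derivative (\<lambda>v. 2 * (z \<bullet> v) / e)) (at z)"
    unfolding power2_norm_eq_inner divide_inverse
    by (auto intro!: derivative_eq_intros simp: inner_commute)
  from has_derivative_compose[OF this assms[unfolded has_field_derivative_def]]
  have "((\<lambda>z. f ((norm z)\<^sup>2 / e)) has_derivative (\<lambda>v. f' ((norm z)\<^sup>2 / e) * (2 * (z \<bullet> v) / e))) (at z)" .
  then show ?thesis by (rule has_derivative_of_real)
qed

text \<open>The square of the norm, unlike the norm, is differentiable at the origin.\<close>

definition disc_bump :: "real \<Rightarrow> complex \<Rightarrow> complex" where
  "disc_bump e z = of_real (bump ((norm z)\<^sup>2 / e\<^sup>2))"

lemma norm_square_quotient_cases:
  fixes e :: real and z :: complex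
  assumes "e > 0"
  shows "norm z \<ge> e \<Longrightarrow> (norm z)\<^sup>2 / e\<^sup>2 \<ge> 1" "norm z \<le> e / 2 \<Longrightarrow> (norm z)\<^sup>2 / e\<^sup>2 \<le> 1/4"
proof -
  show "norm z \<ge> e \<Longrightarrow> (norm z)\<^sup>2 / e\<^sup>2 \<ge> 1"
    using assms power_mono[of e "norm z" 2] by (simp add: field_simps)
  show "norm z \<le> e / 2 \<Longrightarrow> (norm z)\<^sup>2 / e\<^sup>2 \<le> 1/4"
    using assms power_mono[of "norm z" "e / 2" 2] by (simp add: field_simps)
qed

lemma disc_bump_simps:
  assumes "e > 0"
  shows "norm z \<ge> e \<Longrightarrow> disc_bump e z = 0" "norm z \<le> e / 2 \<Longrightarrow> disc_bump e z = 1"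
  using norm_square_quotient_cases[OF assms, of z]
  by (simp_all only: disc_bump_def bump_eq_0 bump_eq_1 of_real_0 of_real_1)

lemma has_derivative_disc_bump:
  "(disc_bump e has_derivative (\<lambda>v. of_real (bump' ((norm z)\<^sup>2 / e\<^sup>2) * (2 * (z \<bullet> v) / e\<^sup>2)))) (at z)"
  unfolding disc_bump_def by (rule has_derivative_radial[where f = bump and f' = bump', OF DERIV_bump])

lemma continuous_on_bump': "continuous_on A bump'"
  using bump'_C1 DERIV_continuous_on[of UNIV bump'] by (meson continuous_on_subset has_field_derivative_at_within subset_UNIV)

lemma Ck_1_disc_bump: "Ck_on 1 (disc_bump e) UNIV"
  by (rule has_derivative_imp_Ck_1[OF has_derivative_disc_bump])
     (auto intro!: continuous_intros continuous_on_compose2[OF continuous_on_bump'[of UNIV]] simp: divide_inverse)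

text \<open>The \<open>z\<close>-derivative of the cut-off divided by \<open>z ^ N\<close>, the
  factor \<open>cnj z / e\<^sup>2\<close> being the derivative of the argument of
  \<open>bump\<close>. It appears when the cut-off is differentiated in a product with
  \<open>g z / z ^ N\<close>. The conjugate contributes rotation weight \<open>- 1\<close> and the
  denominator \<open>- N\<close>.\<close>

definition bump_kernel :: "nat \<Rightarrow> real \<Rightarrow> complex \<Rightarrow> complex" where
  "bump_kernel N e z = of_real (bump' ((norm z)\<^sup>2 / e\<^sup>2)) / e\<^sup>2 * (cnj z / z ^ N)"

lemma wirtinger_disc_bump: "wirtinger_deriv (disc_bump e) z = bump_kernel 0 e z"
  unfolding wirtinger_deriv_def frechet_derivative_eqI[OF has_derivative_disc_bump] bump_kernel_def
  by (simp add: complex_eq_iff inner_complex_def)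

text \<open>The kernel lives on the annulus between \<open>e / 2\<close> and \<open>e\<close>, where
  \<open>1 / norm z ^ N\<close> is at most \<open>2 ^ N / e ^ N\<close>; this is the origin of the
  factor \<open>2 ^ N\<close> in the constant.\<close>

lemma rotation_kernel_bump_kernel:
  "\<exists>M\<ge>0. \<forall>e>0. rotation_kernel (Suc N) e (M / e ^ Suc N) (bump_kernel N e)"
proof -
  obtain M where M: "M > 0" "\<And>t. \<bar>bump' t\<bar> \<le> M" using bump'_bounded by auto
  obtain d where d: "\<And>t. (bump' has_real_derivative d t) (at t)" "continuous_on UNIV d"
    using bump'_C1 by auto
  have "rotation_kernel (Suc N) e (M * 2 ^ N / e ^ Suc N) (bump_kernel N e)" if e: "e > 0" for e
  proof -
    let ?R = "\<lambda>z. complex_of_real (bump' ((norm z)\<^sup>2 / e\<^sup>2))"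
    let ?L = "\<lambda>z::complex. (1 / (complex_of_real e)\<^sup>2) / z ^ N"
    let ?U = "- {0 :: complex}"
    have supp: "bump_kernel N e z = 0" if "norm z \<ge> e \<or> norm z \<le> e / 2" for z
      using that norm_square_quotient_cases[OF e, of z] bump'_eq_0[of "(norm z)\<^sup>2 / e\<^sup>2"]
      by (auto simp: bump_kernel_def)
    have R: "Ck_on 1 ?R UNIV"
      by (rule has_derivative_imp_Ck_1[OF has_derivative_radial[where f = bump' and f' = d, OF d(1)]])
         (auto intro!: continuous_intros continuous_on_compose2[OF d(2)] simp: divide_inverse)
    have L: "?L holomorphic_on ?U"
      by (auto intro!: holomorphic_intros)
    have oU: "open ?U" by auto
    have eq: "bump_kernel N e = (\<lambda>z. ?R z * (cnj z * ?L z))"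
      by (auto simp: bump_kernel_def fun_eq_iff)
    have C1: "Ck_on 1 (bump_kernel N e) ?U"
      unfolding eq
      by (rule Ck_on_mult[OF oU Ck_on_subset[OF R] Ck_on_mult[OF oU Ck_on_cnj holomorphic_imp_Ck_on[OF oU L]]]) simp
    \<comment> \<open>The kernel vanishes identically near the origin, so the pole of
      \<open>1 / z ^ N\<close> does no harm.\<close>
    have C2: "Ck_on 1 (bump_kernel N e) (ball 0 (e / 2))"
      by (rule Ck_on_cong[OF _ _ Ck_on_const[of 1 0]]) (use supp in auto)
    have "?U \<union> ball 0 (e / 2) = UNIV" using e by auto
    then have C: "Ck_on 1 (bump_kernel N e) UNIV"
      using Ck_on_Un[OF oU open_ball C1 C2] by simp
    have rot: "frechet_derivative (bump_kernel N e) (at z) (\<i> * z) = - \<i> * of_nat (Suc N) * bump_kernel N e z" for z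
    proof (cases "z = 0")
      case True
      have "linear (frechet_derivative (bump_kernel N e) (at z))"
        using Ck_1D(1)[OF C] by (simp add: linear_frechet_derivative)
      then show ?thesis using True by (simp add: linear_0 bump_kernel_def)
    next
      case False
      have L': "(?L has_derivative (\<lambda>v. (- of_nat N * ?L z / z) * v)) (at z)"
      proof -
        have X: "of_nat N * z ^ (N - 1) * inverse ((z ^ N) ^ 2) = of_nat N / z ^ N / z"
          using False by (cases N) (simp_all add: field_simps power2_eq_square)
        have "((\<lambda>z. z ^ N) has_field_derivative of_nat N * z ^ (N - 1)) (at z)"
          by (auto intro!: derivative_eq_intros)
        from DERIV_cmult[OF DERIV_inverse_fun[OF this]] False
        have "(?L has_field_derivative 1 / (complex_of_real e)\<^sup>2 * - (of_nat N * z ^ (N - 1) * inverse ((z ^ N) ^ 2))) (at z)"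
          by (simp add: divide_inverse power2_eq_square)
        then have D: "(?L has_field_derivative 1 / (complex_of_real e)\<^sup>2 * - (of_nat N / z ^ N / z)) (at z)"
          unfolding X .
        have "1 / (complex_of_real e)\<^sup>2 * - (of_nat N / z ^ N / z) = - of_nat N * ?L z / z"
          by simp
        from DERIV_cong[OF D this] show ?thesis unfolding has_field_derivative_def .
      qed
      have CL: "((\<lambda>z. cnj z * ?L z) has_derivative (\<lambda>v. cnj z * ((- of_nat N * ?L z / z) * v) + cnj v * ?L z)) (at z)"
        by (rule has_derivative_mult[OF has_derivative_cnj L'])
      have RD: "(?R has_derivative (\<lambda>v. of_real (d ((norm z)\<^sup>2 / e\<^sup>2) * (2 * (z \<bullet> v) / e\<^sup>2)))) (at z)"
        by (rule has_derivative_radial[where f = bump' and f' = d, OF d(1)])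
      \<comment> \<open>The rotation field is orthogonal to the radius, so the radial factor has
        derivative 0 along it.\<close>
      have "z \<bullet> (\<i> * z) = 0" by (simp add: inner_complex_def)
      then show ?thesis
        unfolding eq frechet_derivative_eqI[OF has_derivative_mult[OF RD CL]]
        using False by (simp add: algebra_simps diff_divide_distrib add_divide_distrib)
    qed
    have bound: "norm (bump_kernel N e z) \<le> M * 2 ^ N / e ^ Suc N" for z
    proof (cases "norm z \<ge> e \<or> norm z \<le> e / 2")
      case True
      then show ?thesis using supp e M by simp
    next
      case False
      then have z: "e / 2 \<le> norm z" "norm z \<le> e" "norm z > 0" using e by auto
      have "norm (bump_kernel N e z) = \<bar>bump' ((norm z)\<^sup>2 / e\<^sup>2)\<bar> / e\<^sup>2 * (norm z / norm z ^ N)"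
        using e by (simp add: bump_kernel_def norm_mult norm_divide norm_power)
      also have "\<dots> \<le> M / e\<^sup>2 * (e / (e / 2) ^ N)"
        using z e M by (intro mult_mono divide_mono divide_right_mono power_mono) auto
      also have "\<dots> = M * 2 ^ N / e ^ Suc N"
        using e by (simp add: power_divide field_simps power2_eq_square)
      finally show ?thesis .
    qed
    show ?thesis unfolding rotation_kernel_def using C supp rot bound by auto
  qed
  then show ?thesis using M by (intro exI[of _ "M * 2 ^ N"]) auto
qed


section \<open>Stokes' theorem on the torus with singularities\<close>

lemma wirtinger_deriv_cong_open:
  assumes "open U" "z \<in> U" "\<And>w. w \<in> U \<Longrightarrow> f w = g w"
  shows "wirtinger_deriv f z = wirtinger_deriv g z"
  by (simp add: wirtinger_deriv_def frechet_derivative_cong_open[OF assms])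

lemma wirtinger_deriv_mult:
  assumes "f differentiable (at z)" "g differentiable (at z)"
  shows "wirtinger_deriv (\<lambda>z. f z * g z) z = f z * wirtinger_deriv g z + wirtinger_deriv f z * g z"
  unfolding wirtinger_deriv_def frechet_derivative_mult_complex[OF assms] by (simp add: field_simps)

lemma wirtinger_deriv_diff:
  assumes "f differentiable (at z)" "g differentiable (at z)"
  shows "wirtinger_deriv (\<lambda>z. f z - g z) z = wirtinger_deriv f z - wirtinger_deriv g z"
proof -
  have "((\<lambda>z. f z - g z) has_derivative
      (\<lambda>v. frechet_derivative f (at z) v - frechet_derivative g (at z) v)) (at z)"
    using assms by (intro has_derivative_diff) (simp_all add: frechet_derivative_works[symmetric])
  then show ?thesis by (simp add: wirtinger_deriv_def frechet_derivative_eqI field_simps)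
qed

lemma wirtinger_deriv_const [simp]: "wirtinger_deriv (\<lambda>_. c) z = 0"
  by (simp add: wirtinger_deriv_def)

lemma wirtinger_deriv_sum:
  assumes "finite I" "\<And>i. i \<in> I \<Longrightarrow> f i differentiable (at z)"
  shows "wirtinger_deriv (\<lambda>z. \<Sum>i\<in>I. f i z) z = (\<Sum>i\<in>I. wirtinger_deriv (f i) z)"
proof -
  have "((\<lambda>z. \<Sum>i\<in>I. f i z) has_derivative (\<lambda>v. \<Sum>i\<in>I. frechet_derivative (f i) (at z) v)) (at z)"
    using assms by (intro has_derivative_sum) (simp_all add: frechet_derivative_works[symmetric])
  then show ?thesis
    by (simp add: wirtinger_deriv_def frechet_derivative_eqI sum_divide_distrib sum_subtractf sum_distrib_left diff_divide_distrib)
qed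

lemma
  fixes f :: "complex \<Rightarrow> complex"
  assumes "f differentiable (at (p + z))"
  shows frechet_derivative_translate: "frechet_derivative (\<lambda>z. f (p + z)) (at z) = frechet_derivative f (at (p + z))"
    and differentiable_translate: "(\<lambda>z. f (p + z)) differentiable (at z)"
proof -
  have "((\<lambda>z. p + z) has_derivative (\<lambda>v. v)) (at z)" by (auto intro!: derivative_eq_intros)
  from has_derivative_compose[OF this, of f] assms
  have "((\<lambda>z. f (p + z)) has_derivative (\<lambda>v. frechet_derivative f (at (p + z)) v)) (at z)"
    by (simp add: frechet_derivative_works)
  then show "frechet_derivative (\<lambda>z. f (p + z)) (at z) = frechet_derivative f (at (p + z))"
    "(\<lambda>z. f (p + z)) differentiable (at z)"
    by (auto simp: frechet_derivative_eqI intro: differentiableI)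
qed

lemma Ck_on_translate:
  assumes "open U"
  shows "Ck_on n f U \<Longrightarrow> Ck_on n (\<lambda>z. f (p + z)) ((\<lambda>z. p + z) -` U)"
proof (induction n arbitrary: f)
  case 0
  then show ?case by (auto intro!: continuous_on_compose2[of U f] continuous_intros)
next
  case (Suc n)
  have o: "open ((\<lambda>z. p + z) -` U)" using assms by (intro open_vimage continuous_intros)
  have "Ck_on n (\<lambda>z. frechet_derivative (\<lambda>z. f (p + z)) (at z) v) ((\<lambda>z. p + z) -` U)"
    if "Ck_on n (\<lambda>z. frechet_derivative f (at z) v) U" for v
    by (rule Ck_on_cong[OF o _ Suc.IH[OF that]]) (use Suc.prems in \<open>auto simp: frechet_derivative_translate\<close>)
  then show ?case using Suc.prems by (auto intro: differentiable_translate)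
qed

lemma integral_wirtinger_compact_support:
  assumes u: "Ck_on 1 u UNIV" and supp: "\<And>z. norm (z - p) \<ge> r \<Longrightarrow> u z = 0" and r: "r < 1/2"
  shows "integrable lborel (wirtinger_deriv u)" "(\<integral>z. wirtinger_deriv u z \<partial>lborel) = 0"
proof -
  note 1 = integral_derivative_compact_support[where v = 1, OF u supp r]
  note 2 = integral_derivative_compact_support[where v = \<i>, OF u supp r]
  show "integrable lborel (wirtinger_deriv u)"
    unfolding wirtinger_deriv_def using 1 2 by simp
  show "(\<integral>z. wirtinger_deriv u z \<partial>lborel) = 0"
    unfolding wirtinger_deriv_def using 1 2 by simp
qed

text \<open>Off the origin \<open>V e\<close> is the \<open>z\<close>-derivative of
  \<open>disc_bump e * c\<close>. Two such expressions with different radii differ by the derivative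
  of a compactly supported differentiable function that vanishes near the origin, so the integral
  does not depend on the radius. As the radius shrinks, the first summand is small by the
  simple-pole bound and the second by rotation weight; hence the common value is 0.\<close>

lemma disc_bump_stokes:
  assumes g: "smooth_fun_on g (ball 0 r)" and r: "r \<le> 1/2"
    and c: "\<And>z. z \<in> ball 0 r - {0} \<Longrightarrow> c z = g z / z ^ N"
    and A: "A \<ge> 0" "\<And>z. z \<in> ball 0 r - {0} \<Longrightarrow> norm (wirtinger_deriv c z) \<le> A / norm z"
    and e: "0 < e" "e < r"
  defines "V \<equiv> \<lambda>e z. disc_bump e z * wirtinger_deriv c z + bump_kernel 0 e z * c z"
  shows "integrable lborel (V e)" "(\<integral>z. V e z \<partial>lborel) = 0"
proof -
  let ?B = "ball 0 r - {0 :: complex}"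
  have oB: "open ?B" by auto
  have g': "Ck_on n g (ball 0 r)" for n using g by (simp add: smooth_fun_on_def)
  have cC: "Ck_on n c ?B" for n
  proof -
    have "Ck_on n (\<lambda>z. g z * (1 / z ^ N)) ?B"
      by (intro Ck_on_mult[OF oB] Ck_on_subset[OF g'] holomorphic_imp_Ck_on[OF oB] holomorphic_intros) auto
    then show ?thesis by (rule Ck_on_cong[OF oB, rotated]) (use c in auto)
  qed
  \<comment> \<open>Moving the denominator of \<open>c\<close> into the kernel leaves the smooth
    \<open>g\<close> to be paired with a bounded kernel.\<close>
  have split: "V e = (\<lambda>z. disc_bump e z * wirtinger_deriv c z + g z * bump_kernel N e z)" if e: "0 < e" "e < r" for e
  proof
    fix z
    have "bump_kernel 0 e z * c z = g z * bump_kernel N e z"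
    proof (cases "norm z < e")
      case True
      then show ?thesis using c[of z] e by (cases "z = 0") (auto simp: bump_kernel_def)
    next
      case False
      then show ?thesis using norm_square_quotient_cases(1)[OF e(1), of z]
        by (simp add: bump_kernel_def bump'_eq_0)
    qed
    then show "V e z = disc_bump e z * wirtinger_deriv c z + g z * bump_kernel N e z" by (simp add: V_def)
  qed
  obtain M where M: "M \<ge> 0" "\<And>e. e > 0 \<Longrightarrow> rotation_kernel (Suc N) e (M / e ^ Suc N) (bump_kernel N e)"
    using rotation_kernel_bump_kernel by blast
  \<comment> \<open>The bound is used with \<open>m = N\<close> and the kernel index
    \<open>N + 1\<close>: of \<open>d ^ (N + 2)\<close> against the kernel size
    \<open>M / d ^ (N + 1)\<close> exactly one factor \<open>d\<close> remains.\<close>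
  obtain C where C: "C \<ge> 0" "\<And>d. 0 < d \<Longrightarrow> d \<le> e \<Longrightarrow>
      norm (\<integral>z. g z * bump_kernel N d z \<partial>lborel) \<le> C * d ^ (N + 2) * (M / d ^ Suc N)"
    using rotation_kernel_bound[OF g'[of "Suc N"] e(2) r] M by (meson le_SucI order_refl)
  have int1: "integrable lborel (\<lambda>z. disc_bump d z * wirtinger_deriv c z)"
    and bd1: "norm (\<integral>z. disc_bump d z * wirtinger_deriv c z \<partial>lborel) \<le> 16 * A * d" if d: "0 < d" "d < r" for d
  proof -
    let ?F = "\<lambda>z. disc_bump d z * wirtinger_deriv c z"
    have C1: "Ck_on 0 ?F ?B"
      using Ck_on_mult[OF oB Ck_on_subset[OF Ck_on_Suc_imp[of 0]] Ck_on_wirtinger(1)[OF oB cC[of "Suc 0"]], of "disc_bump d" UNIV]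
        Ck_1_disc_bump[of d] by simp
    have C2: "Ck_on 0 ?F (- cball 0 d)"
      by (rule Ck_on_cong[OF _ _ Ck_on_const[of 0 0]]) (use disc_bump_simps[OF d(1)] in auto)
    have "?B \<union> - cball 0 d = - {0}" using d by auto
    then have "continuous_on (- {0}) ?F"
      using Ck_on_Un[OF oB _ C1 C2] by (simp add: open_Compl)
    then have meas: "?F \<in> borel_measurable borel"
      by (rule borel_measurable_continuous_countable_exceptions[rotated]) auto
    have le: "norm (?F z) \<le> A / norm (z - 0)" if "z \<in> ball 0 d" "z \<noteq> 0" for z
    proof -
      have "norm (disc_bump d z) \<le> 1" using bump_bounds by (simp add: disc_bump_def)
      then show ?thesis
        using A(2)[of z] that d mult_mono[of "norm (disc_bump d z)" 1 "norm (wirtinger_deriv c z)" "A / norm z"]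
        by (simp add: norm_mult)
    qed
    have eq: "indicator (ball 0 d) z *\<^sub>R ?F z = ?F z" for z
      using disc_bump_simps(1)[OF d(1), of z] by (auto simp: indicator_def not_less)
    show "integrable lborel ?F"
      using set_integrable_ball_inverse_norm[OF meas _ A(1) le, of d] d
      unfolding set_integrable_def eq by simp
    show "norm (\<integral>z. ?F z \<partial>lborel) \<le> 16 * A * d"
      using norm_integral_ball_inverse_norm[OF meas _ A(1) le, of d] d
      unfolding set_lebesgue_integral_def eq by simp
  qed
  have int2: "integrable lborel (\<lambda>z. g z * bump_kernel N d z)" if d: "0 < d" "d < r" for d
  proof -
    have K: "Ck_on 1 (bump_kernel N d) UNIV" "\<And>z. norm z \<ge> d \<Longrightarrow> bump_kernel N d z = 0"
      using M(2)[OF d(1)] by (auto simp: rotation_kernel_def)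
    have "continuous_on UNIV (\<lambda>z. g z * bump_kernel N d z)"
      using Ck_on_mult_compact_support[OF g'[of 1] K d(2)] Ck_on_imp_continuous_on by blast
    then have "continuous_on (cball 0 d) (\<lambda>z. g z * bump_kernel N d z)" by (rule continuous_on_subset) auto
    moreover have "(\<lambda>z. indicator (cball 0 d) z *\<^sub>R (g z * bump_kernel N d z)) = (\<lambda>z. g z * bump_kernel N d z)"
      using K(2) by (auto simp: indicator_def fun_eq_iff)
    ultimately show ?thesis using borel_integrable_compact[OF compact_cball, of 0 d] by fastforce
  qed
  have intV: "integrable lborel (V d)" if "0 < d" "d < r" for d
    unfolding split[OF that] using int1[OF that] int2[OF that] by simp
  show "integrable lborel (V e)" by (rule intV[OF e])
  have bdV: "norm (\<integral>z. V d z \<partial>lborel) \<le> (16 * A + C * M) * d" if "0 < d" "d \<le> e" for d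
  proof -
    have d: "d < r" using that e by simp
    have "norm (\<integral>z. V d z \<partial>lborel) \<le> norm (\<integral>z. disc_bump d z * wirtinger_deriv c z \<partial>lborel)
        + norm (\<integral>z. g z * bump_kernel N d z \<partial>lborel)"
      unfolding split[OF that(1) d] using int1[OF that(1) d] int2[OF that(1) d]
      by (simp add: norm_triangle_ineq)
    also have "\<dots> \<le> 16 * A * d + C * d ^ (N + 2) * (M / d ^ Suc N)"
      by (intro add_mono bd1 C(2) that d)
    also have "\<dots> = (16 * A + C * M) * d"
      using that by (simp add: field_simps)
    finally show ?thesis .
  qed
  have same: "(\<integral>z. V e z \<partial>lborel) = (\<integral>z. V d z \<partial>lborel)" if d: "0 < d" "d \<le> e" for d
  proof -
    \<comment> \<open>Both cut-offs are 1 near the origin, so their difference removes the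
      singularity of \<open>c\<close>.\<close>
    define u where "u = (\<lambda>z. (disc_bump e z - disc_bump d z) * c z)"
    have b: "Ck_on 1 (\<lambda>z. disc_bump e z - disc_bump d z) UNIV"
      by (intro Ck_on_diff open_UNIV Ck_1_disc_bump)
    have u1: "Ck_on 1 u ?B" unfolding u_def
      by (intro Ck_on_mult[OF oB] Ck_on_subset[OF b] cC) auto
    have u2: "Ck_on 1 u (ball 0 (d / 2))"
      by (rule Ck_on_cong[OF _ _ Ck_on_const[of 1 0]])
         (use disc_bump_simps(2)[OF d(1)] disc_bump_simps(2)[OF e(1)] d in \<open>auto simp: u_def\<close>)
    have u3: "Ck_on 1 u (- cball 0 e)"
      by (rule Ck_on_cong[OF _ _ Ck_on_const[of 1 0]])
         (use disc_bump_simps(1)[OF d(1)] disc_bump_simps(1)[OF e(1)] d in \<open>auto simp: u_def\<close>)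
    have "?B \<union> ball 0 (d / 2) \<union> - cball 0 e = UNIV" using d e by auto
    then have u: "Ck_on 1 u UNIV"
      using Ck_on_Un[OF _ _ Ck_on_Un[OF oB open_ball u1 u2] u3] by (simp add: open_Compl open_Un oB)
    have supp: "u z = 0" if "norm (z - 0) \<ge> e" for z
      using that disc_bump_simps(1)[OF d(1)] disc_bump_simps(1)[OF e(1)] d by (auto simp: u_def)
    have eq: "wirtinger_deriv u z = V e z - V d z" if "z \<noteq> 0" for z
    proof (cases "norm z < r")
      case True
      have b': "disc_bump a differentiable (at z)" for a
        using Ck_1D(1)[OF Ck_1_disc_bump] by simp
      have c': "c differentiable (at z)" using Ck_1D(1)[OF cC[of 1] oB, of z] True that by simp
      have "wirtinger_deriv u z = (disc_bump e z - disc_bump d z) * wirtinger_deriv c z +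
          (bump_kernel 0 e z - bump_kernel 0 d z) * c z"
        unfolding u_def using b' c'
        by (simp add: wirtinger_deriv_mult wirtinger_deriv_diff wirtinger_disc_bump differentiable_diff)
      then show ?thesis by (simp add: V_def algebra_simps)
    next
      case False
      then have z: "norm z \<ge> e" "norm z \<ge> d" "z \<in> - cball 0 e" using e d by auto
      have "V e z = 0" "V d z = 0"
        using disc_bump_simps(1)[OF d(1) z(2)] disc_bump_simps(1)[OF e(1) z(1)]
          norm_square_quotient_cases(1)[OF e(1) z(1)] norm_square_quotient_cases(1)[OF d(1) z(2)]
        by (simp_all add: V_def bump_kernel_def bump'_eq_0)
      moreover have "wirtinger_deriv u z = wirtinger_deriv (\<lambda>_. 0) z"
        by (rule wirtinger_deriv_cong_open[OF _ z(3)]) (use supp in \<open>auto simp: open_Compl\<close>)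
      ultimately show ?thesis by simp
    qed
    have "0 = (\<integral>z. wirtinger_deriv u z \<partial>lborel)"
      using integral_wirtinger_compact_support(2)[where p = 0 and r = e, OF u supp] e r by simp
    also have "\<dots> = (\<integral>z. V e z - V d z \<partial>lborel)"
      by (rule integral_discrete_difference[of "{0}"]) (use eq in auto)
    also have "\<dots> = (\<integral>z. V e z \<partial>lborel) - (\<integral>z. V d z \<partial>lborel)"
      using intV[OF e] intV[of d] d e by simp
    finally show ?thesis by simp
  qed
  show "(\<integral>z. V e z \<partial>lborel) = 0"
  proof (rule ccontr)
    let ?I = "norm (\<integral>z. V e z \<partial>lborel)" and ?K = "16 * A + C * M"
    assume "(\<integral>z. V e z \<partial>lborel) \<noteq> 0"
    then have I: "?I > 0" by simp
    have K: "?K \<ge> 0" using A C M by simp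
    \<comment> \<open>Small enough that the bound falls to half the supposed value;
      \<open>?K + 1\<close> keeps the denominator positive.\<close>
    define d where "d = min e (?I / (2 * (?K + 1)))"
    have d: "0 < d" "d \<le> e" using I K e by (auto simp: d_def)
    have "?I \<le> ?K * d" using bdV[OF d] same[OF d] by simp
    also have "\<dots> \<le> (?K + 1) * d" using d by simp
    also have "\<dots> \<le> (?K + 1) * (?I / (2 * (?K + 1)))" using K by (intro mult_left_mono) (auto simp: d_def)
    also have "\<dots> = ?I / 2" using K by (simp add: field_simps)
    finally show False using I by simp
  qed
qed


section \<open>Lattice orbits, generic parallelograms and local integrability\<close>

lemma finite_period_lattice_cball:
  assumes "Im \<tau> > 0"
  shows "finite (period_lattice \<tau> \<inter> cball 0 R)"
proof -
  define b where "b = \<lceil>R / Im \<tau>\<rceil>"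
  define a where "a = \<lceil>R + R / Im \<tau> * \<bar>Re \<tau>\<bar>\<rceil>"
  have "period_lattice \<tau> \<inter> cball 0 R \<subseteq> (\<lambda>(m, n). of_int m + of_int n * \<tau>) ` ({-a..a} \<times> {-b..b})"
  proof
    fix l assume l: "l \<in> period_lattice \<tau> \<inter> cball 0 R"
    then obtain m n where mn: "l = of_int m + of_int n * \<tau>" by (auto simp: period_lattice_def)
    have R: "\<bar>Re l\<bar> \<le> R" "\<bar>Im l\<bar> \<le> R"
      using l abs_Re_le_cmod[of l] abs_Im_le_cmod[of l] by auto
    have "\<bar>of_int n\<bar> * Im \<tau> \<le> R" using R(2) assms by (simp add: mn abs_mult)
    then have n: "\<bar>of_int n\<bar> \<le> R / Im \<tau>" using assms by (simp add: field_simps)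
    have "\<bar>of_int m\<bar> \<le> \<bar>Re l\<bar> + \<bar>of_int n\<bar> * \<bar>Re \<tau>\<bar>"
      by (simp add: mn abs_mult[symmetric])
    also have "\<dots> \<le> R + R / Im \<tau> * \<bar>Re \<tau>\<bar>"
      using R n by (intro add_mono mult_right_mono) auto
    finally have "\<bar>m\<bar> \<le> a" unfolding a_def by linarith
    moreover have "\<bar>n\<bar> \<le> b" using n unfolding b_def by linarith
    ultimately show "l \<in> (\<lambda>(m, n). of_int m + of_int n * \<tau>) ` ({-a..a} \<times> {-b..b})"
      by (intro image_eqI[of _ _ "(m, n)"]) (auto simp: mn)
  qed
  then show ?thesis by (rule finite_subset) auto
qed

lemma lattice_orbit_translate:
  assumes "l \<in> period_lattice \<tau>"
  shows "z + l \<in> lattice_orbit \<tau> P \<longleftrightarrow> z \<in> lattice_orbit \<tau> P"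
proof
  assume "z \<in> lattice_orbit \<tau> P"
  then show "z + l \<in> lattice_orbit \<tau> P"
    unfolding lattice_orbit_def using assms period_lattice_add by (force simp: add.assoc)
next
  assume "z + l \<in> lattice_orbit \<tau> P"
  then obtain p m where "z + l = p + m" "p \<in> P" "m \<in> period_lattice \<tau>"
    by (auto simp: lattice_orbit_def)
  moreover from this have "z = p + (m - l)" by (simp add: algebra_simps)
  ultimately show "z \<in> lattice_orbit \<tau> P"
    unfolding lattice_orbit_def using assms period_lattice_diff by blast
qed

lemma lattice_orbit_Un: "lattice_orbit \<tau> (P \<union> Q) = lattice_orbit \<tau> P \<union> lattice_orbit \<tau> Q"
  by (auto simp: lattice_orbit_def)

lemma finite_lattice_orbit_bounded:
  assumes "Im \<tau> > 0" "finite P" "bounded B"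
  shows "finite (lattice_orbit \<tau> P \<inter> B)"
proof -
  obtain R where R: "\<And>z. z \<in> B \<Longrightarrow> norm z \<le> R" using assms(3) by (auto simp: bounded_iff)
  have "lattice_orbit \<tau> P \<inter> B \<subseteq> (\<Union>p\<in>P. (\<lambda>l. p + l) ` (period_lattice \<tau> \<inter> cball 0 (R + norm p)))"
  proof
    fix z assume z: "z \<in> lattice_orbit \<tau> P \<inter> B"
    then obtain p l where pl: "z = p + l" "p \<in> P" "l \<in> period_lattice \<tau>" by (auto simp: lattice_orbit_def)
    have "norm l \<le> norm z + norm p" using norm_triangle_ineq4[of z p] by (simp add: pl)
    then have "l \<in> cball 0 (R + norm p)" using R[of z] z by simp
    then show "z \<in> (\<Union>p\<in>P. (\<lambda>l. p + l) ` (period_lattice \<tau> \<inter> cball 0 (R + norm p)))"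
      using pl by blast
  qed
  then show ?thesis
    by (rule finite_subset) (use assms finite_period_lattice_cball in auto)
qed

lemma countable_lattice_orbit: "finite P \<Longrightarrow> countable (lattice_orbit \<tau> P)"
proof -
  assume P: "finite P"
  have "lattice_orbit \<tau> P = (\<lambda>(p, l). p + l) ` (P \<times> period_lattice \<tau>)"
    by (auto simp: lattice_orbit_def)
  then show ?thesis using P countable_period_lattice by (simp add: countable_finite)
qed

lemma lattice_orbit_isolated:
  assumes "Im \<tau> > 0" "finite P"
  shows "\<exists>r>0. ball z r \<inter> lattice_orbit \<tau> P \<subseteq> {z}"
proof -
  have "finite (lattice_orbit \<tau> P \<inter> ball z 1)"
    using finite_lattice_orbit_bounded[OF assms bounded_ball] .
  from finite_set_avoid[OF this, of z] obtain d where d: "d > 0"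
    "\<And>x. x \<in> lattice_orbit \<tau> P \<inter> ball z 1 \<Longrightarrow> x \<noteq> z \<Longrightarrow> d \<le> dist z x" by auto
  then show ?thesis by (intro exI[of _ "min d 1"]) force
qed

lemma closed_lattice_orbit:
  assumes "Im \<tau> > 0" "finite P"
  shows "closed (lattice_orbit \<tau> P)"
proof -
  have "\<exists>r>0. ball z r \<subseteq> - lattice_orbit \<tau> P" if "z \<notin> lattice_orbit \<tau> P" for z
  proof -
    obtain r where "r > 0" "ball z r \<inter> lattice_orbit \<tau> P \<subseteq> {z}"
      using lattice_orbit_isolated[OF assms] by blast
    with that show ?thesis by (intro exI[of _ r]) auto
  qed
  then have "open (- lattice_orbit \<tau> P)" by (auto simp: open_contains_ball)
  then show ?thesis by (simp add: closed_def)
qed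

definition open_parallelogram :: "complex \<Rightarrow> complex \<Rightarrow> complex set" where
  "open_parallelogram \<tau> q = {z. coord1 \<tau> (z - q) \<in> {0<..<1} \<and> coord2 \<tau> (z - q) \<in> {0<..<1}}"

lemma open_open_parallelogram: "open (open_parallelogram \<tau> q)"
proof -
  have c: "continuous_on UNIV (\<lambda>z. coord1 \<tau> (z - q))" "continuous_on UNIV (\<lambda>z. coord2 \<tau> (z - q))"
    by (auto intro!: continuous_on_compose2[OF continuous_on_coord(1)[of UNIV]]
        continuous_on_compose2[OF continuous_on_coord(2)[of UNIV]] continuous_intros)
  have "open_parallelogram \<tau> q =
      (\<lambda>z. coord1 \<tau> (z - q)) -` {0<..<1} \<inter> (\<lambda>z. coord2 \<tau> (z - q)) -` {0<..<1}"
    by (auto simp: open_parallelogram_def)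
  then show ?thesis using c by (auto intro!: open_Int open_vimage)
qed

lemma open_parallelogram_subset:
  assumes "Im \<tau> > 0"
  shows "open_parallelogram \<tau> q \<subseteq> parallelogram \<tau> q"
  using assms by (auto simp: open_parallelogram_def parallelogram_def fundamental_parallelogram_iff)

lemma closed_parallelogram_iff:
  assumes "Im \<tau> > 0"
  shows "z \<in> closed_parallelogram \<tau> q \<longleftrightarrow> coord1 \<tau> (z - q) \<in> {0..1} \<and> coord2 \<tau> (z - q) \<in> {0..1}"
proof
  assume "z \<in> closed_parallelogram \<tau> q"
  then obtain s t where st: "z = q + of_real s + of_real t * \<tau>" "s \<in> {0..1}" "t \<in> {0..1}"
    by (auto simp: closed_parallelogram_def)
  then have "z - q = of_real s + of_real t * \<tau>" by simp
  then show "coord1 \<tau> (z - q) \<in> {0..1} \<and> coord2 \<tau> (z - q) \<in> {0..1}"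
    using st(2,3) assms by simp
next
  assume *: "coord1 \<tau> (z - q) \<in> {0..1} \<and> coord2 \<tau> (z - q) \<in> {0..1}"
  have "z = q + of_real (coord1 \<tau> (z - q)) + of_real (coord2 \<tau> (z - q)) * \<tau>"
    using coord_eq[OF assms, of "z - q"] by (simp add: add.assoc)
  then show "z \<in> closed_parallelogram \<tau> q" unfolding closed_parallelogram_def
    using * by (intro image_eqI[of _ _ "(coord1 \<tau> (z - q), coord2 \<tau> (z - q))"]) auto
qed

text \<open>The second property says that the diagonal avoids \<open>S\<close>.\<close>

lemma generic_parallelogram:
  assumes "Im \<tau> > 0" "countable S"
  obtains q where "S \<inter> closed_parallelogram \<tau> q \<subseteq> open_parallelogram \<tau> q"
    "\<And>z. z \<in> S \<Longrightarrow> coord1 \<tau> (z - q) \<noteq> coord2 \<tau> (z - q)"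
proof -
  \<comment> \<open>Values of \<open>x\<close> that put a point of \<open>S\<close> on a line
    through one of the two sides in direction \<tau>. The set \<open>Y\<close> below does the same
    for the other pair of sides, and its third part excludes points of \<open>S\<close> on the line
    through the diagonal. All these sets are countable.\<close>
  define X where "X = coord1 \<tau> ` S \<union> (\<lambda>x. x - 1) ` coord1 \<tau> ` S"
  have "countable X" using assms(2) by (simp add: X_def)
  then have "X \<noteq> UNIV" using uncountable_UNIV_real by auto
  then obtain x where x: "x \<notin> X" by auto
  define Y where "Y = coord2 \<tau> ` S \<union> (\<lambda>y. y - 1) ` coord2 \<tau> ` S \<union> (\<lambda>z. coord2 \<tau> z - coord1 \<tau> z + x) ` S"
  have "countable Y" using assms(2) by (simp add: Y_def)
  then have "Y \<noteq> UNIV" using uncountable_UNIV_real by auto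
  then obtain y where y: "y \<notin> Y" by auto
  define q where "q = of_real x + of_real y * \<tau>"
  have q: "coord1 \<tau> q = x" "coord2 \<tau> q = y" using assms(1) by (simp_all add: q_def)
  have S: "coord1 \<tau> z \<noteq> x \<and> coord1 \<tau> z - 1 \<noteq> x \<and> coord2 \<tau> z \<noteq> y \<and> coord2 \<tau> z - 1 \<noteq> y \<and>
      coord2 \<tau> z - coord1 \<tau> z + x \<noteq> y" if "z \<in> S" for z
    using that x y unfolding X_def Y_def by blast
  show ?thesis
  proof
    show "S \<inter> closed_parallelogram \<tau> q \<subseteq> open_parallelogram \<tau> q"
    proof
      fix z assume z: "z \<in> S \<inter> closed_parallelogram \<tau> q"
      then show "z \<in> open_parallelogram \<tau> q"
        using S[of z] assms(1) by (auto simp: closed_parallelogram_iff open_parallelogram_def q)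
    qed
    show "coord1 \<tau> (z - q) \<noteq> coord2 \<tau> (z - q)" if "z \<in> S" for z
      using S[OF that] assms(1) by (simp add: q)
  qed
qed

lemma set_integrable_locally_inverse_norm:
  fixes f :: "complex \<Rightarrow> complex"
  assumes f: "f \<in> borel_measurable borel" and K: "compact K" and L: "L \<in> sets borel" "L \<subseteq> K"
    and loc: "\<And>p. p \<in> K \<Longrightarrow> \<exists>r>0. \<exists>A\<ge>0. \<forall>z\<in>ball p r - {p}. norm (f z) \<le> A / norm (z - p)"
  shows "set_integrable lborel L f"
proof -
  have "\<exists>r>0. set_integrable lborel (ball p r) f" if p: "p \<in> K" for p
  proof -
    obtain r A where *: "r > 0" "A \<ge> 0" "\<forall>z\<in>ball p r - {p}. norm (f z) \<le> A / norm (z - p)"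
      using loc[OF p] by (elim exE conjE)
    then have "set_integrable lborel (ball p r) f"
      by (intro set_integrable_ball_inverse_norm[OF f]) auto
    then show ?thesis using *(1) by blast
  qed
  then obtain r where r: "\<And>p. p \<in> K \<Longrightarrow> r p > 0" "\<And>p. p \<in> K \<Longrightarrow> set_integrable lborel (ball p (r p)) f"
    by metis
  have "K \<subseteq> (\<Union>p\<in>K. ball p (r p))" using r(1) by force
  with compactE_image[OF K, of K "\<lambda>p. ball p (r p)"] obtain C where
    C: "C \<subseteq> K" "finite C" "K \<subseteq> (\<Union>p\<in>C. ball p (r p))" by auto
  have "set_integrable lborel (\<Union>p\<in>C. ball p (r p)) f"
    using C r by (intro set_integrable_UN) auto
  then show ?thesis by (rule set_integrable_subset) (use L C in auto)
qed

lemma smooth_over_power_at_bound: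
  assumes "smooth_over_power_at f p N"
  shows "\<exists>r>0. \<exists>A\<ge>0. \<forall>z\<in>ball p r - {p}. norm (f z) \<le> A / norm (z - p) ^ N"
proof -
  obtain U g where g: "open U" "p \<in> U" "smooth_fun_on g U" "\<And>z. z \<in> U - {p} \<Longrightarrow> f z = g z / (z - p) ^ N"
    using assms by (auto simp: smooth_over_power_at_def)
  obtain r where r: "r > 0" "cball p r \<subseteq> U" using g open_contains_cball by blast
  have "continuous_on U g" using g(3) unfolding smooth_fun_on_def by (metis Ck_on.simps(1))
  then have "compact (g ` cball p r)"
    using r by (intro compact_continuous_image) (auto intro: continuous_on_subset)
  then obtain M where M: "M > 0" "\<And>z. z \<in> cball p r \<Longrightarrow> norm (g z) \<le> M"
    using compact_imp_bounded bounded_pos[of "g ` cball p r"] by auto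
  have "norm (f z) \<le> M / norm (z - p) ^ N" if z: "z \<in> ball p r - {p}" for z
  proof -
    have "z \<in> U - {p}" using z r(2) by auto
    then have "norm (f z) = norm (g z) / norm (z - p) ^ N" by (simp add: g(4) norm_divide norm_power)
    also have "\<dots> \<le> M / norm (z - p) ^ N" using z by (intro divide_right_mono M) auto
    finally show ?thesis .
  qed
  then show ?thesis using r M by (intro exI[of _ r] conjI exI[of _ M]) auto
qed

text \<open>At a regular point the function is bounded nearby, and a bound \<open>A\<close> on a
  disc of radius \<open>r\<close> is also a bound \<open>A * r / norm (z - p)\<close>. Thus singular
  and regular points satisfy one condition, to which a compactness argument applies.\<close>

lemma smooth_over_simple_pole_bound:
  assumes "smooth_fun_on a (- T)" "closed T" "p \<in> T \<Longrightarrow> smooth_over_power_at a p 1"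
  shows "\<exists>r>0. \<exists>A\<ge>0. \<forall>z\<in>ball p r - {p}. norm (a z) \<le> A / norm (z - p)"
proof (cases "p \<in> T")
  case True
  then show ?thesis using smooth_over_power_at_bound[OF assms(3)[OF True]] by simp
next
  case False
  have "smooth_over_power_at a p 0"
    unfolding smooth_over_power_at_def using False assms by (intro exI[of _ "- T"] exI[of _ a]) auto
  from smooth_over_power_at_bound[OF this] obtain r A where
    r: "r > 0" "A \<ge> 0" "\<And>z. z \<in> ball p r - {p} \<Longrightarrow> norm (a z) \<le> A" by auto
  have "norm (a z) \<le> (A * r) / norm (z - p)" if "z \<in> ball p r - {p}" for z
  proof -
    have "1 \<le> r / norm (z - p)" using that by (auto simp: dist_norm norm_minus_commute)
    then have "A * 1 \<le> A * (r / norm (z - p))" using r by (intro mult_left_mono) auto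
    then show ?thesis using r(3)[OF that] by simp
  qed
  then show ?thesis using r by (intro exI[of _ r] conjI exI[of _ "A * r"]) auto
qed

lemma smooth_off_measurable:
  assumes "smooth_off \<tau> (lattice_orbit \<tau> P) a" "finite P"
  shows "a \<in> borel_measurable borel"
proof -
  have "continuous_on (- lattice_orbit \<tau> P) a"
    using assms unfolding smooth_off_def smooth_fun_on_def by (metis Ck_on.simps(1))
  then show ?thesis
    by (rule borel_measurable_continuous_countable_exceptions[rotated]) (rule countable_lattice_orbit[OF assms(2)])
qed

lemma smooth_off_set_integrable:
  assumes \<tau>: "Im \<tau> > 0" and P: "finite P" and a: "smooth_off \<tau> (lattice_orbit \<tau> P) a"
    and pow: "\<And>p. p \<in> lattice_orbit \<tau> P \<Longrightarrow> smooth_over_power_at a p 1"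
  shows "set_integrable lborel (fundamental_parallelogram \<tau>) a"
proof (rule set_integrable_locally_inverse_norm[OF smooth_off_measurable[OF a P] compact_closed_parallelogram])
  show "fundamental_parallelogram \<tau> \<in> sets borel" by (rule fundamental_parallelogram_borel[OF \<tau>])
  show "fundamental_parallelogram \<tau> \<subseteq> closed_parallelogram \<tau> 0"
    using parallelogram_subset[of \<tau> 0] by simp
  show "\<exists>r>0. \<exists>A\<ge>0. \<forall>z\<in>ball p r - {p}. norm (a z) \<le> A / norm (z - p)" for p
    by (rule smooth_over_simple_pole_bound[OF _ closed_lattice_orbit[OF \<tau> P] pow]) (use a in \<open>simp add: smooth_off_def\<close>)
qed


lemma smooth_fun_on_translate:
  assumes "open U" "smooth_fun_on f U"
  shows "smooth_fun_on (\<lambda>z. f (p + z)) ((\<lambda>z. p + z) -` U)"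
  using assms Ck_on_translate unfolding smooth_fun_on_def by blast

lemma smooth_fun_on_subset: "smooth_fun_on f U \<Longrightarrow> V \<subseteq> U \<Longrightarrow> smooth_fun_on f V"
  using Ck_on_subset unfolding smooth_fun_on_def by blast

lemma wirtinger_deriv_translate:
  "f differentiable (at (p + z)) \<Longrightarrow> wirtinger_deriv (\<lambda>z. f (p + z)) z = wirtinger_deriv f (p + z)"
  by (simp add: wirtinger_deriv_def frechet_derivative_translate)

lemma wirtinger_deriv_periodic:
  assumes S: "closed S" "\<And>z. z + l \<in> S \<longleftrightarrow> z \<in> S"
    and c: "\<And>z. z \<in> - S \<Longrightarrow> c differentiable (at z)" "\<And>z. z \<in> - S \<Longrightarrow> c (z + l) = c z" and z: "z \<notin> S"
  shows "wirtinger_deriv c (z + l) = wirtinger_deriv c z"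
proof -
  have "wirtinger_deriv c z = wirtinger_deriv (\<lambda>w. c (l + w)) z"
    by (rule wirtinger_deriv_cong_open[of "- S"]) (use S z c in \<open>auto simp: open_Compl add.commute\<close>)
  also have "\<dots> = wirtinger_deriv c (l + z)"
    by (rule wirtinger_deriv_translate) (use c(1)[of "l + z"] S(2)[of z] z in \<open>auto simp: add.commute\<close>)
  finally show ?thesis by (simp add: add.commute)
qed

text \<open>Translation of the vanishing statement from the origin to \<open>p\<close>. The
  derivative of \<open>c\<close> is replaced by 0 at \<open>p\<close>, where \<open>c\<close> has an
  arbitrary value; a single point is a null set.\<close>

lemma disc_bump_stokes_at:
  assumes g: "smooth_fun_on g (ball p r)" and r: "r \<le> 1/2"
    and c: "\<And>z. z \<in> ball p r - {p} \<Longrightarrow> c z = g z / (z - p) ^ N"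
    and d: "\<And>z. z \<in> ball p r - {p} \<Longrightarrow> c differentiable (at z)"
    and A: "A \<ge> 0" "\<And>z. z \<in> ball p r - {p} \<Longrightarrow> norm (wirtinger_deriv c z) \<le> A / norm (z - p)"
    and e: "0 < e" "e < r"
  defines "V \<equiv> \<lambda>z. disc_bump e (- p + z) * (if z = p then 0 else wirtinger_deriv c z) + bump_kernel 0 e (- p + z) * c z"
  shows "integrable lborel V" "(\<integral>z. V z \<partial>lborel) = 0"
proof -
  let ?W = "\<lambda>w. disc_bump e w * wirtinger_deriv (\<lambda>w. c (p + w)) w + bump_kernel 0 e w * c (p + w)"
  have vim: "(\<lambda>z. p + z) -` ball p r = ball 0 r" by (auto simp: dist_norm)
  have wd: "wirtinger_deriv (\<lambda>w. c (p + w)) w = wirtinger_deriv c (p + w)" if "w \<in> ball 0 r - {0}" for w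
    by (rule wirtinger_deriv_translate[OF d]) (use that in \<open>auto simp: dist_norm\<close>)
  have W: "integrable lborel ?W" "(\<integral>w. ?W w \<partial>lborel) = 0"
  proof (rule_tac [!] disc_bump_stokes[where g = "\<lambda>z. g (p + z)" and N = N and A = A and r = r])
    show "smooth_fun_on (\<lambda>z. g (p + z)) (ball 0 r)" "smooth_fun_on (\<lambda>z. g (p + z)) (ball 0 r)"
      using smooth_fun_on_translate[OF open_ball g, of p] by (simp_all add: vim)
  qed (use r A(1) A(2)[of "p + w" for w] e c[of "p + w" for w] wd in \<open>auto simp: dist_norm\<close>)
  have eq: "V z = ?W (- p + z)" if "z \<noteq> p" for z
  proof (cases "z \<in> ball p r")
    case True
    then show ?thesis using that wd[of "- p + z"] by (auto simp: V_def dist_norm norm_minus_commute)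
  next
    case False
    then have "norm (- p + z) \<ge> e" using e by (auto simp: dist_norm norm_minus_commute)
    then show ?thesis
      using disc_bump_simps(1)[OF e(1), of "- p + z"] norm_square_quotient_cases(1)[OF e(1), of "- p + z"]
      by (simp add: V_def bump_kernel_def bump'_eq_0)
  qed
  have int: "integrable lborel (\<lambda>z. ?W (- p + z))" by (rule integrable_lborel_translate[OF W(1)])
  have "integrable lborel V \<longleftrightarrow> integrable lborel (\<lambda>z. ?W (- p + z))"
    by (rule integrable_discrete_difference[of "{p}"]) (use eq in auto)
  with int show "integrable lborel V" by blast
  have "(\<integral>z. V z \<partial>lborel) = (\<integral>z. ?W (- p + z) \<partial>lborel)"
    by (rule integral_discrete_difference[of "{p}"]) (use eq in auto)
  also have "\<dots> = (\<integral>z. ?W z \<partial>lborel)"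
    by (rule integral_lborel_translate) (use borel_measurable_integrable[OF W(1)] in simp)
  finally show "(\<integral>z. V z \<partial>lborel) = 0" using W(2) by simp
qed

section \<open>Global Stokes theorem and uniqueness of the regularized integral\<close>

lemma torus_stokes_singular:
  assumes \<tau>: "Im \<tau> > 0" and P: "finite P" and S: "S = lattice_orbit \<tau> P"
    and c: "smooth_off \<tau> S c" and pow: "\<And>p. p \<in> S \<Longrightarrow> \<exists>N. smooth_over_power_at c p N"
    and bd: "\<And>p. p \<in> S \<Longrightarrow> \<exists>r>0. \<exists>A\<ge>0. \<forall>z\<in>ball p r - {p}. norm (wirtinger_deriv c z) \<le> A / norm (z - p)"
  shows "set_lebesgue_integral lborel (fundamental_parallelogram \<tau>)
    (\<lambda>z. if z \<in> S then 0 else wirtinger_deriv c z) = 0"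
proof -
  define v where "v = (\<lambda>z. if z \<in> S then 0 else wirtinger_deriv c z)"
  have clS: "closed S" and coS: "countable S" and trS: "l \<in> period_lattice \<tau> \<Longrightarrow> z + l \<in> S \<longleftrightarrow> z \<in> S" for z l
    unfolding S by (auto intro: closed_lattice_orbit countable_lattice_orbit \<tau> P simp: lattice_orbit_translate)
  have oS: "open (- S)" using clS by (rule open_Compl)
  have cC: "Ck_on n c (- S)" for n using c by (simp add: smooth_off_def smooth_fun_on_def)
  have cd: "c differentiable (at z)" if "z \<in> - S" for z using Ck_1D(1)[OF cC oS that] .
  have cper: "c (z + l) = c z" if "z \<in> - S" "l \<in> period_lattice \<tau>" for z l
    using c that by (auto simp: smooth_off_def)
  \<comment> \<open>With this corner no singularity lies on the boundary, so the cut-off discs can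
    be kept in the interior and never have to be continued periodically.\<close>
  obtain q where q: "S \<inter> closed_parallelogram \<tau> q \<subseteq> open_parallelogram \<tau> q"
    using generic_parallelogram[OF \<tau> coS] by metis
  let ?C = "closed_parallelogram \<tau> q" and ?O = "open_parallelogram \<tau> q" and ?Pq = "parallelogram \<tau> q"
  define P' where "P' = S \<inter> ?C"
  have P': "finite P'"
    unfolding P'_def S by (rule finite_lattice_orbit_bounded[OF \<tau> P]) (rule compact_imp_bounded[OF compact_closed_parallelogram])
  \<comment> \<open>All requirements on a radius around \<open>p\<close>. They pass to smaller
    radii, so the finitely many singularities can share one.\<close>
  define Q where "Q = (\<lambda>p r. ball p r \<subseteq> ?O \<and> ball p r \<inter> S \<subseteq> {p} \<and>
    (\<exists>N g. smooth_fun_on g (ball p r) \<and> (\<forall>z\<in>ball p r - {p}. c z = g z / (z - p) ^ N)) \<and>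
    (\<exists>A\<ge>0. \<forall>z\<in>ball p r - {p}. norm (wirtinger_deriv c z) \<le> A / norm (z - p)))"
  have Qmono: "Q p s" if "Q p r" "s \<le> r" for p r s
  proof -
    have sub: "ball p s \<subseteq> ball p r" using that by auto
    then show ?thesis using that(1) unfolding Q_def
      by (meson Diff_mono order_refl inf_mono smooth_fun_on_subset subset_iff subset_trans)
  qed
  have "\<exists>r>0. Q p r" if p: "p \<in> P'" for p
  proof -
    have "p \<in> ?O" "p \<in> S" using p q by (auto simp: P'_def)
    obtain r1 where r1: "r1 > 0" "ball p r1 \<subseteq> ?O"
      using open_open_parallelogram \<open>p \<in> ?O\<close> open_contains_ball by blast
    obtain r2 where r2: "r2 > 0" "ball p r2 \<inter> S \<subseteq> {p}"
      using lattice_orbit_isolated[OF \<tau> P] unfolding S by blast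
    obtain N U g where U: "open U" "p \<in> U" "smooth_fun_on g U" "\<And>z. z \<in> U - {p} \<Longrightarrow> c z = g z / (z - p) ^ N"
      using pow[OF \<open>p \<in> S\<close>] by (auto simp: smooth_over_power_at_def)
    obtain r3 where r3: "r3 > 0" "ball p r3 \<subseteq> U" using U open_contains_ball by blast
    obtain r4 A where r4: "r4 > 0" "A \<ge> 0" "\<forall>z\<in>ball p r4 - {p}. norm (wirtinger_deriv c z) \<le> A / norm (z - p)"
      using bd[OF \<open>p \<in> S\<close>] by (elim exE conjE)
    define r where "r = Min {r1, r2, r3, r4}"
    have r: "r > 0" "r \<le> r1" "r \<le> r2" "r \<le> r3" "r \<le> r4" using r1 r2 r3 r4 by (auto simp: r_def)
    have "smooth_fun_on g (ball p r)" by (rule smooth_fun_on_subset[OF U(3)]) (use r r3 in auto)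
    moreover have "\<forall>z\<in>ball p r - {p}. c z = g z / (z - p) ^ N" using r r3 by (intro ballI U(4)) auto
    moreover have "ball p r \<subseteq> ball p r1" "ball p r \<subseteq> ball p r2" using r by auto
    then have "ball p r \<subseteq> ?O" "ball p r \<inter> S \<subseteq> {p}" using r1 r2 by blast+
    moreover have "\<forall>z\<in>ball p r - {p}. norm (wirtinger_deriv c z) \<le> A / norm (z - p)" using r r4 by auto
    ultimately have "Q p r" using r4(2) unfolding Q_def by blast
    then show ?thesis using r by blast
  qed
  then obtain \<rho> where \<rho>: "\<And>p. p \<in> P' \<Longrightarrow> \<rho> p > 0" "\<And>p. p \<in> P' \<Longrightarrow> Q p (\<rho> p)" by metis
  define r where "r = Min (insert (1/2) (\<rho> ` P'))"
  \<comment> \<open>Distinct singularities are at distance at least \<open>r = 2 * e\<close>; near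
    each of them all cut-offs but its own vanish, which is what makes \<open>B\<close> equal to 0
    there.\<close>
  define e where "e = r / 2"
  have "r > 0" using \<rho>(1) P' by (auto simp: r_def)
  moreover have "r \<le> 1/2" unfolding r_def using P' by (intro Min_le) auto
  ultimately have r: "r > 0" "r \<le> 1/2" by auto
  have e: "0 < e" "e < r" using r by (auto simp: e_def)
  have Q: "Q p r" if "p \<in> P'" for p
    by (rule Qmono[OF \<rho>(2)[OF that]]) (use P' that in \<open>auto simp: r_def\<close>)
  have Qe: "ball p e \<subseteq> ?O" if "p \<in> P'" for p
    using Q[OF that] subset_ball[of e r p] e unfolding Q_def by (meson less_imp_le subset_trans)
  define b where "b = (\<lambda>p z. disc_bump e (- p + z))"
  define V where "V = (\<lambda>p z. disc_bump e (- p + z) * (if z = p then 0 else wirtinger_deriv c z) + bump_kernel 0 e (- p + z) * c z)"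
  have V: "integrable lborel (V p)" "(\<integral>z. V p z \<partial>lborel) = 0" if p: "p \<in> P'" for p
  proof -
    obtain N g A where *: "smooth_fun_on g (ball p r)" "\<And>z. z \<in> ball p r - {p} \<Longrightarrow> c z = g z / (z - p) ^ N"
      "A \<ge> 0" "\<And>z. z \<in> ball p r - {p} \<Longrightarrow> norm (wirtinger_deriv c z) \<le> A / norm (z - p)" "ball p r \<inter> S \<subseteq> {p}"
      using Q[OF p] unfolding Q_def by blast
    have d: "c differentiable (at z)" if "z \<in> ball p r - {p}" for z using * that by (intro cd) auto
    show "integrable lborel (V p)" "(\<integral>z. V p z \<partial>lborel) = 0"
      unfolding V_def by (rule disc_bump_stokes_at[OF *(1) r(2) *(2) d *(3,4) e]; assumption)+
  qed
  have b0: "b p z = 0" "V p z = 0" if "z \<notin> ball p e" for p z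
  proof -
    have "norm (- p + z) \<ge> e" using that by (auto simp: dist_norm norm_minus_commute)
    then show "b p z = 0" "V p z = 0"
      using disc_bump_simps(1)[OF e(1), of "- p + z"] norm_square_quotient_cases(1)[OF e(1), of "- p + z"]
      by (simp_all add: b_def V_def bump_kernel_def bump'_eq_0)
  qed
  have b1: "b p z = 1" if "z \<in> ball p (e / 2)" for p z
    using that disc_bump_simps(2)[OF e(1), of "- p + z"] by (simp add: b_def dist_norm norm_minus_commute)
  have bC: "Ck_on 1 (b p) UNIV" for p
    using Ck_on_translate[where p = "- p", OF open_UNIV Ck_1_disc_bump[of e]] by (simp add: b_def)
  have bd: "b p differentiable (at z)" for p z using Ck_1D(1)[OF bC] by simp
  have wb: "wirtinger_deriv (b p) z = bump_kernel 0 e (- p + z)" for p z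
    unfolding b_def using Ck_1D(1)[OF Ck_1_disc_bump]
    by (subst wirtinger_deriv_translate) (simp_all add: wirtinger_disc_bump)
  define B where "B = (\<lambda>z. 1 - (\<Sum>p\<in>P'. b p z))"
  have sumC: "Ck_on 1 (\<lambda>z. \<Sum>p\<in>I. b p z) UNIV" if "finite I" for I
    using that by (induction I rule: finite_induct) (auto intro!: Ck_on_add Ck_on_const bC simp del: Ck_on.simps One_nat_def)
  have BC: "Ck_on 1 B UNIV" unfolding B_def by (intro Ck_on_diff open_UNIV Ck_on_const sumC P')
  \<comment> \<open>The part of \<open>c\<close> away from its singularities. It extends by 0 across
    them, and on the boundary it coincides with \<open>c\<close>, so opposite sides agree by
    periodicity of \<open>c\<close>.\<close>
  define u where "u = (\<lambda>z. c z * B z)"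
  define W1 where "W1 = (\<Union>p\<in>P'. ball p (e / 2))"
  have B_W1: "B z = 0" if z: "z \<in> W1" for z
  proof -
    obtain p where p: "p \<in> P'" "z \<in> ball p (e / 2)" using z by (auto simp: W1_def)
    have "b p' z = (if p' = p then 1 else 0)" if "p' \<in> P'" for p'
    proof (cases "p' = p")
      case False
      have "p \<notin> ball p' r" using False Q[OF that] p by (auto simp: Q_def P'_def)
      then have "dist p' p \<ge> r" by auto
      then have "dist p' z \<ge> e" using p(2) r dist_triangle[of p' p z] by (auto simp: e_def dist_commute)
      then show ?thesis using False b0(1)[of z p'] by simp
    qed (use b1 p in simp)
    then show ?thesis using p P' by (simp add: B_def)
  qed
  have oW1: "open W1" by (auto simp: W1_def)
  have u1: "Ck_on 1 u W1" by (rule Ck_on_cong[OF oW1 _ Ck_on_const[of 1 0]]) (simp add: u_def B_W1)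
  have u2: "Ck_on 1 u (- S)" unfolding u_def by (intro Ck_on_mult[OF oS] cC Ck_on_subset[OF BC]) auto
  have oW: "open (W1 \<union> - S)" using oW1 oS by auto
  have uC: "Ck_on 1 u (W1 \<union> - S)" by (rule Ck_on_Un[OF oW1 oS u1 u2])
  have sub: "?C \<subseteq> W1 \<union> - S" using e by (auto simp: W1_def P'_def)
  note D = Ck_1D[OF uC oW]
  have side: "u (z + l) = u z"
    if "z \<in> ?C" "z + l \<in> ?C" "z \<notin> ?O" "z + l \<notin> ?O" "l \<in> period_lattice \<tau>" for z l
  proof -
    have "z \<notin> S" using \<open>z \<in> ?C\<close> \<open>z \<notin> ?O\<close> q by auto
    moreover have "B z' = 1" if "z' \<in> {z, z + l}" for z'
    proof -
      have "z' \<notin> ?O" using that \<open>z \<notin> ?O\<close> \<open>z + l \<notin> ?O\<close> by auto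
      then have "z' \<notin> ball p e" if "p \<in> P'" for p
        using Qe[OF that] by blast
      then show "B z' = 1" unfolding B_def using b0(1) by simp
    qed
    ultimately show ?thesis using cper[of z l] that(5) by (simp add: u_def)
  qed
  have wu: "set_lebesgue_integral lborel ?Pq (\<lambda>z. frechet_derivative u (at z) w) = 0" for w
  proof (rule integral_derivative_parallelogram_0[OF \<tau>])
    fix t :: real assume t: "t \<in> {0..1}"
    have cf: "coord1 \<tau> 1 = 1" "coord2 \<tau> 1 = 0" "coord1 \<tau> \<tau> = 0" "coord2 \<tau> \<tau> = 1"
      using coord1_simps(1)[OF \<tau>, of 1] coord2_simps(1)[OF \<tau>, of 1]
        coord1_simps(2)[OF \<tau>, of 1] coord2_simps(2)[OF \<tau>, of 1] by simp_all
    have rw: "q + of_real t * \<tau> + 1 - q = of_real t * \<tau> + 1" "q + of_real t * \<tau> - q = of_real t * \<tau>"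
      "q + of_real t + \<tau> - q = of_real t + \<tau>" "q + of_real t - q = of_real t" by simp_all
    have "u (q + of_real t * \<tau> + 1) = u (q + of_real t * \<tau>)"
      unfolding closed_parallelogram_iff[OF \<tau>] by (rule side)
        (use t \<tau> cf in \<open>simp_all add: closed_parallelogram_iff[OF \<tau>] open_parallelogram_def rw del: coord1_simps(3,4) coord2_simps(3,4)\<close>,
         use t \<tau> cf in \<open>simp_all\<close>)
    then show "u (q + 1 + of_real t * \<tau>) = u (q + of_real t * \<tau>)" by (simp add: add_ac)
    show "u (q + of_real t + \<tau>) = u (q + of_real t)"
      by (rule side)
        (use t \<tau> cf in \<open>simp_all add: closed_parallelogram_iff[OF \<tau>] open_parallelogram_def rw del: coord1_simps(3,4) coord2_simps(3,4)\<close>,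
         use t \<tau> cf in \<open>simp_all\<close>)
  qed (use D sub in \<open>auto intro: continuous_on_subset\<close>)
  have int: "set_integrable lborel ?Pq (\<lambda>z. k * frechet_derivative u (at z) w)" for k w
    by (intro continuous_closed_parallelogram_integrable[OF \<tau>] continuous_intros continuous_on_subset[OF D(2) sub])
  have wint: "set_integrable lborel ?Pq (wirtinger_deriv u)"
    and w0: "set_lebesgue_integral lborel ?Pq (wirtinger_deriv u) = 0"
  proof -
    have eq: "wirtinger_deriv u = (\<lambda>z. (1/2) * frechet_derivative u (at z) 1 + (- \<i>/2) * frechet_derivative u (at z) \<i>)"
      by (simp add: wirtinger_deriv_def fun_eq_iff diff_divide_distrib)
    show "set_integrable lborel ?Pq (wirtinger_deriv u)"
      unfolding eq by (rule set_integral_add(1)[OF int int])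
    show "set_lebesgue_integral lborel ?Pq (wirtinger_deriv u) = 0"
      unfolding eq by (subst set_integral_add(2)[OF int int]) (simp only: set_integral_mult_right wu mult_zero_right add_0)
  qed
  have Vs: "indicator ?Pq z *\<^sub>R V p z = V p z" if "p \<in> P'" for p z
  proof (cases "z \<in> ?Pq")
    case False
    then have "z \<notin> ball p e"
      using Qe[OF that] open_parallelogram_subset[OF \<tau>, of q] by blast
    then show ?thesis using b0(2) by simp
  qed simp
  have Vint: "set_integrable lborel ?Pq (V p)" and V0: "set_lebesgue_integral lborel ?Pq (V p) = 0" if "p \<in> P'" for p
    using V[OF that] by (simp_all add: set_integrable_def set_lebesgue_integral_def Vs[OF that])
  \<comment> \<open>Leibniz' rule for \<open>c * B\<close>: the derivatives of the cut-offs cancel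
    against the kernel terms of the \<open>V p\<close>. The smooth part integrates to 0 by comparing
    sides, each \<open>V p\<close> by the local statement.\<close>
  have eq: "v z = wirtinger_deriv u z + (\<Sum>p\<in>P'. V p z)" if z: "z \<notin> S" for z
  proof -
    have "wirtinger_deriv B z = - (\<Sum>p\<in>P'. bump_kernel 0 e (- p + z))"
      unfolding B_def using bd P' Ck_1D(1)[OF sumC[OF P']]
      by (subst wirtinger_deriv_diff) (auto simp: wirtinger_deriv_sum wb)
    moreover have "V p z = b p z * wirtinger_deriv c z + bump_kernel 0 e (- p + z) * c z" if "p \<in> P'" for p
      using z that by (auto simp: V_def b_def P'_def)
    moreover have "wirtinger_deriv u z = c z * wirtinger_deriv B z + wirtinger_deriv c z * B z"
      unfolding u_def using cd z Ck_1D(1)[OF BC] by (intro wirtinger_deriv_mult) auto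
    ultimately show ?thesis using z
      by (simp add: v_def B_def sum.distrib sum_distrib_right sum_distrib_left algebra_simps)
  qed
  define v' where "v' = (\<lambda>z. wirtinger_deriv u z + (\<Sum>p\<in>P'. V p z))"
  have sint: "set_integrable lborel ?Pq (\<lambda>z. \<Sum>p\<in>P'. V p z)"
    using Vint by (simp add: set_integrable_def scaleR_sum_right)
  have s0: "set_lebesgue_integral lborel ?Pq (\<lambda>z. \<Sum>p\<in>P'. V p z) = 0"
    using Vint V0 by (simp add: set_integrable_def set_lebesgue_integral_def scaleR_sum_right)
  have v'int: "set_integrable lborel ?Pq v'" and v'0: "set_lebesgue_integral lborel ?Pq v' = 0"
    unfolding v'_def using set_integral_add[OF wint sint] w0 s0 by simp_all
  have "set_integrable lborel ?Pq v \<longleftrightarrow> set_integrable lborel ?Pq v'"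
    unfolding set_integrable_def by (rule integrable_discrete_difference[of S]) (use eq coS in \<open>auto simp: v'_def\<close>)
  with v'int have vint: "set_integrable lborel ?Pq v" by blast
  have "set_lebesgue_integral lborel ?Pq v = set_lebesgue_integral lborel ?Pq v'"
    unfolding set_lebesgue_integral_def by (rule integral_discrete_difference[of S]) (use eq coS in \<open>auto simp: v'_def\<close>)
  \<comment> \<open>Back from the generic corner to the standard parallelogram, by periodicity of
    \<open>v\<close>.\<close>
  moreover have "set_lebesgue_integral lborel ?Pq v = set_lebesgue_integral lborel (parallelogram \<tau> 0) v"
  proof (rule parallelogram_integral_periodic[OF \<tau> _ vint])
    fix z l assume l: "l \<in> period_lattice \<tau>"
    show "v (z + l) = v z"
      using wirtinger_deriv_periodic[OF clS trS[OF l] cd cper[OF _ l], of z] trS[OF l, of z] by (auto simp: v_def)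
  qed
  ultimately show ?thesis using v'0 by (simp add: v_def)
qed

text \<open>The difference \<open>c\<close> of the two potentials may have poles of any order, but
  its derivative is a multiple of \<open>a1 - a2\<close> and so is bounded by a simple pole. These
  are exactly the conditions under which the singular Stokes theorem applies.\<close>

lemma reg_decomposition_unique:
  assumes \<tau>: "Im \<tau> > 0" and d1: "reg_decomposition \<tau> f S1 a1 b1" and d2: "reg_decomposition \<tau> f S2 a2 b2"
  shows "set_lebesgue_integral lborel (fundamental_parallelogram \<tau>) a1 =
    set_lebesgue_integral lborel (fundamental_parallelogram \<tau>) a2"
proof -
  obtain P1 P2 where P: "finite P1" "S1 = lattice_orbit \<tau> P1" "finite P2" "S2 = lattice_orbit \<tau> P2"
    using d1 d2 by (auto simp: reg_decomposition_def)
  define S where "S = S1 \<union> S2"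
  have S: "S = lattice_orbit \<tau> (P1 \<union> P2)" "finite (P1 \<union> P2)" using P by (auto simp: S_def lattice_orbit_Un)
  have cl: "closed S" "closed S1" "closed S2"
    unfolding S P(2,4) by (auto intro!: closed_lattice_orbit \<tau> P S(2))
  have coS: "countable S" unfolding S by (rule countable_lattice_orbit[OF S(2)])
  define c where "c = (\<lambda>z. b2 z - b1 z)"
  have sb: "smooth_fun_on b1 (- S1)" "smooth_fun_on b2 (- S2)"
    using d1 d2 by (auto simp: reg_decomposition_def smooth_off_def)
  have oS: "open (- S)" "open (- S1)" "open (- S2)" using cl by auto
  have c1: "smooth_fun_on c (- S)"
    using sb oS unfolding smooth_fun_on_def c_def
    by (auto intro!: Ck_on_diff intro: Ck_on_subset simp: S_def)
  have c2: "smooth_off \<tau> S c"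
    unfolding smooth_off_def using c1 d1 d2 by (auto simp: c_def S_def reg_decomposition_def smooth_off_def)
  \<comment> \<open>A point of the union that is singular for only one decomposition is regular for
    the other, which is covered by the exponent 0.\<close>
  have sm: "\<exists>N. smooth_over_power_at b p N" if "smooth_fun_on b (- T)" "closed T"
     "\<And>p. p \<in> T \<Longrightarrow> \<exists>N. smooth_over_power_at b p N" for b p T
  proof (cases "p \<in> T")
    case False
    have "smooth_over_power_at b p 0"
      unfolding smooth_over_power_at_def using False that by (intro exI[of _ "- T"] exI[of _ b]) auto
    then show ?thesis by blast
  qed (use that in auto)
  have pow: "\<exists>N. smooth_over_power_at c p N" if "p \<in> S" for p
  proof -
    have pw1: "\<exists>N. smooth_over_power_at b1 p N"
      by (rule sm[OF sb(1) cl(2)]) (use d1 in \<open>simp add: reg_decomposition_def\<close>)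
    have pw2: "\<exists>N. smooth_over_power_at b2 p N"
      by (rule sm[OF sb(2) cl(3)]) (use d2 in \<open>simp add: reg_decomposition_def\<close>)
    obtain N1 U1 g1 where 1: "open U1" "p \<in> U1" "smooth_fun_on g1 U1" "\<And>z. z \<in> U1 - {p} \<Longrightarrow> b1 z = g1 z / (z - p) ^ N1"
      using pw1 unfolding smooth_over_power_at_def by blast
    obtain N2 U2 g2 where 2: "open U2" "p \<in> U2" "smooth_fun_on g2 U2" "\<And>z. z \<in> U2 - {p} \<Longrightarrow> b2 z = g2 z / (z - p) ^ N2"
      using pw2 unfolding smooth_over_power_at_def by blast
    \<comment> \<open>The numerator of \<open>b2 - b1\<close> over the common denominator
      \<open>(z - p) ^ (N1 + N2)\<close>.\<close>
    let ?g = "\<lambda>z. g2 z * (z - p) ^ N1 - g1 z * (z - p) ^ N2"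
    have "smooth_fun_on ?g (U1 \<inter> U2)"
      unfolding smooth_fun_on_def
    proof
      fix n
      have o: "open (U1 \<inter> U2)" using 1 2 by auto
      have h: "Ck_on n (\<lambda>z. (z - p) ^ m) (U1 \<inter> U2)" for m
        by (intro holomorphic_imp_Ck_on[OF o] holomorphic_intros)
      show "Ck_on n ?g (U1 \<inter> U2)"
        using 1 2 by (intro Ck_on_diff[OF o] Ck_on_mult[OF o] h)
          (auto simp: smooth_fun_on_def intro: Ck_on_subset)
    qed
    moreover have "c z = ?g z / (z - p) ^ (N1 + N2)" if "z \<in> U1 \<inter> U2 - {p}" for z
    proof -
      have "g1 z = b1 z * (z - p) ^ N1" "g2 z = b2 z * (z - p) ^ N2"
        using that 1(4)[of z] 2(4)[of z] by auto
      then show ?thesis using that by (simp add: c_def power_add field_simps)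
    qed
    ultimately have "smooth_over_power_at c p (N1 + N2)"
      unfolding smooth_over_power_at_def using 1 2 by (intro exI[of _ "U1 \<inter> U2"] exI[of _ ?g]) auto
    then show ?thesis by blast
  qed
  have wc: "a1 z - a2 z = - 2 * \<i> * wirtinger_deriv c z" if "z \<notin> S" for z
  proof -
    have z: "z \<in> - S1" "z \<in> - S2" using that by (auto simp: S_def)
    have b: "b1 differentiable (at z)" "b2 differentiable (at z)"
      using Ck_1D(1)[of b1 "- S1" z] Ck_1D(1)[of b2 "- S2" z] sb oS z by (auto simp: smooth_fun_on_def simp del: Ck_on.simps)
    have "a1 z + (- 2 * \<i>) * wirtinger_deriv b1 z = a2 z + (- 2 * \<i>) * wirtinger_deriv b2 z"
      using d1 d2 z unfolding reg_decomposition_def by metis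
    then show ?thesis unfolding c_def wirtinger_deriv_diff[OF b(2,1)] by (simp add: algebra_simps)
  qed
  have int: "set_integrable lborel (fundamental_parallelogram \<tau>) a1" "set_integrable lborel (fundamental_parallelogram \<tau>) a2"
    by (rule smooth_off_set_integrable[OF \<tau> P(1)]; use d1 in \<open>simp add: reg_decomposition_def P(2)[symmetric]\<close>)
       (rule smooth_off_set_integrable[OF \<tau> P(3)]; use d2 in \<open>simp add: reg_decomposition_def P(4)[symmetric]\<close>)
  have bd: "\<exists>r>0. \<exists>A\<ge>0. \<forall>z\<in>ball p r - {p}. norm (wirtinger_deriv c z) \<le> A / norm (z - p)" if "p \<in> S" for p
  proof -
    obtain r1 A1 where 1: "r1 > 0" "A1 \<ge> 0" "\<forall>z\<in>ball p r1 - {p}. norm (a1 z) \<le> A1 / norm (z - p)"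
      using smooth_over_simple_pole_bound[of a1 S1 p] cl d1 unfolding reg_decomposition_def smooth_off_def by (elim exE conjE) auto
    obtain r2 A2 where 2: "r2 > 0" "A2 \<ge> 0" "\<forall>z\<in>ball p r2 - {p}. norm (a2 z) \<le> A2 / norm (z - p)"
      using smooth_over_simple_pole_bound[of a2 S2 p] cl d2 unfolding reg_decomposition_def smooth_off_def by (elim exE conjE) auto
    obtain r3 where 3: "r3 > 0" "ball p r3 \<inter> S \<subseteq> {p}"
      using lattice_orbit_isolated[OF \<tau> S(2)] unfolding S by blast
    have "norm (wirtinger_deriv c z) \<le> (A1 + A2) / norm (z - p)" if "z \<in> ball p (Min {r1, r2, r3}) - {p}" for z
    proof -
      have z: "z \<in> ball p r1 - {p}" "z \<in> ball p r2 - {p}" "z \<notin> S" using that 3 by auto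
      have "2 * norm (wirtinger_deriv c z) = norm (a1 z - a2 z)" unfolding wc[OF z(3)] by (simp add: norm_mult)
      also have "\<dots> \<le> norm (a1 z) + norm (a2 z)" by (rule norm_triangle_ineq4)
      also have "\<dots> \<le> A1 / norm (z - p) + A2 / norm (z - p)" using 1 2 z by (intro add_mono) auto
      finally have "2 * norm (wirtinger_deriv c z) \<le> (A1 + A2) / norm (z - p)" by (simp add: add_divide_distrib)
      then show ?thesis using norm_ge_zero[of "wirtinger_deriv c z"] by linarith
    qed
    then show ?thesis using 1 2 3 by (intro exI[of _ "Min {r1, r2, r3}"] conjI exI[of _ "A1 + A2"]) auto
  qed
  let ?F = "fundamental_parallelogram \<tau>"
  let ?v = "\<lambda>z. if z \<in> S then 0 else wirtinger_deriv c z"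
  have "set_lebesgue_integral lborel ?F a1 - set_lebesgue_integral lborel ?F a2 =
      set_lebesgue_integral lborel ?F (\<lambda>z. a1 z - a2 z)"
    using int by (simp add: set_integral_diff)
  also have "\<dots> = set_lebesgue_integral lborel ?F (\<lambda>z. (- 2 * \<i>) * ?v z)"
    unfolding set_lebesgue_integral_def
    by (rule integral_discrete_difference[of S]) (use coS wc in auto)
  also have "\<dots> = (- 2 * \<i>) * set_lebesgue_integral lborel ?F ?v"
    by (rule set_integral_mult_right)
  also have "set_lebesgue_integral lborel ?F ?v = 0"
    by (rule torus_stokes_singular[OF \<tau> S(2,1) c2 pow bd])
  finally show ?thesis by simp
qed

lemma reg_integral_eq:
  assumes "Im \<tau> > 0" "reg_decomposition \<tau> f S a b"
  shows "reg_integral \<tau> f = set_lebesgue_integral lborel (fundamental_parallelogram \<tau>) a"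
  unfolding reg_integral_def using assms reg_decomposition_unique[OF assms(1)]
  by (intro the_equality) blast+


section \<open>Elliptic functions without residues\<close>

text \<open>The integral from a base point does not depend on the path. On a small disc it is
  compared with a local primitive \<open>H\<close> along the closed path through the base point,
  \<open>x\<close> and \<open>y\<close>. No simple connectedness is involved, as needed for the
  plane with all poles removed.\<close>

lemma primitive_of_closed_integrals_0:
  assumes U: "open U" "connected U" and f: "f holomorphic_on U"
    and closed: "\<And>\<gamma>. valid_path \<gamma> \<Longrightarrow> path_image \<gamma> \<subseteq> U \<Longrightarrow> pathfinish \<gamma> = pathstart \<gamma> \<Longrightarrow>
      contour_integral \<gamma> f = 0"
  shows "\<exists>G. \<forall>z\<in>U. (G has_field_derivative f z) (at z)"
proof (cases "U = {}")
  case False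
  then obtain a where a: "a \<in> U" by blast
  have "\<exists>g. valid_path g \<and> path_image g \<subseteq> U \<and> pathstart g = a \<and> pathfinish g = z" if "z \<in> U" for z
    using connected_open_polynomial_connected[OF U a that] valid_path_polynomial_function by blast
  then obtain g where g: "\<And>z. z \<in> U \<Longrightarrow> valid_path (g z)" "\<And>z. z \<in> U \<Longrightarrow> path_image (g z) \<subseteq> U"
    "\<And>z. z \<in> U \<Longrightarrow> pathstart (g z) = a" "\<And>z. z \<in> U \<Longrightarrow> pathfinish (g z) = z"
    by metis
  define G where "G = (\<lambda>z. contour_integral (g z) f)"
  have ci: "f contour_integrable_on p" if "valid_path p" "path_image p \<subseteq> U" for p
    using contour_integrable_holomorphic_simple[OF f U(1) that] .
  have "(G has_field_derivative f x) (at x)" if x: "x \<in> U" for x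
  proof -
    obtain d where d: "d > 0" "ball x d \<subseteq> U" using U(1) x open_contains_ball by blast
    obtain H where H: "\<And>y. y \<in> ball x d \<Longrightarrow> (H has_field_derivative f y) (at y within ball x d)"
      using holomorphic_convex_primitive'[OF convex_ball open_ball holomorphic_on_subset[OF f d(2)]] by metis
    have eq: "G x + H y - H x = G y" if y: "y \<in> ball x d" for y
    proof -
      have yU: "y \<in> U" using y d by auto
      have seg: "closed_segment x y \<subseteq> ball x d"
        using y d(1) by (intro closed_segment_subset convex_ball) auto
      have L: "(f has_contour_integral H y - H x) (linepath x y)"
        using contour_integral_primitive[of "ball x d" H f "linepath x y"] H seg by simp
      let ?p = "g x +++ linepath x y +++ reversepath (g y)"
      have v: "valid_path (linepath x y +++ reversepath (g y))"
        "path_image (linepath x y +++ reversepath (g y)) \<subseteq> U"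
        using g(1,4)[OF yU] g(2)[OF yU] seg d(2) by (auto intro!: valid_path_join path_image_join_subset[THEN subset_trans])
      have "valid_path ?p" "path_image ?p \<subseteq> U" "pathfinish ?p = pathstart ?p"
        using g[OF x] g[OF yU] v by (auto intro!: valid_path_join path_image_join_subset[THEN subset_trans])
      from closed[OF this] have "0 = contour_integral ?p f" by simp
      also have "\<dots> = G x + (contour_integral (linepath x y) f - G y)"
        using g[OF x] g[OF yU] v ci[OF v] ci[of "g x"] ci[of "g y"] L
        by (simp add: G_def has_contour_integral_integrable contour_integrable_reversepath
            contour_integral_reversepath has_contour_integral_unique)
      finally show ?thesis using contour_integral_unique[OF L] by (simp add: algebra_simps)
    qed
    have "((\<lambda>y. G x + H y - H x) has_field_derivative f x) (at x)"
      using H[of x] d(1) at_within_open[of x "ball x d"] by (auto intro!: derivative_eq_intros)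
    then show ?thesis
      by (rule has_field_derivative_transform_within_open[of _ _ _ "ball x d"]) (use d eq in auto)
  qed
  then show ?thesis by blast
qed auto

text \<open>Induction on the exponent: \<open>g\<close> is \<open>g p\<close> plus
  \<open>(z - p) * g2\<close>, and the principal term \<open>g p / (z - p) ^ Suc N\<close> has an
  elementary primitive unless \<open>N = 0\<close>, where the residue condition forces
  \<open>g p = 0\<close>. The result has the form of a holomorphic function over a power, as a
  potential in a decomposition must.\<close>

lemma pole_primitive:
  fixes g :: "complex \<Rightarrow> complex"
  assumes "g holomorphic_on ball p r" "r > 0" "residue (\<lambda>z. g z / (z - p) ^ N) p = 0"
  shows "\<exists>h. h holomorphic_on ball p r \<and>
    (\<forall>z\<in>ball p r - {p}. ((\<lambda>z. h z / (z - p) ^ N) has_field_derivative g z / (z - p) ^ N) (at z))"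
  using assms(1,3)
proof (induction N arbitrary: g)
  case 0
  obtain h where h: "\<And>y. y \<in> ball p r \<Longrightarrow> (h has_field_derivative g y) (at y within ball p r)"
    using holomorphic_convex_primitive'[OF convex_ball open_ball 0(1)] by metis
  then have "h holomorphic_on ball p r" using holomorphic_on_def field_differentiable_def by blast
  moreover have "(h has_field_derivative g y) (at y)" if "y \<in> ball p r" for y
    using h[OF that] at_within_open[OF that open_ball] by simp
  ultimately show ?case by (intro exI[of _ h]) auto
next
  case (Suc N)
  let ?B = "ball p r"
  define g2 where "g2 = (\<lambda>z. if z = p then deriv g p else (g z - g p) / (z - p))"
  have g2: "g2 holomorphic_on ?B"
    unfolding g2_def by (rule pole_lemma_open[OF Suc.prems(1) open_ball])
  have split: "g z / (z - p) ^ Suc N = g p / (z - p) ^ Suc N + g2 z / (z - p) ^ N" if "z \<noteq> p" for z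
  proof -
    have "g2 z / (z - p) ^ N = (g z - g p) / (z - p) ^ Suc N" using that by (simp add: g2_def)
    then show ?thesis by (simp add: diff_divide_distrib)
  qed
  have hol: "(\<lambda>z. g p / (z - p) ^ Suc N) holomorphic_on ?B - {p}" "(\<lambda>z. g2 z / (z - p) ^ N) holomorphic_on ?B - {p}"
    using g2 by (auto intro!: holomorphic_intros)
  have res: "residue (\<lambda>z. g p / (z - p) ^ Suc N) p = (deriv ^^ N) (\<lambda>_. g p) p / fact N"
    using residue_holomorphic_over_power[of UNIV p "\<lambda>_. g p" N] by simp
  have "0 = residue (\<lambda>z. g p / (z - p) ^ Suc N + g2 z / (z - p) ^ N) p"
    using Suc.prems(2) split by (subst residue_cong[of "\<lambda>z. g p / (z - p) ^ Suc N + g2 z / (z - p) ^ N"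
        "\<lambda>z. g z / (z - p) ^ Suc N" p p]) (auto simp: eventually_at_filter)
  also have "\<dots> = residue (\<lambda>z. g p / (z - p) ^ Suc N) p + residue (\<lambda>z. g2 z / (z - p) ^ N) p"
    using residue_add[OF open_ball _ hol] assms(2) by simp
  finally have sum: "residue (\<lambda>z. g p / (z - p) ^ Suc N) p + residue (\<lambda>z. g2 z / (z - p) ^ N) p = 0" by simp
  show ?case
  proof (cases N)
    case 0
    have "residue g2 p = 0" using residue_holo[OF open_ball _ g2] assms(2) by simp
    then have gp: "g p = 0" using sum res 0 by simp
    obtain h where h: "h holomorphic_on ?B" "\<And>z. z \<in> ?B - {p} \<Longrightarrow> ((\<lambda>z. h z / (z - p) ^ N) has_field_derivative g2 z / (z - p) ^ N) (at z)"
      using Suc.IH[OF g2] \<open>residue g2 p = 0\<close> 0 by auto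
    show ?thesis
    proof (intro exI[of _ "\<lambda>z. h z * (z - p)"] conjI ballI)
      show "(\<lambda>z. h z * (z - p)) holomorphic_on ?B" using h(1) by (intro holomorphic_intros)
      fix z assume z: "z \<in> ?B - {p}"
      have "((\<lambda>z. h z / (z - p) ^ N) has_field_derivative g z / (z - p) ^ Suc N) (at z)"
        using h(2)[OF z] split[of z] z gp by simp
      then show "((\<lambda>z. h z * (z - p) / (z - p) ^ Suc N) has_field_derivative g z / (z - p) ^ Suc N) (at z)"
        by (rule has_field_derivative_transform_within_open[of _ _ _ "?B - {p}"]) (use z in auto)
    qed
  next
    case (Suc m)
    have "(deriv ^^ N) (\<lambda>_. g p) p = 0" unfolding Suc by (simp add: higher_deriv_const)
    then have "residue (\<lambda>z. g2 z / (z - p) ^ N) p = 0" using sum res by simp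
    then obtain h where h: "h holomorphic_on ?B" "\<And>z. z \<in> ?B - {p} \<Longrightarrow> ((\<lambda>z. h z / (z - p) ^ N) has_field_derivative g2 z / (z - p) ^ N) (at z)"
      using Suc.IH[OF g2] by auto
    \<comment> \<open>The elementary primitive \<open>- g p / (N * (z - p) ^ N)\<close> is added to
      the one for \<open>g2\<close>, and the sum is written over the exponent
      \<open>Suc N\<close>.\<close>
    let ?h = "\<lambda>z. (h z - g p / of_nat N) * (z - p)"
    show ?thesis
    proof (intro exI[of _ ?h] conjI ballI)
      show "?h holomorphic_on ?B" using h(1) Suc by (intro holomorphic_intros) auto
      fix z assume z: "z \<in> ?B - {p}"
      have "((\<lambda>z. (z - p) ^ N) has_field_derivative of_nat N * (z - p) ^ m) (at z)"
      proof -
        have "((\<lambda>z. z - p) has_field_derivative 1) (at z)" by (auto intro!: derivative_eq_intros)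
        from DERIV_power[OF this, of N] show ?thesis by (simp add: Suc)
      qed
      from DERIV_inverse_fun[OF this] z have
        "((\<lambda>z. inverse ((z - p) ^ N)) has_field_derivative - (of_nat N * (z - p) ^ m * inverse (((z - p) ^ N) ^ 2))) (at z)"
        by (simp add: power2_eq_square)
      moreover have "of_nat N * (z - p) ^ m * inverse (((z - p) ^ N) ^ 2) = of_nat N / (z - p) ^ Suc N"
      proof -
        have "of_nat (Suc m) * w ^ m * inverse ((w ^ Suc m) ^ 2) = of_nat (Suc m) / w ^ Suc (Suc m)"
          if "w \<noteq> 0" for w :: complex
          using that by (simp add: field_simps power2_eq_square)
        from this[of "z - p"] z show ?thesis unfolding Suc by simp
      qed
      ultimately have D: "((\<lambda>z. inverse ((z - p) ^ N)) has_field_derivative - (of_nat N / (z - p) ^ Suc N)) (at z)" by simp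
      have N0: "of_nat N \<noteq> (0 :: complex)" unfolding Suc by (simp del: of_nat_Suc)
      have "((\<lambda>z. h z / (z - p) ^ N - g p / of_nat N * inverse ((z - p) ^ N)) has_field_derivative
         g2 z / (z - p) ^ N - g p / of_nat N * - (of_nat N / (z - p) ^ Suc N)) (at z)"
        by (intro DERIV_diff h(2)[OF z] DERIV_cmult D)
      moreover have "g2 z / (z - p) ^ N - g p / of_nat N * - (of_nat N / (z - p) ^ Suc N) = g z / (z - p) ^ Suc N"
        using split[of z] z N0 by (simp add: field_simps)
      ultimately have D2: "((\<lambda>z. h z / (z - p) ^ N - g p / of_nat N * inverse ((z - p) ^ N)) has_field_derivative
          g z / (z - p) ^ Suc N) (at z)" by simp
      have eq: "h x / (x - p) ^ N - g p / of_nat N * inverse ((x - p) ^ N) = ?h x / (x - p) ^ Suc N"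
        if "x \<in> ?B - {p}" for x
      proof -
        have "?h x / (x - p) ^ Suc N = (h x - g p / of_nat N) / (x - p) ^ N" using that by simp
        also have "\<dots> = h x / (x - p) ^ N - g p / of_nat N * inverse ((x - p) ^ N)"
          by (simp add: divide_inverse algebra_simps)
        finally show ?thesis by simp
      qed
      show "((\<lambda>z. ?h z / (z - p) ^ Suc N) has_field_derivative g z / (z - p) ^ Suc N) (at z)"
        by (rule has_field_derivative_transform_within_open[OF D2 open_delete[OF open_ball] z eq])
    qed
  qed
qed

text \<open>A single fibre of the family, with the modular parameter fixed.\<close>

locale elliptic_second_kind =
  fixes \<tau> :: complex and f :: "complex \<Rightarrow> complex"
  assumes \<tau>: "Im \<tau> > 0"
    and mero: "f nicely_meromorphic_on UNIV"
    and per: "l \<in> period_lattice \<tau> \<Longrightarrow> f (z + l) = f z"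
    and res: "is_pole f p \<Longrightarrow> residue f p = 0"
begin

abbreviation poles where "poles \<equiv> {z. is_pole f z}"

lemma pole_translate: "l \<in> period_lattice \<tau> \<Longrightarrow> is_pole f (z + l) \<longleftrightarrow> is_pole f z"
  using is_pole_shift_iff[of f l z] per[of l] by (simp add: o_def add.commute)

lemma analytic_off_poles: "\<not> is_pole f z \<Longrightarrow> f analytic_on {z}"
  using nicely_meromorphic_on_imp_analytic_at[OF mero] by blast

lemma finite_poles_compact: "compact K \<Longrightarrow> finite (poles \<inter> K)"
proof -
  assume K: "compact K"
  have "\<not> z islimpt poles" for z
    using mero by (intro not_islimpt_poles meromorphic_on_isolated_singularity)
      (auto simp: nicely_meromorphic_on_def intro: meromorphic_on_subset)
  then have "finite (K \<inter> poles)" by (intro finite_not_islimpt_in_compact K) auto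
  then show ?thesis by (simp add: Int_commute)
qed

text \<open>Finiteness is not part of \<open>pole_representatives\<close>. It follows by moving the
  representatives into one compact parallelogram: two of them cannot end at the same point, since
  each pole has only one representative.\<close>

lemma poles_lattice_orbit:
  assumes R: "pole_representatives \<tau> f R"
  shows "finite R" "poles = lattice_orbit \<tau> R"
proof -
  obtain lat where lat: "\<And>z. lat z \<in> period_lattice \<tau>" "\<And>z. z - lat z \<in> fundamental_parallelogram \<tau>"
    using parallelogram_tiling[OF \<tau>, of _ 0] unfolding parallelogram_0 by metis
  have "inj_on (\<lambda>r. r - lat r) R"
  proof
    fix r s assume r: "r \<in> R" and s: "s \<in> R" and eq: "r - lat r = s - lat s"
    have "is_pole f r" using R r by (auto simp: pole_representatives_def)
    then have "\<exists>!t. t \<in> R \<and> r - t \<in> period_lattice \<tau>" using R by (auto simp: pole_representatives_def)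
    moreover have "r - r \<in> period_lattice \<tau>" by simp
    moreover have "r - s = lat r - lat s" using eq by (simp add: algebra_simps)
    then have "r - s \<in> period_lattice \<tau>" using period_lattice_diff lat(1) by simp
    ultimately show "r = s" using r s by blast
  qed
  moreover have "(\<lambda>r. r - lat r) ` R \<subseteq> poles \<inter> closed_parallelogram \<tau> 0"
  proof
    fix z assume "z \<in> (\<lambda>r. r - lat r) ` R"
    then obtain r where r: "r \<in> R" "z = r - lat r" by blast
    have "is_pole f r" using R r by (auto simp: pole_representatives_def)
    then have "is_pole f z" using pole_translate[OF lat(1)[of r], of z] r by simp
    then show "z \<in> poles \<inter> closed_parallelogram \<tau> 0"
      using lat(2)[of r] parallelogram_subset[of \<tau> 0] r by auto
  qed
  then have "finite ((\<lambda>r. r - lat r) ` R)"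
    by (rule finite_subset) (rule finite_poles_compact[OF compact_closed_parallelogram])
  ultimately show "finite R" by (rule finite_imageD[rotated])
  show "poles = lattice_orbit \<tau> R"
  proof (intro equalityI subsetI)
    fix z assume "z \<in> poles"
    then obtain r where "r \<in> R" "z - r \<in> period_lattice \<tau>" using R unfolding pole_representatives_def by blast
    then show "z \<in> lattice_orbit \<tau> R" unfolding lattice_orbit_def by (intro CollectI exI[of _ r] exI[of _ "z - r"]) auto
  next
    fix z assume "z \<in> lattice_orbit \<tau> R"
    then show "z \<in> poles" using R pole_translate by (auto simp: lattice_orbit_def pole_representatives_def)
  qed
qed

lemma closed_poles: "closed poles"
proof -
  have "\<not> z islimpt poles" for z
    using mero by (intro not_islimpt_poles meromorphic_on_isolated_singularity)
      (auto simp: nicely_meromorphic_on_def intro: meromorphic_on_subset)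
  then show ?thesis by (simp add: closed_limpt)
qed

lemma countable_poles: "countable poles"
proof -
  have eq: "poles = (\<Union>n::nat. poles \<inter> cball 0 (real n))"
  proof (intro equalityI subsetI)
    fix z assume z: "z \<in> poles"
    obtain n :: nat where "norm z \<le> real n" using real_arch_simple by blast
    then show "z \<in> (\<Union>n::nat. poles \<inter> cball 0 (real n))" using z by auto
  qed auto
  have "countable (\<Union>n::nat. poles \<inter> cball 0 (real n))"
  proof (rule countable_UN)
    show "countable (poles \<inter> cball 0 (real n))" for n
      by (rule countable_finite[OF finite_poles_compact[OF compact_cball]])
  qed simp
  then show ?thesis by (subst eq)
qed

lemma connected_off_poles: "connected (- poles)"
  using path_connected_complement_countable[OF _ countable_poles] path_connected_imp_connected by simp

lemma holomorphic_off_poles: "f holomorphic_on - poles"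
  using analytic_off_poles analytic_imp_holomorphic analytic_on_analytic_at by (metis ComplD mem_Collect_eq)

lemma pole_form:
  assumes "is_pole f p"
  obtains r N g where "r > 0" "g holomorphic_on ball p r" "\<And>z. z \<in> ball p r - {p} \<Longrightarrow> \<not> is_pole f z"
    "\<And>z. z \<in> ball p r - {p} \<Longrightarrow> f z = g z / (z - p) ^ N"
proof -
  have "finite (poles \<inter> cball p 1)" by (rule finite_poles_compact) simp
  from finite_set_avoid[OF this, of p] obtain d where d: "d > 0"
    "\<And>x. x \<in> poles \<inter> cball p 1 \<Longrightarrow> x \<noteq> p \<Longrightarrow> d \<le> dist p x" by auto
  define e where "e = min d 1"
  have e: "e > 0" "\<And>z. z \<in> ball p e - {p} \<Longrightarrow> \<not> is_pole f z" using d by (force simp: e_def)+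
  have hol: "f holomorphic_on ball p e - {p}"
    by (rule holomorphic_on_subset[OF holomorphic_off_poles]) (use e(2) in auto)
  obtain r where r: "r > 0" "cball p r \<subseteq> ball p e" "zor_poly f p holomorphic_on cball p r"
    "\<And>w. w \<in> cball p r - {p} \<Longrightarrow> f w = zor_poly f p w / (w - p) ^ nat (- zorder f p)"
    using zorder_exist_pole[OF hol open_ball _ assms] e(1) by auto
  show ?thesis
  proof (rule that[OF r(1)])
    show "zor_poly f p holomorphic_on ball p r" using r(3) by (rule holomorphic_on_subset) auto
    show "\<not> is_pole f z" if "z \<in> ball p r - {p}" for z
    proof -
      have "z \<in> cball p r" using that by auto
      then have "z \<in> ball p e" using r(2) by blast
      then show ?thesis using e(2) that by blast
    qed
    show "f z = zor_poly f p z / (z - p) ^ nat (- zorder f p)" if "z \<in> ball p r - {p}" for z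
      using r(4)[of z] that by auto
  qed
qed

text \<open>A closed path may wind around poles; in the residue theorem every term vanishes because
  the residue does, whatever the winding number.\<close>

lemma primitive_exists: "\<exists>G. \<forall>z. \<not> is_pole f z \<longrightarrow> (G has_field_derivative f z) (at z)"
proof -
  have "contour_integral \<gamma> f = 0"
    if \<gamma>: "valid_path \<gamma>" "path_image \<gamma> \<subseteq> - poles" "pathfinish \<gamma> = pathstart \<gamma>" for \<gamma>
  proof -
    have "bounded (path_image \<gamma>)" using \<gamma>(1) valid_path_imp_path compact_path_image compact_imp_bounded by blast
    then obtain K where K: "path_image \<gamma> \<subseteq> ball 0 K" using bounded_subset_ballD by blast
    have fin: "finite (poles \<inter> cball 0 K)" by (rule finite_poles_compact) simp
    have "contour_integral \<gamma> f = 2 * pi * \<i> * (\<Sum>p\<in>poles \<inter> cball 0 K. winding_number \<gamma> p * residue f p)"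
    proof (rule Residue_theorem[OF open_ball[of 0 K] _ fin _ \<gamma>(1,3)])
      show "f holomorphic_on ball 0 K - poles \<inter> cball 0 K"
        using holomorphic_off_poles by (rule holomorphic_on_subset) auto
      show "path_image \<gamma> \<subseteq> ball 0 K - poles \<inter> cball 0 K" using K \<gamma>(2) by auto
      show "\<forall>z. z \<notin> ball 0 K \<longrightarrow> winding_number \<gamma> z = 0"
        using winding_number_zero_outside[OF valid_path_imp_path[OF \<gamma>(1)] convex_ball \<gamma>(3) _ K] by blast
    qed auto
    also have "(\<Sum>p\<in>poles \<inter> cball 0 K. winding_number \<gamma> p * residue f p) = 0"
      by (intro sum.neutral) (auto simp: res)
    finally show ?thesis by simp
  qed
  then have "\<exists>G. \<forall>z\<in>-poles. (G has_field_derivative f z) (at z)"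
    using closed_poles by (intro primitive_of_closed_integrals_0 connected_off_poles holomorphic_off_poles) auto
  then show ?thesis by auto
qed

definition primitive :: "complex \<Rightarrow> complex" where
  "primitive = (SOME G. \<forall>z. \<not> is_pole f z \<longrightarrow> (G has_field_derivative f z) (at z))"

lemma DERIV_primitive: "\<not> is_pole f z \<Longrightarrow> (primitive has_field_derivative f z) (at z)"
  using someI_ex[OF primitive_exists] unfolding primitive_def by blast

text \<open>The increment has derivative \<open>f (z + l) - f z = 0\<close>, and the complement of
  the countably many poles is connected.\<close>

lemma primitive_period_exists:
  assumes l: "l \<in> period_lattice \<tau>"
  shows "\<exists>c. \<forall>z. \<not> is_pole f z \<longrightarrow> primitive (z + l) - primitive z = c"
proof -
  have "(\<lambda>z. primitive (z + l) - primitive z) constant_on - poles"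
  proof (rule has_field_derivative_0_imp_constant_on)
    fix z assume "z \<in> - poles"
    then have z: "\<not> is_pole f z" "\<not> is_pole f (z + l)" using pole_translate[OF l] by auto
    have "((\<lambda>z. primitive (z + l) - primitive z) has_field_derivative f (z + l) * 1 - f z) (at z)"
      by (intro DERIV_diff DERIV_primitive z DERIV_chain2[of primitive]) (auto intro!: derivative_eq_intros)
    then show "((\<lambda>z. primitive (z + l) - primitive z) has_field_derivative 0) (at z)"
      using per[OF l] by simp
  qed (use closed_poles connected_off_poles in auto)
  then show ?thesis by (auto simp: constant_on_def)
qed

definition period :: "complex \<Rightarrow> complex" where
  "period l = (SOME c. \<forall>z. \<not> is_pole f z \<longrightarrow> primitive (z + l) - primitive z = c)"

lemma primitive_period: "l \<in> period_lattice \<tau> \<Longrightarrow> \<not> is_pole f z \<Longrightarrow> primitive (z + l) = primitive z + period l"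
proof -
  assume l: "l \<in> period_lattice \<tau>" and z: "\<not> is_pole f z"
  have "primitive (z + l) - primitive z = period l"
    using someI_ex[OF primitive_period_exists[OF l]] z unfolding period_def by blast
  then show "primitive (z + l) = primitive z + period l" by (simp add: algebra_simps)
qed

lemma not_pole_exists: "\<exists>z. \<not> is_pole f z"
proof -
  have "poles \<noteq> UNIV" using countable_poles uncountable_UNIV_complex by auto
  then show ?thesis by auto
qed

text \<open>Two primitives differ by a constant off the poles, so any primitive computes the
  periods. This will be applied to a primitive pulled back from another fibre.\<close>

lemma period_eqI:
  assumes "l \<in> period_lattice \<tau>" "\<not> is_pole f z" "H (z + l) - H z = c"
    "\<And>w. \<not> is_pole f w \<Longrightarrow> (H has_field_derivative f w) (at w)"
  shows "period l = c"
proof -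
  have "(\<lambda>z. H z - primitive z) constant_on - poles"
    using closed_poles connected_off_poles
    by (intro has_field_derivative_0_imp_constant_on)
       (auto intro!: derivative_eq_intros assms(4) DERIV_primitive)
  then obtain k where k: "\<And>z. \<not> is_pole f z \<Longrightarrow> H z - primitive z = k" by (auto simp: constant_on_def)
  show ?thesis
    using k[OF assms(2)] k[of "z + l"] assms(3) primitive_period[OF assms(1,2)] pole_translate[OF assms(1), of z] assms(2)
    by (auto simp: algebra_simps)
qed

lemma period_add:
  assumes "l \<in> period_lattice \<tau>" "m \<in> period_lattice \<tau>"
  shows "period (l + m) = period l + period m"
proof -
  obtain z where z: "\<not> is_pole f z" using not_pole_exists by blast
  then have z': "\<not> is_pole f (z + l)" using pole_translate assms by blast
  show ?thesis
    using primitive_period[OF assms(1) z] primitive_period[OF assms(2) z'] primitive_period[OF period_lattice_add[OF assms] z]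
    by (simp add: add.assoc)
qed

lemma period_of_int_mult:
  assumes "l \<in> period_lattice \<tau>"
  shows "period (of_int n * l) = of_int n * period l" and "of_int n * l \<in> period_lattice \<tau>"
proof -
  have 0: "period 0 = 0" using period_add[of 0 0] by simp
  have nat: "of_nat n * l \<in> period_lattice \<tau> \<and> period (of_nat n * l) = of_nat n * period l" for n
    by (induction n) (auto simp: 0 algebra_simps period_add assms intro: period_lattice_add)
  have neg: "period (- m) = - period m" if "m \<in> period_lattice \<tau>" for m
    using period_add[OF that period_lattice_uminus[OF that]] 0 by (simp add: eq_neg_iff_add_eq_0 add.commute)
  show "period (of_int n * l) = of_int n * period l" "of_int n * l \<in> period_lattice \<tau>"
    using nat neg period_lattice_uminus by (cases n rule: int_cases2; force)+
qed

lemma period_lincomb: "period (of_int m * \<tau> + of_int n) = of_int m * period \<tau> + of_int n * period 1"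
  using period_add[OF period_of_int_mult(2)[of \<tau> m] period_of_int_mult(2)[of 1 n]]
    period_of_int_mult(1)[of \<tau> m] period_of_int_mult(1)[of 1 n] by simp

text \<open>A global primitive turns the integral into an increment between endpoints that differ by
  \<open>l\<close>, which makes it independent of the path and of its starting point.\<close>

lemma contour_integral_period:
  assumes "valid_path \<gamma>" "\<And>z. z \<in> path_image \<gamma> \<Longrightarrow> \<not> is_pole f z" "pathfinish \<gamma> = pathstart \<gamma> + l" "l \<in> period_lattice \<tau>"
  shows "(f has_contour_integral period l) \<gamma>"
proof -
  have "(f has_contour_integral primitive (pathfinish \<gamma>) - primitive (pathstart \<gamma>)) \<gamma>"
    by (rule contour_integral_primitive[of "path_image \<gamma>"])
       (use assms in \<open>auto intro!: has_field_derivative_at_within DERIV_primitive\<close>)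
  moreover have "\<not> is_pole f (pathstart \<gamma>)" using assms(2) by auto
  ultimately show ?thesis using primitive_period assms by simp
qed

lemma A_cycle_integral: "A_cycle f \<gamma> \<Longrightarrow> contour_integral \<gamma> f = period 1"
  by (intro contour_integral_unique contour_integral_period) (auto simp: A_cycle_def)

text \<open>On a punctured disc the global primitive differs from the local one by a constant
  \<open>k\<close>, which is absorbed into the numerator as \<open>k * (z - p) ^ N\<close>.\<close>

lemma primitive_smooth_over_power:
  assumes p: "is_pole f p"
  shows "\<exists>N r h. r > 0 \<and> h holomorphic_on ball p r \<and> (\<forall>z\<in>ball p r - {p}. primitive z = h z / (z - p) ^ N)"
proof -
  obtain r N g where r: "r > 0" "g holomorphic_on ball p r" "\<And>z. z \<in> ball p r - {p} \<Longrightarrow> \<not> is_pole f z"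
    "\<And>z. z \<in> ball p r - {p} \<Longrightarrow> f z = g z / (z - p) ^ N"
    using pole_form[OF p] by metis
  have "residue (\<lambda>z. g z / (z - p) ^ N) p = residue f p"
  proof (rule residue_cong)
    have "\<forall>\<^sub>F z in at p. z \<in> ball p r - {p}"
      using r(1) by (auto simp: eventually_at dist_commute intro!: exI[of _ r])
    then show "\<forall>\<^sub>F z in at p. g z / (z - p) ^ N = f z" by eventually_elim (use r(4) in simp)
  qed simp
  then have res0: "residue (\<lambda>z. g z / (z - p) ^ N) p = 0" using res[OF p] by simp
  obtain h where h: "h holomorphic_on ball p r"
    "\<And>z. z \<in> ball p r - {p} \<Longrightarrow> ((\<lambda>z. h z / (z - p) ^ N) has_field_derivative g z / (z - p) ^ N) (at z)"
    using pole_primitive[OF r(2,1) res0] by blast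
  have "(\<lambda>z. primitive z - h z / (z - p) ^ N) constant_on ball p r - {p}"
  proof (rule has_field_derivative_0_imp_constant_on)
    fix z assume z: "z \<in> ball p r - {p}"
    have "((\<lambda>z. primitive z - h z / (z - p) ^ N) has_field_derivative f z - g z / (z - p) ^ N) (at z)"
      by (intro DERIV_diff DERIV_primitive r(3) h(2) z)
    then show "((\<lambda>z. primitive z - h z / (z - p) ^ N) has_field_derivative 0) (at z)"
      using r(4)[OF z] by simp
  qed (auto intro: connected_punctured_ball)
  then obtain k where k: "\<And>z. z \<in> ball p r - {p} \<Longrightarrow> primitive z - h z / (z - p) ^ N = k"
    by (auto simp: constant_on_def)
  show ?thesis
  proof (intro exI[of _ N] exI[of _ r] exI[of _ "\<lambda>z. h z + k * (z - p) ^ N"] conjI ballI)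
    show "(\<lambda>z. h z + k * (z - p) ^ N) holomorphic_on ball p r" using h(1) by (intro holomorphic_intros)
    show "primitive z = (h z + k * (z - p) ^ N) / (z - p) ^ N" if "z \<in> ball p r - {p}" for z
      using k[OF that] that by (auto simp: field_simps)
  qed (rule r(1))
qed

end


section \<open>The canonical decomposition of an elliptic function without residues\<close>

lemma set_integral_const_fundamental_parallelogram:
  assumes "Im \<tau> > 0"
  shows "set_lebesgue_integral lborel (fundamental_parallelogram \<tau>) (\<lambda>_. c :: complex) = of_real (Im \<tau>) * c"
proof -
  have I: "(\<integral>s. indicator {0..<1::real} s *\<^sub>R k \<partial>lborel) = k" for k :: complex
  proof -
    have m: "measure lborel {0..<1::real} = 1" by (simp add: measure_def)
    have "has_bochner_integral lborel (indicator {0..<1::real}) (measure lborel {0..<1::real})"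
      by (rule has_bochner_integral_real_indicator) auto
    from has_bochner_integral_scaleR_left[OF this, of k] show ?thesis
      unfolding m by (intro has_bochner_integral_integral_eq) simp
  qed
  have J: "(\<integral>s. indicator {0..<1::real} s *\<^sub>R indicator {0..<1} t *\<^sub>R c \<partial>lborel) = indicator {0..<1} t *\<^sub>R c" for t :: real
    by (rule I)
  show ?thesis
    using parallelogram_integral_iterated(1)[OF assms, of 0 "\<lambda>_. c"]
    unfolding parallelogram_0 J I by (simp add: scaleR_conv_of_real)
qed

lemma smooth_fun_on_cmult_add:
  assumes "open U" "smooth_fun_on f U" "smooth_fun_on g U"
  shows "smooth_fun_on (\<lambda>z. f z * g z) U" "smooth_fun_on (\<lambda>z. f z + g z) U" "smooth_fun_on (\<lambda>z. f z - g z) U"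
proof -
  have "Ck_on n f U" "Ck_on n g U" for n using assms by (simp_all add: smooth_fun_on_def)
  then show "smooth_fun_on (\<lambda>z. f z * g z) U" "smooth_fun_on (\<lambda>z. f z + g z) U" "smooth_fun_on (\<lambda>z. f z - g z) U"
    unfolding smooth_fun_on_def by (auto intro!: Ck_on_mult Ck_on_add Ck_on_diff assms(1))
qed

lemma holomorphic_imp_smooth: "open U \<Longrightarrow> f holomorphic_on U \<Longrightarrow> smooth_fun_on f U"
  using holomorphic_imp_Ck_on unfolding smooth_fun_on_def by blast

lemma smooth_fun_on_cnj: "smooth_fun_on cnj U"
  using Ck_on_cnj unfolding smooth_fun_on_def by blast

lemma smooth_fun_on_const: "smooth_fun_on (\<lambda>_. c) U"
  using Ck_on_const unfolding smooth_fun_on_def by blast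

context elliptic_second_kind
begin

text \<open>Cramer's rule for the system \<open>\<alpha> + \<beta> = period 1\<close>,
  \<open>\<alpha> * \<tau> + \<beta> * cnj \<tau> = period \<tau>\<close>, whose determinant is, up
  to sign, \<open>\<tau> - cnj \<tau> = 2 * \<i> * Im \<tau>\<close>.\<close>

definition "\<alpha> = (period \<tau> - cnj \<tau> * period 1) / (2 * \<i> * of_real (Im \<tau>))"
definition "\<beta> = period 1 - \<alpha>"

lemma \<alpha>_\<beta>: "\<alpha> + \<beta> = period 1" "\<alpha> * \<tau> + \<beta> * cnj \<tau> = period \<tau>"
proof -
  show "\<alpha> + \<beta> = period 1" by (simp add: \<beta>_def)
  have "\<alpha> * (2 * \<i> * of_real (Im \<tau>)) = period \<tau> - cnj \<tau> * period 1"
    using \<tau> by (simp add: \<alpha>_def)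
  moreover have "2 * \<i> * of_real (Im \<tau>) = \<tau> - cnj \<tau>" by (simp add: complex_eq_iff)
  ultimately have "\<alpha> * (\<tau> - cnj \<tau>) = period \<tau> - cnj \<tau> * period 1" by simp
  then show "\<alpha> * \<tau> + \<beta> * cnj \<tau> = period \<tau>" by (simp add: \<beta>_def algebra_simps)
qed

text \<open>The coefficients \<open>\<alpha>\<close>, \<open>\<beta>\<close> are those for which subtracting \<open>\<alpha> z + \<beta>\<close> times the conjugate of \<open>z\<close>
  makes the primitive periodic.\<close>

definition periodic_primitive :: "complex \<Rightarrow> complex" where
  "periodic_primitive z = primitive z - (\<alpha> * z + \<beta> * cnj z)"

lemma periodic_primitive_periodic:
  assumes l: "l \<in> period_lattice \<tau>" and z: "\<not> is_pole f z"
  shows "periodic_primitive (z + l) = periodic_primitive z"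
proof -
  obtain m n where mn: "l = of_int m + of_int n * \<tau>" using l by (auto simp: period_lattice_def)
  then have "l = of_int n * \<tau> + of_int m" by simp
  then have "period l = of_int n * period \<tau> + of_int m * period 1" using period_lincomb[of n m] by simp
  also have "\<dots> = \<alpha> * l + \<beta> * cnj l"
    unfolding mn \<alpha>_\<beta>(1)[symmetric] \<alpha>_\<beta>(2)[symmetric] by (simp add: algebra_simps)
  finally show ?thesis using primitive_period[OF l z] by (simp add: periodic_primitive_def algebra_simps)
qed

text \<open>The \<open>z\<close>-derivative of \<open>periodic_primitive\<close> is
  \<open>f - \<alpha>\<close>, because the conjugate of \<open>z\<close> does not contribute. The
  factor \<open>\<i> / 2\<close> cancels the \<open>- 2 * \<i>\<close> that comes from writing the
  exterior derivative in terms of Lebesgue measure.\<close>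

lemma reg_decomposition_canonical:
  assumes R: "pole_representatives \<tau> f R"
  shows "reg_decomposition \<tau> (\<lambda>z. f z / of_real (Im \<tau>)) poles (\<lambda>_. \<alpha> / of_real (Im \<tau>))
    (\<lambda>z. \<i> / (2 * of_real (Im \<tau>)) * periodic_primitive z)"
proof -
  let ?k = "\<i> / (2 * of_real (Im \<tau>)) :: complex"
  have o: "open (- poles)" using closed_poles by (rule open_Compl)
  have G: "primitive holomorphic_on - poles"
    using o DERIV_primitive by (auto simp: holomorphic_on_open)
  have lin: "smooth_fun_on (\<lambda>z. \<alpha> * z + \<beta> * cnj z) U" if "open U" for U
    using that by (intro smooth_fun_on_cmult_add smooth_fun_on_const smooth_fun_on_cnj holomorphic_imp_smooth) (auto intro: holomorphic_intros)
  have b: "smooth_fun_on (\<lambda>z. ?k * periodic_primitive z) (- poles)"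
    unfolding periodic_primitive_def
    by (intro smooth_fun_on_cmult_add o smooth_fun_on_const holomorphic_imp_smooth G lin)
  have f: "smooth_fun_on (\<lambda>z. f z / of_real (Im \<tau>)) (- poles)"
    by (intro holomorphic_imp_smooth o holomorphic_intros holomorphic_off_poles) (use \<tau> in auto)
  have pf: "\<exists>N. smooth_over_power_at (\<lambda>z. f z / of_real (Im \<tau>)) p N" if "p \<in> poles" for p
  proof -
    have p: "is_pole f p" using that by simp
    obtain r N g where r: "r > 0" "g holomorphic_on ball p r" "\<And>z. z \<in> ball p r - {p} \<Longrightarrow> f z = g z / (z - p) ^ N"
      using pole_form[OF p] by metis
    have "smooth_fun_on (\<lambda>z. g z / of_real (Im \<tau>)) (ball p r)"
      by (intro holomorphic_imp_smooth open_ball holomorphic_intros r(2)) (use \<tau> in auto)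
    then have "smooth_over_power_at (\<lambda>z. f z / of_real (Im \<tau>)) p N"
      unfolding smooth_over_power_at_def using r
      by (intro exI[of _ "ball p r"] exI[of _ "\<lambda>z. g z / of_real (Im \<tau>)"]) auto
    then show ?thesis by blast
  qed
  have pb: "\<exists>N. smooth_over_power_at (\<lambda>z. ?k * periodic_primitive z) p N" if "p \<in> poles" for p
  proof -
    have p: "is_pole f p" using that by simp
    obtain N r h where r: "r > 0" "h holomorphic_on ball p r" "\<And>z. z \<in> ball p r - {p} \<Longrightarrow> primitive z = h z / (z - p) ^ N"
      using primitive_smooth_over_power[OF p] by blast
    let ?h = "\<lambda>z. ?k * (h z - (\<alpha> * z + \<beta> * cnj z) * (z - p) ^ N)"
    have "(\<lambda>z. (z - p) ^ N) holomorphic_on ball p r" by (intro holomorphic_intros)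
    then have "smooth_fun_on ?h (ball p r)"
      by (intro smooth_fun_on_cmult_add smooth_fun_on_const open_ball lin) (auto intro: holomorphic_imp_smooth r(2))
    moreover have "?k * periodic_primitive z = ?h z / (z - p) ^ N" if "z \<in> ball p r - {p}" for z
    proof -
      have "(h z - (\<alpha> * z + \<beta> * cnj z) * (z - p) ^ N) / (z - p) ^ N = periodic_primitive z"
        using that by (simp add: periodic_primitive_def r(3) diff_divide_distrib)
      then show ?thesis by (metis times_divide_eq_right)
    qed
    ultimately have "smooth_over_power_at (\<lambda>z. ?k * periodic_primitive z) p N"
      unfolding smooth_over_power_at_def using r(1) by (intro exI[of _ "ball p r"] exI[of _ ?h]) auto
    then show ?thesis by blast
  qed
  have main: "f z / of_real (Im \<tau>) = \<alpha> / of_real (Im \<tau>) + (- 2 * \<i>) * wirtinger_deriv (\<lambda>z. ?k * periodic_primitive z) z"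
    if z: "z \<in> - poles" for z
  proof -
    have D: "(primitive has_derivative (\<lambda>v. f z * v)) (at z)"
      using DERIV_primitive[of z] z by (simp add: has_field_derivative_def)
    have "((\<lambda>z. ?k * periodic_primitive z) has_derivative (\<lambda>v. ?k * (f z * v - (\<alpha> * v + \<beta> * cnj v)))) (at z)"
      unfolding periodic_primitive_def
      by (intro has_derivative_mult_right has_derivative_diff D has_derivative_add has_derivative_ident has_derivative_cnj)
    then have w: "wirtinger_deriv (\<lambda>z. ?k * periodic_primitive z) z = ?k * (f z - \<alpha>)"
      using \<tau> by (simp add: wirtinger_deriv_def frechet_derivative_eqI field_simps)
    show ?thesis unfolding w using \<tau> by (simp add: field_simps)
  qed
  \<comment> \<open>A constant counts as a simple pole with the numerator vanishing at
    \<open>p\<close>.\<close>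
  have pa: "smooth_over_power_at (\<lambda>_. \<alpha> / of_real (Im \<tau>)) p 1" for p
    unfolding smooth_over_power_at_def
    by (intro exI[of _ UNIV] exI[of _ "\<lambda>z. \<alpha> / of_real (Im \<tau>) * (z - p)"] conjI holomorphic_imp_smooth holomorphic_intros)
       (use \<tau> in auto)
  have pp: "periodic_primitive (z + l) = periodic_primitive z" if "z \<in> - poles" "l \<in> period_lattice \<tau>" for z l
    using periodic_primitive_periodic that by simp
  show ?thesis
    unfolding reg_decomposition_def smooth_off_def
    using poles_lattice_orbit[OF R] f b pf pb main pa per pp smooth_fun_on_const
    by auto
qed

lemma reg_integral_eq_\<alpha>:
  assumes "pole_representatives \<tau> f R"
  shows "reg_integral \<tau> (\<lambda>z. f z / of_real (Im \<tau>)) = \<alpha>"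
  using reg_integral_eq[OF \<tau> reg_decomposition_canonical[OF assms]] \<tau>
  by (simp add: set_integral_const_fundamental_parallelogram)

text \<open>Translation by \<open>l\<close> adds \<open>l * f\<close> to \<open>z * f\<close>, and
  \<open>f\<close> has no residue. This is the independence of the pairing from the chosen
  representatives.\<close>

lemma residue_mult_id_translate:
  assumes l: "l \<in> period_lattice \<tau>" and p: "is_pole f p"
  shows "residue (\<lambda>z. z * f z) (p + l) = residue (\<lambda>z. z * f z) p"
proof -
  obtain r N g where r: "r > 0" "g holomorphic_on ball p r" "\<And>z. z \<in> ball p r - {p} \<Longrightarrow> \<not> is_pole f z"
    using pole_form[OF p] by metis
  have hol: "f holomorphic_on ball p r - {p}"
    by (rule holomorphic_on_subset[OF holomorphic_off_poles]) (use r(3) in auto)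
  have "residue (\<lambda>z. z * f z) (p + l) = residue (\<lambda>x. (p + l + x) * f (p + l + x)) 0"
    by (rule residue_shift_0)
  also have "(\<lambda>x. (p + l + x) * f (p + l + x)) = (\<lambda>x. (p + x) * f (p + x) + l * f (p + x))"
    using per[OF l, of "p + x" for x] by (simp add: fun_eq_iff algebra_simps)
  also have "residue \<dots> 0 = residue (\<lambda>z. z * f z + l * f z) p"
    by (rule residue_shift_0[symmetric])
  also have "\<dots> = residue (\<lambda>z. z * f z) p + residue (\<lambda>z. l * f z) p"
    using r(1) by (intro residue_add[OF open_ball[of p r]] holomorphic_intros hol) auto
  also have "residue (\<lambda>z. l * f z) p = l * residue f p"
    using r(1) by (intro residue_lmul[OF open_ball[of p r]] hol) auto
  finally show ?thesis using res[OF p] by simp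
qed

text \<open>The sign condition says that the triangle is traversed counterclockwise around
  \<open>p\<close>, so every pole inside has winding number 1; poles outside the hull have winding
  number 0.\<close>

lemma triangle_residues:
  assumes int: "\<And>p. is_pole f p \<Longrightarrow> p \<in> convex hull {a, b, c} \<Longrightarrow>
      p \<in> interior (convex hull {a, b, c}) \<and> 0 < Im ((b - a) * cnj (b - p))"
    and path: "path_image (linepath a b +++ linepath b c +++ linepath c a) \<subseteq> - poles"
  shows "contour_integral (linepath a b +++ linepath b c +++ linepath c a) (\<lambda>z. z * f z) =
    2 * pi * \<i> * (\<Sum>p\<in>poles \<inter> convex hull {a, b, c}. residue (\<lambda>z. z * f z) p)"
proof -
  let ?\<gamma> = "linepath a b +++ linepath b c +++ linepath c a" and ?H = "convex hull {a, b, c}"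
  have cH: "compact ?H" by (intro compact_convex_hull finite_imp_compact) simp
  obtain K where K: "?H \<subseteq> ball 0 K" using bounded_subset_ballD[OF compact_imp_bounded[OF cH]] by blast
  have pH: "path_image ?\<gamma> \<subseteq> ?H"
    using closed_segment_subset[OF hull_inc hull_inc convex_convex_hull, of _ "{a, b, c}" _]
    by (simp add: path_image_join)
  have fin: "finite (poles \<inter> cball 0 K)" by (rule finite_poles_compact) simp
  have "contour_integral ?\<gamma> (\<lambda>z. z * f z) = 2 * pi * \<i> *
      (\<Sum>p\<in>poles \<inter> cball 0 K. winding_number ?\<gamma> p * residue (\<lambda>z. z * f z) p)"
  proof (rule Residue_theorem[OF open_ball[of 0 K] _ fin])
    show "(\<lambda>z. z * f z) holomorphic_on ball 0 K - poles \<inter> cball 0 K"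
      by (intro holomorphic_intros holomorphic_on_subset[OF holomorphic_off_poles]) auto
    show "path_image ?\<gamma> \<subseteq> ball 0 K - poles \<inter> cball 0 K" using pH K path by auto
    show "\<forall>z. z \<notin> ball 0 K \<longrightarrow> winding_number ?\<gamma> z = 0"
      using pH K by (intro allI impI winding_number_zero_outside[of _ "ball 0 K"]) auto
  qed auto
  also have "(\<Sum>p\<in>poles \<inter> cball 0 K. winding_number ?\<gamma> p * residue (\<lambda>z. z * f z) p) =
      (\<Sum>p\<in>poles \<inter> ?H. residue (\<lambda>z. z * f z) p)"
  proof (intro sum.mono_neutral_cong_right fin)
    show "poles \<inter> ?H \<subseteq> poles \<inter> cball 0 K" using K by auto
    show "\<forall>p\<in>poles \<inter> cball 0 K - poles \<inter> ?H. winding_number ?\<gamma> p * residue (\<lambda>z. z * f z) p = 0"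
      using pH winding_number_zero_outside[of ?\<gamma> ?H] by auto
    show "winding_number ?\<gamma> p * residue (\<lambda>z. z * f z) p = residue (\<lambda>z. z * f z) p" if "p \<in> poles \<inter> ?H" for p
      using winding_number_triangle[of p a b c] int[of p] that by simp
  qed
  finally show ?thesis .
qed

end


section \<open>Legendre's relation\<close>

lemma has_contour_integral_linepath_translate:
  "(h has_contour_integral i) (linepath (a + w) (b + w)) \<longleftrightarrow>
   ((\<lambda>z. h (z + w)) has_contour_integral i) (linepath a b)"
proof -
  have "linepath (a + w) (b + w) x = linepath a b x + w" for x
    by (simp add: linepath_def algebra_simps)
  then show ?thesis by (simp add: has_contour_integral_linepath)
qed

context elliptic_second_kind
begin

lemma sum_residues_parallelogram:
  assumes R: "pole_representatives \<tau> f R"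
  shows "(\<Sum>p\<in>poles \<inter> parallelogram \<tau> q. residue (\<lambda>z. z * f z) p) = (\<Sum>p\<in>R. residue (\<lambda>z. z * f z) p)"
proof -
  obtain lat where lat: "\<And>z. lat z \<in> period_lattice \<tau>" "\<And>z. z - lat z \<in> parallelogram \<tau> q"
    using parallelogram_tiling[OF \<tau>, of _ q] by metis
  have pr: "is_pole f r" "is_pole f (r - lat r)" if "r \<in> R" for r
    using R that pole_translate[OF lat(1)[of r], of "r - lat r"] by (auto simp: pole_representatives_def)
  have "bij_betw (\<lambda>r. r - lat r) R (poles \<inter> parallelogram \<tau> q)"
  proof (rule bij_betwI')
    fix r s assume r: "r \<in> R" and s: "s \<in> R"
    show "(r - lat r = s - lat s) = (r = s)"
    proof
      assume eq: "r - lat r = s - lat s"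
      have "\<exists>!t. t \<in> R \<and> r - t \<in> period_lattice \<tau>" using R pr(1)[OF r] by (auto simp: pole_representatives_def)
      moreover have "r - r \<in> period_lattice \<tau>" by simp
      moreover have "r - s = lat r - lat s" using eq by (simp add: algebra_simps)
      then have "r - s \<in> period_lattice \<tau>" using period_lattice_diff lat(1) by simp
      ultimately show "r = s" using r s by blast
    qed simp
  next
    fix r assume "r \<in> R"
    then show "r - lat r \<in> poles \<inter> parallelogram \<tau> q" using pr(2) lat(2) by auto
  next
    fix p assume p: "p \<in> poles \<inter> parallelogram \<tau> q"
    then obtain r where r: "r \<in> R" "p - r \<in> period_lattice \<tau>"
      using R unfolding pole_representatives_def by blast
    have "\<exists>!l. l \<in> period_lattice \<tau> \<and> r - l \<in> parallelogram \<tau> q" by (rule parallelogram_tiling[OF \<tau>])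
    moreover have "r - p \<in> period_lattice \<tau>" "r - (r - p) \<in> parallelogram \<tau> q"
      using period_lattice_uminus[OF r(2)] p by auto
    ultimately have "r - p = lat r" using lat by blast
    then show "\<exists>r\<in>R. p = r - lat r" using r(1) by (intro bexI[of _ r]) (auto simp: algebra_simps)
  qed
  from sum.reindex_bij_betw[OF this, of "residue (\<lambda>z. z * f z)", symmetric]
  have "(\<Sum>p\<in>poles \<inter> parallelogram \<tau> q. residue (\<lambda>z. z * f z) p) =
      (\<Sum>r\<in>R. residue (\<lambda>z. z * f z) (r - lat r))" by simp
  also have "\<dots> = (\<Sum>r\<in>R. residue (\<lambda>z. z * f z) r)"
    using residue_mult_id_translate[OF lat(1) pr(2), of r r for r] by (intro sum.cong refl) simp
  finally show ?thesis .
qed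

text \<open>The residue theorem for \<open>z f(z)\<close> on the boundary of a parallelogram, cut into two triangles along
  the diagonal: the quasi-periodicity of \<open>z f(z)\<close> turns opposite sides into periods of \<open>f dz\<close>.\<close>

lemma legendre_relation:
  assumes R: "pole_representatives \<tau> f R"
  shows "period \<tau> - \<tau> * period 1 = 2 * pi * \<i> * (\<Sum>p\<in>R. residue (\<lambda>z. z * f z) p)"
proof -
  obtain q where q: "poles \<inter> closed_parallelogram \<tau> q \<subseteq> open_parallelogram \<tau> q"
    "\<And>z. z \<in> poles \<Longrightarrow> coord1 \<tau> (z - q) \<noteq> coord2 \<tau> (z - q)"
    using generic_parallelogram[OF \<tau> countable_poles] by metis
  define s t where "s = (\<lambda>z. coord1 \<tau> (z - q))" and "t = (\<lambda>z. coord2 \<tau> (z - q))"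
  define a b c d where "a = q" and "b = q + 1" and "c = q + 1 + \<tau>" and "d = q + \<tau>"
  have co: "coord1 \<tau> 1 = 1" "coord2 \<tau> 1 = 0" "coord1 \<tau> \<tau> = 0" "coord2 \<tau> \<tau> = 1" "coord1 \<tau> 0 = 0" "coord2 \<tau> 0 = 0"
    using \<tau> by (auto simp: coord1_def coord2_def)
  have z_eq: "z = q + of_real (s z) + of_real (t z) * \<tau>" for z
    using coord_eq[OF \<tau>, of "z - q"] by (simp add: s_def t_def add.assoc)
  have st: "s (q + of_real x + of_real y * \<tau>) = x" "t (q + of_real x + of_real y * \<tau>) = y" for x y
  proof -
    have "q + of_real x + of_real y * \<tau> - q = of_real x + of_real y * \<tau>" by simp
    then show "s (q + of_real x + of_real y * \<tau>) = x" "t (q + of_real x + of_real y * \<tau>) = y"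
      using \<tau> by (simp_all add: s_def t_def)
  qed
  have H1: "z \<in> convex hull {a, b, c} \<longleftrightarrow> 0 \<le> t z \<and> t z \<le> s z \<and> s z \<le> 1" for z
  proof
    assume "z \<in> convex hull {a, b, c}"
    then obtain u v where uv: "z = a + u *\<^sub>R (b - a) + v *\<^sub>R (c - a)" "0 \<le> u" "0 \<le> v" "u + v \<le> 1"
      by (auto simp: convex_hull_3_alt)
    then have "z = q + of_real (u + v) + of_real v * \<tau>"
      by (simp add: a_def b_def c_def scaleR_conv_of_real algebra_simps)
    then show "0 \<le> t z \<and> t z \<le> s z \<and> s z \<le> 1" using uv by (simp only: st) simp
  next
    assume *: "0 \<le> t z \<and> t z \<le> s z \<and> s z \<le> 1"
    have "z = a + (s z - t z) *\<^sub>R (b - a) + t z *\<^sub>R (c - a)"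
      by (subst z_eq) (simp add: a_def b_def c_def scaleR_conv_of_real algebra_simps)
    then show "z \<in> convex hull {a, b, c}" unfolding convex_hull_3_alt using *
      by (intro CollectI exI[of _ "s z - t z"] exI[of _ "t z"]) auto
  qed
  have H2: "z \<in> convex hull {a, c, d} \<longleftrightarrow> 0 \<le> s z \<and> s z \<le> t z \<and> t z \<le> 1" for z
  proof
    assume "z \<in> convex hull {a, c, d}"
    then obtain u v where uv: "z = a + u *\<^sub>R (c - a) + v *\<^sub>R (d - a)" "0 \<le> u" "0 \<le> v" "u + v \<le> 1"
      by (auto simp: convex_hull_3_alt)
    then have "z = q + of_real u + of_real (u + v) * \<tau>"
      by (simp add: a_def d_def c_def scaleR_conv_of_real algebra_simps)
    then show "0 \<le> s z \<and> s z \<le> t z \<and> t z \<le> 1" using uv by (simp only: st) simp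
  next
    assume *: "0 \<le> s z \<and> s z \<le> t z \<and> t z \<le> 1"
    have "z = a + s z *\<^sub>R (c - a) + (t z - s z) *\<^sub>R (d - a)"
      by (subst z_eq) (simp add: a_def d_def c_def scaleR_conv_of_real algebra_simps)
    then show "z \<in> convex hull {a, c, d}" unfolding convex_hull_3_alt using *
      by (intro CollectI exI[of _ "s z"] exI[of _ "t z - s z"]) auto
  qed
  have cl: "z \<in> closed_parallelogram \<tau> q \<longleftrightarrow> 0 \<le> s z \<and> s z \<le> 1 \<and> 0 \<le> t z \<and> t z \<le> 1" for z
    unfolding closed_parallelogram_iff[OF \<tau>] s_def t_def by auto
  have pole_in: "0 < s p \<and> s p < 1 \<and> 0 < t p \<and> t p < 1 \<and> s p \<noteq> t p"
    if "is_pole f p" "0 \<le> s p" "s p \<le> 1" "0 \<le> t p" "t p \<le> 1" for p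
    using q(1) q(2)[of p] that cl[of p] by (auto simp: open_parallelogram_def s_def t_def)
  have cont: "continuous_on UNIV s" "continuous_on UNIV t"
    unfolding s_def t_def by (auto intro!: continuous_on_compose2[OF continuous_on_coord(1)[of UNIV]]
        continuous_on_compose2[OF continuous_on_coord(2)[of UNIV]] continuous_intros)
  have o1: "open {z. 0 < t z \<and> t z < s z \<and> s z < 1}" and o2: "open {z. 0 < s z \<and> s z < t z \<and> t z < 1}"
    using cont by (auto intro!: open_Collect_conj open_Collect_less continuous_intros)
  have seg: "\<exists>u. 0 \<le> u \<and> u \<le> 1 \<and> z = x + of_real u * (y - x)" if "z \<in> closed_segment x y" for x y z :: complex
    using that by (auto simp: closed_segment_def scaleR_conv_of_real algebra_simps)
  have off: "\<not> is_pole f z" if z: "z \<in> closed_segment a b \<union> closed_segment b c \<union> closed_segment c a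
      \<union> closed_segment c d \<union> closed_segment d a" for z
  proof
    assume p: "is_pole f z"
    \<comment> \<open>On the sides one coordinate is 0 or 1 and on the diagonal both agree;
      \<open>pole_in\<close> excludes each of these for a pole.\<close>
    consider u where "0 \<le> u" "u \<le> 1" "z = q + of_real u + of_real 0 * \<tau>"
      | u where "0 \<le> u" "u \<le> 1" "z = q + of_real 1 + of_real u * \<tau>"
      | u where "0 \<le> u" "u \<le> 1" "z = q + of_real (1 - u) + of_real (1 - u) * \<tau>"
      | u where "0 \<le> u" "u \<le> 1" "z = q + of_real (1 - u) + of_real 1 * \<tau>"
      | u where "0 \<le> u" "u \<le> 1" "z = q + of_real 0 + of_real (1 - u) * \<tau>"
    proof -
      from z seg[of z a b] seg[of z b c] seg[of z c a] seg[of z c d] seg[of z d a]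
      show ?thesis using that by (auto simp: a_def b_def c_def d_def algebra_simps)
    qed
    then show False
      using pole_in[OF p] by cases (auto simp only: st, auto)
  qed
  have T1: "contour_integral (linepath a b +++ linepath b c +++ linepath c a) (\<lambda>z. z * f z) =
      2 * pi * \<i> * (\<Sum>p\<in>poles \<inter> convex hull {a, b, c}. residue (\<lambda>z. z * f z) p)"
  proof (rule triangle_residues)
    fix p assume p: "is_pole f p" "p \<in> convex hull {a, b, c}"
    then have in1: "0 < t p" "t p < s p" "s p < 1" using pole_in[OF p(1)] H1[of p] by auto
    have "{z. 0 < t z \<and> t z < s z \<and> s z < 1} \<subseteq> interior (convex hull {a, b, c})"
      by (rule interior_maximal[OF _ o1]) (auto simp: H1)
    \<comment> \<open>Orientation of the first triangle: the quantity is a positive multiple of the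
      height of \<open>p\<close> above the bottom side.\<close>
    moreover have "Im ((b - a) * cnj (b - p)) = t p * Im \<tau>"
      by (subst z_eq[of p]) (simp add: a_def b_def)
    ultimately show "p \<in> interior (convex hull {a, b, c}) \<and> 0 < Im ((b - a) * cnj (b - p))"
      using in1 \<tau> by auto
  qed (use off in \<open>auto simp: path_image_join\<close>)
  have T2: "contour_integral (linepath a c +++ linepath c d +++ linepath d a) (\<lambda>z. z * f z) =
      2 * pi * \<i> * (\<Sum>p\<in>poles \<inter> convex hull {a, c, d}. residue (\<lambda>z. z * f z) p)"
  proof (rule triangle_residues)
    fix p assume p: "is_pole f p" "p \<in> convex hull {a, c, d}"
    then have in2: "0 < s p" "s p < t p" "t p < 1" using pole_in[OF p(1)] H2[of p] by auto
    have "{z. 0 < s z \<and> s z < t z \<and> t z < 1} \<subseteq> interior (convex hull {a, c, d})"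
      by (rule interior_maximal[OF _ o2]) (auto simp: H2)
    moreover have "Im ((c - a) * cnj (c - p)) = (t p - s p) * Im \<tau>"
      by (subst z_eq[of p]) (simp add: a_def c_def algebra_simps)
    ultimately show "p \<in> interior (convex hull {a, c, d}) \<and> 0 < Im ((c - a) * cnj (c - p))"
      using in2 \<tau> by auto
  qed (use off in \<open>auto simp: path_image_join closed_segment_commute\<close>)
  have op: "open (- poles)" using closed_poles by (rule open_Compl)
  have hol: "(\<lambda>z. z * f z) holomorphic_on - poles" by (intro holomorphic_intros holomorphic_off_poles)
  define I where "I = (\<lambda>x y. contour_integral (linepath x y) (\<lambda>z. z * f z))"
  have ci: "(\<lambda>z. z * f z) contour_integrable_on linepath x y" if "closed_segment x y \<subseteq> - poles" for x y
    using that by (intro contour_integrable_holomorphic_simple[OF hol op]) auto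
  have segs: "closed_segment a b \<subseteq> - poles" "closed_segment b c \<subseteq> - poles" "closed_segment c a \<subseteq> - poles"
    "closed_segment a c \<subseteq> - poles" "closed_segment c d \<subseteq> - poles" "closed_segment d a \<subseteq> - poles"
    "closed_segment a d \<subseteq> - poles"
    using off by (auto simp: closed_segment_commute)
  have J1: "contour_integral (linepath a b +++ linepath b c +++ linepath c a) (\<lambda>z. z * f z) = I a b + (I b c + I c a)"
    using segs by (simp add: I_def ci contour_integrable_joinI)
  have J2: "contour_integral (linepath a c +++ linepath c d +++ linepath d a) (\<lambda>z. z * f z) = I a c + (I c d + I d a)"
    using segs by (simp add: I_def ci contour_integrable_joinI)
  have rev: "I x y = - I y x" if "closed_segment x y \<subseteq> - poles" for x y
    using contour_integral_reversepath[of "linepath y x" "\<lambda>z. z * f z"] by (simp add: I_def)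
  \<comment> \<open>As \<open>(z + w) * f (z + w) = z * f z + w * f z\<close>, translating a side by
    \<open>w\<close> adds \<open>w\<close> times the integral of \<open>f\<close> over that side,
    which is a period.\<close>
  have shift: "I (x + w) (y + w) = I x y + w * period l"
    if w: "w \<in> period_lattice \<tau>" and sg: "closed_segment x y \<subseteq> - poles" and l: "y = x + l" "l \<in> period_lattice \<tau>" for w x y l
  proof -
    have "(f has_contour_integral period l) (linepath x y)"
      using sg l by (intro contour_integral_period) auto
    moreover have "((\<lambda>z. z * f z) has_contour_integral I x y) (linepath x y)"
      unfolding I_def by (rule has_contour_integral_integral[OF ci[OF sg]])
    ultimately have "((\<lambda>z. z * f z + w * f z) has_contour_integral I x y + w * period l) (linepath x y)"
      by (intro has_contour_integral_add has_contour_integral_lmul)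
    then have "((\<lambda>z. (z + w) * f (z + w)) has_contour_integral I x y + w * period l) (linepath x y)"
      by (simp add: per[OF w] algebra_simps)
    then show ?thesis
      unfolding has_contour_integral_linepath_translate[of "\<lambda>z. z * f z", symmetric] I_def
      by (rule contour_integral_unique)
  qed
  have "I d c = I a b + \<tau> * period 1"
    using shift[of \<tau> a b 1] segs(1) by (simp add: a_def b_def c_def d_def add_ac)
  moreover have "I b c = I a d + 1 * period \<tau>"
    using shift[of 1 a d \<tau>] segs(7) by (simp add: a_def b_def c_def d_def add_ac)
  moreover have "I c d = - I d c" "I d a = - I a d" "I c a = - I a c"
    by (rule rev[OF segs(5)], rule rev[OF segs(6)], rule rev[OF segs(3)])
  \<comment> \<open>The diagonal is traversed in both directions and cancels; of each pair of
    opposite sides only the period term survives.\<close>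
  ultimately have sum: "I a b + (I b c + I c a) + (I a c + (I c d + I d a)) = period \<tau> - \<tau> * period 1" by simp
  have fin: "finite (poles \<inter> convex hull S)" if "finite S" for S
    by (intro finite_poles_compact compact_convex_hull finite_imp_compact that)
  \<comment> \<open>The triangles overlap in the diagonal, which was chosen free of poles, so no
    residue is counted twice.\<close>
  have disj: "(poles \<inter> convex hull {a, b, c}) \<inter> (poles \<inter> convex hull {a, c, d}) = {}"
  proof -
    have False if "is_pole f x" "0 \<le> s x" "t x = s x" "s x \<le> 1" for x
      using pole_in[OF that(1)] that by simp
    then show ?thesis by (auto simp: H1 H2)
  qed
  have un: "(poles \<inter> convex hull {a, b, c}) \<union> (poles \<inter> convex hull {a, c, d}) = poles \<inter> parallelogram \<tau> q"
  proof -
    have "z \<in> parallelogram \<tau> q \<longleftrightarrow> 0 \<le> s z \<and> s z < 1 \<and> 0 \<le> t z \<and> t z < 1" for z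
      unfolding parallelogram_def mem_Collect_eq fundamental_parallelogram_iff[OF \<tau>] s_def t_def by auto
    moreover have "z \<in> convex hull {a, b, c} \<or> z \<in> convex hull {a, c, d} \<longleftrightarrow> 0 \<le> s z \<and> s z < 1 \<and> 0 \<le> t z \<and> t z < 1"
      if "is_pole f z" for z
      using pole_in[OF that] by (auto simp: H1 H2)
    ultimately show ?thesis by blast
  qed
  have "period \<tau> - \<tau> * period 1 = 2 * pi * \<i> * (\<Sum>p\<in>poles \<inter> parallelogram \<tau> q. residue (\<lambda>z. z * f z) p)"
    unfolding sum[symmetric] J1[symmetric] J2[symmetric] T1 T2 un[symmetric]
    by (subst sum.union_disjoint[OF fin fin disj]) (auto simp: algebra_simps)
  then show ?thesis using sum_residues_parallelogram[OF R] by simp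
qed

text \<open>Replacing \<open>cnj \<tau>\<close> by \<open>\<tau> - 2 * \<i> * Im \<tau>\<close> in
  the numerator of \<open>\<alpha>\<close> splits off \<open>period 1\<close> and leaves the
  combination evaluated by Legendre's relation. The sign is that of the pairing, minus a sum of
  residues.\<close>

lemma \<alpha>_eq:
  assumes R: "pole_representatives \<tau> f R"
  shows "\<alpha> = period 1 - 1 / (2 * \<i> * of_real (Im \<tau>)) * (2 * of_real pi * \<i> * poincare_pairing f R)"
proof -
  have c: "\<tau> = cnj \<tau> + 2 * \<i> * of_real (Im \<tau>)" by (simp add: complex_eq_iff)
  have "period \<tau> - cnj \<tau> * period 1 = (period \<tau> - \<tau> * period 1) + 2 * \<i> * of_real (Im \<tau>) * period 1"
    by (subst (3) c) (simp add: algebra_simps)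
  then have "\<alpha> = ((period \<tau> - \<tau> * period 1) + 2 * \<i> * of_real (Im \<tau>) * period 1) / (2 * \<i> * of_real (Im \<tau>))"
    by (simp only: \<alpha>_def)
  also have "\<dots> = (period \<tau> - \<tau> * period 1) / (2 * \<i> * of_real (Im \<tau>)) + period 1"
    unfolding add_divide_distrib using \<tau> by simp
  finally have "\<alpha> = (period \<tau> - \<tau> * period 1) / (2 * \<i> * of_real (Im \<tau>)) + period 1" .
  then show ?thesis unfolding legendre_relation[OF R] by (simp add: poincare_pairing_def)
qed

end


section \<open>Variation with the modular parameter\<close>

text \<open>The tube lemma. It lets one segment of integration serve all nearby values of the
  modular parameter.\<close>

lemma compact_times_point_tube:
  fixes W :: "('a::topological_space \<times> 'b::metric_space) set"
  assumes K: "compact K" and W: "open W" and sub: "K \<times> {x} \<subseteq> W"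
  shows "\<exists>d>0. K \<times> ball x d \<subseteq> W"
proof -
  have "\<exists>A B. open A \<and> open B \<and> z \<in> A \<and> x \<in> B \<and> A \<times> B \<subseteq> W" if "z \<in> K" for z
    using W sub that unfolding open_prod_def by (metis SigmaI insertI1 mem_Times_iff fst_conv snd_conv subset_iff)
  then obtain A B where AB: "\<And>z. z \<in> K \<Longrightarrow> open (A z)" "\<And>z. z \<in> K \<Longrightarrow> open (B z)" "\<And>z. z \<in> K \<Longrightarrow> z \<in> A z"
    "\<And>z. z \<in> K \<Longrightarrow> x \<in> B z" "\<And>z. z \<in> K \<Longrightarrow> A z \<times> B z \<subseteq> W"
    by metis
  obtain C where C: "C \<subseteq> K" "finite C" "K \<subseteq> (\<Union>z\<in>C. A z)"
    by (rule compactE_image[OF K, of K A]) (use AB in auto)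
  have "open (\<Inter>z\<in>C. B z)" "x \<in> (\<Inter>z\<in>C. B z)" using C AB by (auto intro!: open_INT)
  then obtain d where d: "d > 0" "ball x d \<subseteq> (\<Inter>z\<in>C. B z)" using open_contains_ball by blast
  have "K \<times> ball x d \<subseteq> W"
  proof
    fix p assume "p \<in> K \<times> ball x d"
    then obtain z y where p: "p = (z, y)" "z \<in> K" "y \<in> ball x d" by auto
    then obtain c where c: "c \<in> C" "z \<in> A c" using C by auto
    then have "(z, y) \<in> A c \<times> B c" using d(2) p by auto
    then show "p \<in> W" using AB(5)[of c] c C p by auto
  qed
  then show ?thesis using d by blast
qed

lemma continuous_on_contour_integral_param:
  assumes "continuous_on (T \<times> closed_segment a b) (\<lambda>(t, z). F t z)"
  shows "continuous_on T (\<lambda>t. contour_integral (linepath a b) (F t))"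
proof -
  have "continuous_on (T \<times> cbox 0 1) (\<lambda>(t, x). F t (linepath a b x) * (b - a))"
  proof -
    have 1: "continuous_on (T \<times> {0..1}) (\<lambda>x. (fst x, linepath a b (snd x)))"
      unfolding linepath_def by (intro continuous_intros)
    have 2: "(\<lambda>x. (fst x, linepath a b (snd x))) ` (T \<times> {0..1}) \<subseteq> T \<times> closed_segment a b"
      by (auto simp: linepath_in_path)
    have "continuous_on (T \<times> {0..1}) (\<lambda>x. F (fst x) (linepath a b (snd x)))"
      using continuous_on_compose2[OF assms 1 2] by simp
    then show ?thesis unfolding case_prod_unfold cbox_interval by (intro continuous_intros)
  qed
  then have "continuous_on T (\<lambda>t. integral (cbox 0 1) (\<lambda>x. F t (linepath a b x) * (b - a)))"
    by (rule integral_continuous_on_param)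
  then show ?thesis by (simp add: contour_integral_integral)
qed

text \<open>Morera's theorem: by continuity the integral over a triangle in \<open>t\<close> may be
  exchanged with the integral over the segment, and the inner integrals vanish by Cauchy's
  theorem.\<close>

lemma holomorphic_on_contour_integral_param:
  assumes T: "open T" and cont: "continuous_on (closed_segment p q \<times> T) (\<lambda>(z, t). F z t)"
    and hol: "\<And>z. z \<in> closed_segment p q \<Longrightarrow> F z holomorphic_on T"
  shows "(\<lambda>t. contour_integral (linepath p q) (\<lambda>z. F z t)) holomorphic_on T"
proof -
  have swap: "continuous_on (T \<times> closed_segment p q) (\<lambda>(t, z). F z t)"
  proof -
    have 1: "continuous_on (T \<times> closed_segment p q) (\<lambda>x. (snd x, fst x))" by (intro continuous_intros)
    have 2: "(\<lambda>x. (snd x, fst x)) ` (T \<times> closed_segment p q) \<subseteq> closed_segment p q \<times> T" by auto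
    show ?thesis using continuous_on_compose2[OF cont 1 2] by (simp add: case_prod_unfold)
  qed
  let ?I = "\<lambda>t. contour_integral (linepath p q) (\<lambda>z. F z t)"
  have "?I analytic_on T"
  proof (rule Morera_triangle[OF continuous_on_contour_integral_param[OF swap] T], intro impI)
    fix a b c assume hull: "convex hull {a, b, c} \<subseteq> T"
    have seg: "closed_segment x y \<subseteq> T" if "x \<in> {a, b, c}" "y \<in> {a, b, c}" for x y
      using closed_segment_subset[OF hull_inc hull_inc convex_convex_hull, of x "{a, b, c}" y] that hull by blast
    define J where "J = (\<lambda>x y z. contour_integral (linepath x y) (F z))"
    have J: "contour_integral (linepath x y) ?I = contour_integral (linepath p q) (J x y)"
      and Jint: "J x y contour_integrable_on linepath p q" if "x \<in> {a, b, c}" "y \<in> {a, b, c}" for x y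
    proof -
      have c1: "continuous_on (closed_segment x y \<times> closed_segment p q) (\<lambda>(t, z). F z t)"
        by (rule continuous_on_subset[OF swap]) (use seg[OF that] in auto)
      have c2: "continuous_on (closed_segment p q \<times> closed_segment x y) (\<lambda>(z, t). F z t)"
        by (rule continuous_on_subset[OF cont]) (use seg[OF that] in auto)
      show "contour_integral (linepath x y) ?I = contour_integral (linepath p q) (J x y)"
        unfolding J_def using c1 by (intro contour_integral_swap) (auto intro: continuous_intros)
      show "J x y contour_integrable_on linepath p q"
        unfolding J_def by (intro contour_integrable_continuous_linepath continuous_on_contour_integral_param c2)
    qed
    have zero: "J a b z + J b c z + J c a z = 0" if "z \<in> closed_segment p q" for z
    proof -
      have F: "F z holomorphic_on T" by (rule hol[OF that])
      have ci: "F z contour_integrable_on linepath x y" if "x \<in> {a, b, c}" "y \<in> {a, b, c}" for x y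
        by (intro contour_integrable_continuous_linepath holomorphic_on_imp_continuous_on holomorphic_on_subset[OF F] seg that)
      have "(F z has_contour_integral 0) (linepath a b +++ linepath b c +++ linepath c a)"
        by (rule Cauchy_theorem_triangle[OF holomorphic_on_subset[OF F hull]])
      then have "contour_integral (linepath a b +++ linepath b c +++ linepath c a) (F z) = 0"
        by (rule contour_integral_unique)
      then show ?thesis using ci by (simp add: J_def contour_integrable_joinI add.assoc)
    qed
    have "contour_integral (linepath a b) ?I + contour_integral (linepath b c) ?I + contour_integral (linepath c a) ?I =
        contour_integral (linepath p q) (\<lambda>z. J a b z + J b c z + J c a z)"
      by (simp add: J Jint contour_integral_add contour_integrable_add)
    also have "\<dots> = contour_integral (linepath p q) (\<lambda>z. 0)"
      by (rule contour_integral_eq) (use zero in simp)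
    finally show "contour_integral (linepath a b) ?I + contour_integral (linepath b c) ?I + contour_integral (linepath c a) ?I = 0"
      by simp
  qed
  then show ?thesis by (rule analytic_imp_holomorphic)
qed

lemma isCont_not_is_pole: "isCont (f :: complex \<Rightarrow> complex) z \<Longrightarrow> \<not> is_pole f z"
  using not_tendsto_and_filterlim_at_infinity[of "at z" f "f z"] by (auto simp: is_pole_def isCont_def)

lemma open_upper_half_plane: "open upper_half_plane"
  unfolding upper_half_plane_def by (rule open_halfspace_Im_gt)

lemma modular_denominator:
  fixes a b c d :: int
  assumes det: "a * d - b * c = 1" and \<tau>: "Im \<tau> > 0"
  defines "j \<equiv> of_int c * \<tau> + of_int d" and "\<tau>' \<equiv> (of_int a * \<tau> + of_int b) / (of_int c * \<tau> + of_int d)"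
  shows "j \<noteq> 0" "of_real (Im \<tau>') * (j * cnj j) = of_real (Im \<tau>)" "Im \<tau>' > 0"
proof -
  show j0: "j \<noteq> 0"
  proof
    assume "j = 0"
    then have "of_int c * Im \<tau> = 0" "of_int c * Re \<tau> + of_int d = (0 :: real)"
      by (simp_all add: j_def complex_eq_iff)
    then have "c = 0" "d = 0" using \<tau> by auto
    then show False using det by simp
  qed
  have "Im \<tau>' * (norm j)\<^sup>2 = Im (of_int a * \<tau> + of_int b) * Re j - Re (of_int a * \<tau> + of_int b) * Im j"
    unfolding \<tau>'_def j_def[symmetric] Im_divide' using j0 by simp
  also have "\<dots> = of_int (a * d - b * c) * Im \<tau>" by (simp add: j_def algebra_simps)
  finally have *: "Im \<tau>' * (norm j)\<^sup>2 = Im \<tau>" unfolding det by simp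
  then show "of_real (Im \<tau>') * (j * cnj j) = of_real (Im \<tau>)"
    unfolding complex_norm_square[symmetric] by (simp only: of_real_mult[symmetric] of_real_power[symmetric] *)
  have "(norm j)\<^sup>2 > 0" using j0 by simp
  moreover have "Im \<tau>' * (norm j)\<^sup>2 > 0" using * \<tau> by simp
  ultimately show "Im \<tau>' > 0" by (simp add: zero_less_mult_iff)
qed

locale modular_elliptic_family =
  fixes \<Phi> :: "complex \<Rightarrow> complex \<Rightarrow> complex" and k :: int
  assumes fibres: "\<And>\<tau>. Im \<tau> > 0 \<Longrightarrow> restricts_to_fibre \<Phi> \<tau>"
    and ell: "elliptic \<Phi>"
    and mod: "modular2 k \<Phi>"
    and res: "\<And>\<tau> p. Im \<tau> > 0 \<Longrightarrow> is_pole (\<lambda>z. \<Phi> z \<tau>) p \<Longrightarrow> residue (\<lambda>z. \<Phi> z \<tau>) p = 0"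
begin

lemma fibre: "Im \<tau> > 0 \<Longrightarrow> elliptic_second_kind \<tau> (\<lambda>z. \<Phi> z \<tau>)"
  using fibres ell res
  by unfold_locales (auto simp: restricts_to_fibre_def elliptic_def upper_half_plane_def)

definition per :: "complex \<Rightarrow> complex \<Rightarrow> complex" where
  "per \<tau> l = elliptic_second_kind.period (\<lambda>z. \<Phi> z \<tau>) l"

text \<open>The fibre at \<open>\<tau>'\<close> is \<open>j powi k * \<Phi> (j * z) \<tau>\<close>,
  so \<open>j powi (k - 1)\<close> times the primitive at \<tau>, evaluated at \<open>j * z\<close>,
  is a primitive for it; one power of \<open>j\<close> is lost to the chain rule. Its increment
  along \<open>l\<close> is that of the old primitive along \<open>j * l\<close>.\<close>

lemma per_modular:
  fixes a b c d m n :: int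
  assumes det: "a * d - b * c = 1" and \<tau>: "Im \<tau> > 0"
  defines "j \<equiv> of_int c * \<tau> + of_int d" and "\<tau>' \<equiv> (of_int a * \<tau> + of_int b) / (of_int c * \<tau> + of_int d)"
  assumes l: "l \<in> period_lattice \<tau>'" "j * l = of_int m * \<tau> + of_int n"
  shows "per \<tau>' l = j powi (k - 1) * (of_int m * per \<tau> \<tau> + of_int n * per \<tau> 1)"
proof -
  have j0: "j \<noteq> 0" and \<tau>': "Im \<tau>' > 0"
    using modular_denominator[OF det \<tau>] by (auto simp: j_def \<tau>'_def)
  let ?f = "\<lambda>z. \<Phi> z \<tau>" and ?f' = "\<lambda>z. \<Phi> z \<tau>'"
  interpret E: elliptic_second_kind \<tau> ?f by (rule fibre[OF \<tau>])
  interpret E': elliptic_second_kind \<tau>' ?f' by (rule fibre[OF \<tau>'])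
  have f': "?f' z = j powi k * ?f (j * z)" for z
  proof -
    have "\<Phi> (j * z / j) \<tau>' = j powi k * \<Phi> (j * z) \<tau>"
      using mod det \<tau> unfolding modular2_def upper_half_plane_def j_def \<tau>'_def by blast
    then show ?thesis using j0 by simp
  qed
  \<comment> \<open>The fibre at \<tau> is recovered from that at \<open>\<tau>'\<close> by a
    rescaling, so continuity at \<open>z\<close> passes to continuity at
    \<open>j * z\<close>.\<close>
  have np: "\<not> is_pole ?f (j * z)" if "\<not> is_pole ?f' z" for z
  proof (rule isCont_not_is_pole)
    have "isCont ?f' z" using E'.analytic_off_poles[OF that] analytic_at_imp_isCont by blast
    then have "isCont ?f' (j * z / j)" using j0 by simp
    then have "isCont (\<lambda>w. j powi (- k) * ?f' (w / j)) (j * z)"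
      using j0 by (intro continuous_intros isCont_o2[of "j * z" "\<lambda>w. w / j" ?f']) auto
    moreover have "(\<lambda>w. j powi (- k) * ?f' (w / j)) = ?f"
      using j0 by (simp add: f' power_int_minus fun_eq_iff)
    ultimately show "isCont ?f (j * z)" by simp
  qed
  obtain z where z: "\<not> is_pole ?f' z" using E'.not_pole_exists by blast
  have lat: "of_int m * \<tau> + of_int n \<in> period_lattice \<tau>"
    using period_lattice_add[OF E.period_of_int_mult(2)[of \<tau> m] E.period_of_int_mult(2)[of 1 n]] by simp
  have "E'.period l = j powi (k - 1) * E.period (of_int m * \<tau> + of_int n)"
  proof (rule E'.period_eqI[OF l(1) z, where H = "\<lambda>z. j powi (k - 1) * E.primitive (j * z)"])
    show "j powi (k - 1) * E.primitive (j * (z + l)) - j powi (k - 1) * E.primitive (j * z) =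
        j powi (k - 1) * E.period (of_int m * \<tau> + of_int n)"
      using E.primitive_period[OF lat np[OF z]] by (simp add: distrib_left l(2) algebra_simps)
    fix w assume w: "\<not> is_pole ?f' w"
    have "((\<lambda>z. j powi (k - 1) * E.primitive (j * z)) has_field_derivative j powi (k - 1) * (?f (j * w) * j)) (at w)"
      by (intro DERIV_cmult DERIV_chain2[where f = E.primitive and g = "\<lambda>z. j * z", OF E.DERIV_primitive[OF np[OF w]]]) (auto intro!: derivative_eq_intros)
    moreover have "j powi (k - 1) * (?f (j * w) * j) = ?f' w"
      using j0 by (simp add: f' power_int_diff)
    ultimately show "((\<lambda>z. j powi (k - 1) * E.primitive (j * z)) has_field_derivative ?f' w) (at w)" by simp
  qed
  then show ?thesis by (simp add: per_def E.period_lincomb)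
qed

text \<open>From \<open>j * 1 = c * \<tau> + d\<close> and
  \<open>j * \<tau>' = a * \<tau> + b\<close>: the pair of periods is transformed by the matrix
  itself, with weight \<open>k - 1\<close>.\<close>

lemma per_1_modular:
  fixes a b c d :: int
  assumes det: "a * d - b * c = 1" and \<tau>: "Im \<tau> > 0"
  defines "j \<equiv> of_int c * \<tau> + of_int d" and "\<tau>' \<equiv> (of_int a * \<tau> + of_int b) / (of_int c * \<tau> + of_int d)"
  shows "per \<tau>' 1 = j powi (k - 1) * (of_int c * per \<tau> \<tau> + of_int d * per \<tau> 1)"
    and "per \<tau>' \<tau>' = j powi (k - 1) * (of_int a * per \<tau> \<tau> + of_int b * per \<tau> 1)"
  using per_modular[OF det \<tau>, of 1 c d] per_modular[OF det \<tau>, of \<tau>' a b] modular_denominator(1)[OF det \<tau>]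
  unfolding j_def \<tau>'_def by simp_all

text \<open>The period is written as an integral over one fixed segment for all nearby parameters.
  Since the local fractions may have vanishing denominators even where the values of
  \<open>\<Phi>\<close> are finite, the segment must avoid more than the poles.\<close>

lemma holomorphic_fibre_integral_local:
  assumes \<tau>: "Im \<tau> > 0"
  shows "\<exists>d>0. (\<lambda>\<sigma>. per \<sigma> 1) holomorphic_on ball \<tau> d"
proof -
  define good where "good = (\<lambda>p. \<exists>U g h. quotient_rep \<Phi> p U g h \<and> h p \<noteq> 0)"
  \<comment> \<open>The points near which the integrand is jointly continuous and complex
    differentiable in the parameter, just what the theorem on parameter integrals asks for.\<close>
  define W where "W = {p. \<exists>V. open V \<and> p \<in> V \<and> continuous_on V (\<lambda>(z, \<sigma>). \<Phi> z \<sigma>) \<and>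
    (\<forall>(z, \<sigma>)\<in>V. (\<lambda>\<sigma>. \<Phi> z \<sigma>) field_differentiable (at \<sigma>))}"
  have W: "open W"
    unfolding W_def by (subst open_subopen) blast
  have goodW: "p \<in> W" if p: "good p" for p
  proof -
    obtain U g h where U: "open U" "p \<in> U" "holomorphic2_on g U" "holomorphic2_on h U" "h p \<noteq> 0"
      and eq: "\<And>z \<sigma>. (z, \<sigma>) \<in> U \<Longrightarrow> h (z, \<sigma>) \<noteq> 0 \<Longrightarrow> \<Phi> z \<sigma> = g (z, \<sigma>) / h (z, \<sigma>)"
      using p unfolding good_def quotient_rep_def by blast
    have cont: "continuous_on U u" if "holomorphic2_on u U" for u
    proof (rule continuous_at_imp_continuous_on, rule ballI)
      fix x assume "x \<in> U"
      with that obtain a b where "(u has_derivative (\<lambda>(x, y). a * x + b * y)) (at x)"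
        unfolding holomorphic2_on_def by blast
      then show "isCont u x" by (rule has_derivative_continuous)
    qed
    define V where "V = {x \<in> U. h x \<noteq> 0}"
    have V: "open V" "p \<in> V"
    proof -
      have "V = U \<inter> h -` (- {0})" by (auto simp: V_def)
      then show "open V" using continuous_open_preimage[OF cont[OF U(4)] U(1), of "- {0}"] by auto
      show "p \<in> V" using U by (simp add: V_def)
    qed
    have "continuous_on V (\<lambda>x. g x / h x)"
      by (intro continuous_intros continuous_on_subset[OF cont[OF U(3)]] continuous_on_subset[OF cont[OF U(4)]])
         (auto simp: V_def)
    moreover have "\<Phi> (fst x) (snd x) = g x / h x" if "x \<in> V" for x
      using eq[of "fst x" "snd x"] that by (simp add: V_def)
    ultimately have c: "continuous_on V (\<lambda>(z, \<sigma>). \<Phi> z \<sigma>)"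
      unfolding case_prod_unfold by (simp cong: continuous_on_cong)
    have slice: "(\<lambda>\<sigma>. u (z, \<sigma>)) field_differentiable (at \<sigma>)" if u: "holomorphic2_on u U" "(z, \<sigma>) \<in> U" for u z \<sigma>
    proof -
      obtain a b where "(u has_derivative (\<lambda>(x, y). a * x + b * y)) (at (z, \<sigma>))"
        using u unfolding holomorphic2_on_def by blast
      moreover have "((\<lambda>\<sigma>. (z, \<sigma>)) has_derivative (\<lambda>y. (0, y))) (at \<sigma>)"
        by (auto intro!: derivative_eq_intros)
      ultimately have "((\<lambda>\<sigma>. u (z, \<sigma>)) has_derivative (\<lambda>y. case (0, y) of (x, y) \<Rightarrow> a * x + b * y)) (at \<sigma>)"
        using has_derivative_compose[of "\<lambda>\<sigma>. (z, \<sigma>)" "\<lambda>y. (0, y)" \<sigma> UNIV u] by blast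
      then have "((\<lambda>\<sigma>. u (z, \<sigma>)) has_field_derivative b) (at \<sigma>)" by (simp add: has_field_derivative_def)
      then show ?thesis by (auto simp: field_differentiable_def)
    qed
    have d: "(\<lambda>\<sigma>. \<Phi> z \<sigma>) field_differentiable (at \<sigma>)" if "(z, \<sigma>) \<in> V" for z \<sigma>
    proof -
      have "(\<lambda>\<sigma>. g (z, \<sigma>) / h (z, \<sigma>)) field_differentiable (at \<sigma>)"
        using that U slice by (intro field_differentiable_divide) (auto simp: V_def)
      then obtain D where D: "((\<lambda>\<sigma>. g (z, \<sigma>) / h (z, \<sigma>)) has_field_derivative D) (at \<sigma>)"
        by (auto simp: field_differentiable_def)
      have o: "open ((\<lambda>\<sigma>. (z, \<sigma>)) -` V)" by (intro open_vimage V continuous_intros)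
      have "((\<lambda>\<sigma>. \<Phi> z \<sigma>) has_field_derivative D) (at \<sigma>)"
        by (rule has_field_derivative_transform_within_open[OF D o]) (use that eq in \<open>auto simp: V_def\<close>)
      then show ?thesis by (auto simp: field_differentiable_def)
    qed
    show ?thesis unfolding W_def using V c d by blast
  qed
  \<comment> \<open>The points of the fibre at \<tau> without a nonvanishing denominator. By
    \<open>restricts_to_fibre\<close> they do not accumulate, hence are countable, and some
    horizontal line misses them all.\<close>
  define Z where "Z = {z. \<not> good (z, \<tau>)}"
  have nolim: "\<not> z islimpt Z" for z
  proof -
    obtain U g h where q: "quotient_rep \<Phi> (z, \<tau>) U g h" and ev: "\<forall>\<^sub>F w in at z. h (w, \<tau>) \<noteq> 0"
      using fibres[OF \<tau>] unfolding restricts_to_fibre_def by blast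
    have U: "open U" "(z, \<tau>) \<in> U" using q by (auto simp: quotient_rep_def)
    have o: "open ((\<lambda>w. (w, \<tau>)) -` U)" by (intro open_vimage U continuous_intros)
    have "\<forall>\<^sub>F w in at z. w \<in> (\<lambda>w. (w, \<tau>)) -` U"
      using U(2) by (intro eventually_at_in_open'[OF o]) simp
    with ev have "\<forall>\<^sub>F w in at z. w \<notin> Z"
    proof eventually_elim
      case (elim w)
      have "quotient_rep \<Phi> (w, \<tau>) U g h" using q elim by (auto simp: quotient_rep_def)
      then have "good (w, \<tau>)" using elim unfolding good_def by blast
      then show ?case by (simp add: Z_def)
    qed
    then show ?thesis by (simp add: islimpt_conv_frequently_at frequently_def)
  qed
  have "countable Z"
  proof -
    have Z: "Z = (\<Union>n::nat. cball 0 (real n) \<inter> Z)"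
    proof (intro equalityI subsetI)
      fix z assume z: "z \<in> Z"
      obtain n :: nat where "norm z \<le> real n" using real_arch_simple by blast
      then show "z \<in> (\<Union>n::nat. cball 0 (real n) \<inter> Z)" using z by auto
    qed auto
    have "countable (\<Union>n::nat. cball 0 (real n) \<inter> Z)"
    proof (rule countable_UN)
      show "countable (cball 0 (real n) \<inter> Z)" for n
        by (rule countable_finite[OF finite_not_islimpt_in_compact[OF compact_cball nolim]])
    qed simp
    then show ?thesis by (subst Z)
  qed
  then have "countable (Im ` Z)" by simp
  then have "Im ` Z \<noteq> UNIV" using uncountable_UNIV_real by auto
  then obtain y where y: "y \<notin> Im ` Z" by auto
  define p where "p = \<i> * of_real y"
  have seg: "closed_segment p (p + 1) \<times> {\<tau>} \<subseteq> W"
  proof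
    fix x assume "x \<in> closed_segment p (p + 1) \<times> {\<tau>}"
    then obtain z where z: "x = (z, \<tau>)" "z \<in> closed_segment p (p + 1)" by auto
    then have "Im z = y" by (auto simp: closed_segment_def p_def algebra_simps)
    then have "z \<notin> Z" using y by auto
    then show "x \<in> W" using goodW z by (simp add: Z_def)
  qed
  obtain d where d: "d > 0" "closed_segment p (p + 1) \<times> ball \<tau> d \<subseteq> W"
    using compact_times_point_tube[OF compact_segment W seg] by blast
  \<comment> \<open>The minimum with \<open>Im \<tau>\<close> keeps the disc inside the upper
    half-plane.\<close>
  define e where "e = min d (Im \<tau>)"
  have e: "e > 0" "ball \<tau> e \<subseteq> ball \<tau> d" using d \<tau> by (auto simp: e_def)
  have H: "Im \<sigma> > 0" if "\<sigma> \<in> ball \<tau> e" for \<sigma>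
    using abs_Im_le_cmod[of "\<tau> - \<sigma>"] that by (auto simp: e_def dist_norm)
  have inW: "closed_segment p (p + 1) \<times> ball \<tau> e \<subseteq> W" using d(2) e(2) by auto
  have contW: "continuous_on W (\<lambda>(z, \<sigma>). \<Phi> z \<sigma>)"
  proof (rule continuous_at_imp_continuous_on, rule ballI)
    fix x assume "x \<in> W"
    then obtain V where "open V" "x \<in> V" "continuous_on V (\<lambda>(z, \<sigma>). \<Phi> z \<sigma>)" unfolding W_def by blast
    then show "isCont (\<lambda>(z, \<sigma>). \<Phi> z \<sigma>) x" by (simp add: continuous_on_eq_continuous_at)
  qed
  have eq: "per \<sigma> 1 = contour_integral (linepath p (p + 1)) (\<lambda>z. \<Phi> z \<sigma>)" if \<sigma>: "\<sigma> \<in> ball \<tau> e" for \<sigma>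
  proof -
    interpret E: elliptic_second_kind \<sigma> "\<lambda>z. \<Phi> z \<sigma>" by (rule fibre[OF H[OF \<sigma>]])
    have "\<not> is_pole (\<lambda>z. \<Phi> z \<sigma>) z" if z: "z \<in> closed_segment p (p + 1)" for z
    proof (rule isCont_not_is_pole)
      have "(z, \<sigma>) \<in> W" using inW z \<sigma> by auto
      then have "isCont (\<lambda>(z, \<sigma>). \<Phi> z \<sigma>) (z, \<sigma>)" using contW W by (simp add: continuous_on_eq_continuous_at)
      then have "isCont (\<lambda>w. (\<lambda>(z, \<sigma>). \<Phi> z \<sigma>) (w, \<sigma>)) z"
        by (intro isCont_o2[of z "\<lambda>w. (w, \<sigma>)" "\<lambda>(z, \<sigma>). \<Phi> z \<sigma>"]) (auto intro!: continuous_intros)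
      then show "isCont (\<lambda>z. \<Phi> z \<sigma>) z" by simp
    qed
    then have "((\<lambda>z. \<Phi> z \<sigma>) has_contour_integral E.period 1) (linepath p (p + 1))"
      by (intro E.contour_integral_period) auto
    then show ?thesis unfolding per_def by (simp add: contour_integral_unique)
  qed
  have "(\<lambda>\<sigma>. contour_integral (linepath p (p + 1)) (\<lambda>z. \<Phi> z \<sigma>)) holomorphic_on ball \<tau> e"
  proof (rule holomorphic_on_contour_integral_param[OF open_ball])
    show "continuous_on (closed_segment p (p + 1) \<times> ball \<tau> e) (\<lambda>(z, t). \<Phi> z t)"
      by (rule continuous_on_subset[OF contW inW])
    fix z assume z: "z \<in> closed_segment p (p + 1)"
    show "\<Phi> z holomorphic_on ball \<tau> e"
      unfolding holomorphic_on_def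
    proof
      fix \<sigma> assume "\<sigma> \<in> ball \<tau> e"
      then have "(z, \<sigma>) \<in> W" using inW z by auto
      then have "(\<lambda>\<sigma>. \<Phi> z \<sigma>) field_differentiable (at \<sigma>)" unfolding W_def by blast
      then show "\<Phi> z field_differentiable at \<sigma> within ball \<tau> e" by (simp add: field_differentiable_at_within)
    qed
  qed
  then have "(\<lambda>\<sigma>. per \<sigma> 1) holomorphic_on ball \<tau> e"
    by (subst holomorphic_cong[OF refl eq])
  then show ?thesis using e by blast
qed

lemma holomorphic_per_1: "(\<lambda>\<tau>. per \<tau> 1) holomorphic_on upper_half_plane"
proof -
  have "(\<lambda>\<tau>. per \<tau> 1) field_differentiable (at \<tau>)" if "\<tau> \<in> upper_half_plane" for \<tau>
  proof -
    obtain d where "d > 0" "(\<lambda>\<sigma>. per \<sigma> 1) holomorphic_on ball \<tau> d"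
      using holomorphic_fibre_integral_local[of \<tau>] \<open>\<tau> \<in> upper_half_plane\<close> by (auto simp: upper_half_plane_def)
    then show ?thesis by (intro holomorphic_on_imp_differentiable_at[of _ "ball \<tau> d"]) auto
  qed
  then show ?thesis by (simp add: holomorphic_on_def field_differentiable_at_within)
qed

text \<open>The matrix with \<open>a = d = 0\<close>, \<open>b = -1\<close>, \<open>c = 1\<close>
  exchanges the two periods up to sign, so holomorphy carries over from the period for 1 and no
  segment with a moving endpoint has to be considered.\<close>

lemma holomorphic_per_\<tau>: "(\<lambda>\<tau>. per \<tau> \<tau>) holomorphic_on upper_half_plane"
proof -
  have eq: "\<tau> powi (1 - k) * per (- 1 / \<tau>) 1 = per \<tau> \<tau>" if "\<tau> \<in> upper_half_plane" for \<tau>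
  proof -
    have \<tau>: "Im \<tau> > 0" "\<tau> \<noteq> 0" using that by (auto simp: upper_half_plane_def)
    have "per (- 1 / \<tau>) 1 = \<tau> powi (k - 1) * per \<tau> \<tau>"
      using per_1_modular(1)[of 0 0 "-1" 1 \<tau>] \<tau>(1) by simp
    then have "\<tau> powi (1 - k) * per (- 1 / \<tau>) 1 = (\<tau> powi (1 - k) * \<tau> powi (k - 1)) * per \<tau> \<tau>" by simp
    also have "\<tau> powi (1 - k) * \<tau> powi (k - 1) = 1" using \<tau>(2) by (subst power_int_add[symmetric]) auto
    finally show ?thesis by simp
  qed
  have im: "(\<lambda>\<tau>. - 1 / \<tau>) ` upper_half_plane \<subseteq> upper_half_plane"
    using modular_denominator(3)[of 0 0 "-1" 1] by (auto simp: upper_half_plane_def)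
  have ne: "\<tau> \<noteq> 0" if "\<tau> \<in> upper_half_plane" for \<tau> using that by (auto simp: upper_half_plane_def)
  have inv: "(\<lambda>\<tau>. - 1 / \<tau>) holomorphic_on upper_half_plane"
    by (intro holomorphic_intros) (use ne in auto)
  have "(\<lambda>\<tau>. per (- 1 / \<tau>) 1) holomorphic_on upper_half_plane"
    using holomorphic_on_compose_gen[OF inv holomorphic_per_1 im] by (simp only: o_def)
  then have "(\<lambda>\<tau>. \<tau> powi (1 - k) * per (- 1 / \<tau>) 1) holomorphic_on upper_half_plane"
    using ne by (intro holomorphic_intros) auto
  then show ?thesis by (subst (asm) holomorphic_cong[OF refl eq])
qed

end


section \<open>Quasi-modularity and the modular completion\<close>

context modular_elliptic_family
begin

text \<open>The coefficient \<open>\<alpha>\<close> of the fibre at \<tau>, as a function of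
  \<tau>.\<close>

definition completed :: "complex \<Rightarrow> complex" where
  "completed \<tau> = (per \<tau> \<tau> - cnj \<tau> * per \<tau> 1) / (2 * \<i> * of_real (Im \<tau>))"

text \<open>Polynomial form of degree one in \<open>1 / Im \<tau>\<close>, with coefficients that
  are holomorphic in \<tau>; the coefficient of degree 0 is the holomorphic limit.\<close>

lemma completed_eq:
  assumes "Im \<tau> > 0"
  shows "completed \<tau> = per \<tau> 1 + (per \<tau> \<tau> - \<tau> * per \<tau> 1) / (2 * \<i>) / of_real (Im \<tau>)"
proof -
  have c: "cnj \<tau> = \<tau> - 2 * \<i> * of_real (Im \<tau>)" by (simp add: complex_eq_iff)
  have "per \<tau> \<tau> - cnj \<tau> * per \<tau> 1 = (per \<tau> \<tau> - \<tau> * per \<tau> 1) + 2 * \<i> * of_real (Im \<tau>) * per \<tau> 1"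
    unfolding c by (simp add: algebra_simps)
  then have "completed \<tau> = ((per \<tau> \<tau> - \<tau> * per \<tau> 1) + 2 * \<i> * of_real (Im \<tau>) * per \<tau> 1) / (2 * \<i> * of_real (Im \<tau>))"
    by (simp only: completed_def)
  also have "\<dots> = (per \<tau> \<tau> - \<tau> * per \<tau> 1) / (2 * \<i> * of_real (Im \<tau>)) + per \<tau> 1"
    unfolding add_divide_distrib using assms by simp
  finally show ?thesis by (simp only: divide_divide_eq_left add.commute)
qed

text \<open>By the determinant condition the numerator is multiplied by
  \<open>j powi (k - 1) / cnj j\<close>, and \<open>Im \<tau>\<close> by
  \<open>1 / (j * cnj j)\<close>. The conjugates cancel in the quotient and the weight becomes
  \<open>k\<close>.\<close>

lemma completed_modular:
  fixes a b c d :: int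
  assumes det: "a * d - b * c = 1" and \<tau>: "Im \<tau> > 0"
  defines "j \<equiv> of_int c * \<tau> + of_int d" and "\<tau>' \<equiv> (of_int a * \<tau> + of_int b) / (of_int c * \<tau> + of_int d)"
  shows "completed \<tau>' = j powi k * completed \<tau>"
proof -
  let ?J = "j powi (k - 1)" and ?A = "per \<tau> 1" and ?B = "per \<tau> \<tau>"
  note M = modular_denominator[OF det \<tau>, folded j_def \<tau>'_def]
  have A': "per \<tau>' 1 = ?J * (of_int c * ?B + of_int d * ?A)" and B': "per \<tau>' \<tau>' = ?J * (of_int a * ?B + of_int b * ?A)"
    using per_1_modular[OF det \<tau>] by (simp_all add: j_def \<tau>'_def)
  have det': "of_int a * of_int d - of_int b * of_int c = (1 :: complex)"
    using det by (metis of_int_1 of_int_diff of_int_mult)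
  have cj: "cnj j = of_int c * cnj \<tau> + of_int d" "cnj j \<noteq> 0"
    using M(1) by (simp add: j_def, simp)
  have "cnj \<tau>' * cnj j = of_int a * cnj \<tau> + of_int b"
    using cj(2) by (simp add: \<tau>'_def j_def)
  then have "(per \<tau>' \<tau>' - cnj \<tau>' * per \<tau>' 1) * cnj j =
      ?J * ((of_int a * ?B + of_int b * ?A) * cnj j - (of_int a * cnj \<tau> + of_int b) * (of_int c * ?B + of_int d * ?A))"
    unfolding A' B' by (simp add: left_diff_distrib right_diff_distrib)
  also have "\<dots> = ?J * ((of_int a * of_int d - of_int b * of_int c) * (?B - cnj \<tau> * ?A))"
    unfolding cj(1) by (simp add: algebra_simps)
  finally have 1: "per \<tau>' \<tau>' - cnj \<tau>' * per \<tau>' 1 = ?J * (?B - cnj \<tau> * ?A) / cnj j"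
    unfolding det' using cj(2) by (simp add: field_simps)
  have 2: "of_real (Im \<tau>') = of_real (Im \<tau>) / (j * cnj j)"
    using M(1,2) cj(2) by (simp add: field_simps)
  have "completed \<tau>' = ?J * j * ((?B - cnj \<tau> * ?A) / (2 * \<i> * of_real (Im \<tau>)))"
    unfolding completed_def 1 2 using M(1) cj(2) \<tau> by (simp add: field_simps)
  also have "?J * j = j powi k" using M(1) by (simp add: power_int_diff)
  finally show ?thesis by (simp add: completed_def)
qed

text \<open>Writing \<open>d\<close> as \<open>j - c * \<tau>\<close> separates the modular term
  from the defect, which is linear in \<open>c\<close>.\<close>

lemma per_1_quasi_modular:
  fixes a b c d :: int
  assumes det: "a * d - b * c = 1" and \<tau>: "Im \<tau> > 0"
  defines "j \<equiv> of_int c * \<tau> + of_int d" and "\<tau>' \<equiv> (of_int a * \<tau> + of_int b) / (of_int c * \<tau> + of_int d)"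
  shows "per \<tau>' 1 = j powi k * per \<tau> 1 + of_int c * j powi (k - 1) * (per \<tau> \<tau> - \<tau> * per \<tau> 1)"
proof -
  have j: "j \<noteq> 0" using modular_denominator(1)[OF det \<tau>] by (simp add: j_def)
  have "per \<tau>' 1 = j powi (k - 1) * (of_int c * per \<tau> \<tau> + (j - of_int c * \<tau>) * per \<tau> 1)"
    using per_1_modular(1)[OF det \<tau>] by (simp add: j_def \<tau>'_def)
  also have "\<dots> = j powi (k - 1) * j * per \<tau> 1 + of_int c * j powi (k - 1) * (per \<tau> \<tau> - \<tau> * per \<tau> 1)"
    by (simp add: algebra_simps)
  also have "j powi (k - 1) * j = j powi k" using j by (simp add: power_int_diff)
  finally show ?thesis .
qed

end

theorem proposition2p22:
  fixes \<Phi> :: "complex \<Rightarrow> complex \<Rightarrow> complex"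
    and k :: int
    and A :: "complex \<Rightarrow> real \<Rightarrow> complex"
    and R :: "complex \<Rightarrow> complex set"
  assumes meromorphic: "meromorphic2_on \<Phi> (UNIV \<times> upper_half_plane)"
    and fibres: "\<forall>\<tau>\<in>upper_half_plane. restricts_to_fibre \<Phi> \<tau>"
    and elliptic: "elliptic \<Phi>"
    and modular: "modular2 k \<Phi>"
    and second_kind: "\<forall>\<tau>\<in>upper_half_plane. \<forall>p. is_pole (\<lambda>z. \<Phi> z \<tau>) p \<longrightarrow> residue (\<lambda>z. \<Phi> z \<tau>) p = 0"
    and A_cycle: "\<forall>\<tau>\<in>upper_half_plane. A_cycle (\<lambda>z. \<Phi> z \<tau>) (A \<tau>)"
    and pole_reps: "\<forall>\<tau>\<in>upper_half_plane. pole_representatives \<tau> (\<lambda>z. \<Phi> z \<tau>) (R \<tau>)"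
  shows "quasi_modular k (\<lambda>\<tau>. contour_integral (A \<tau>) (\<lambda>z. \<Phi> z \<tau>)) \<and>
    is_modular_completion k
      (\<lambda>\<tau>. contour_integral (A \<tau>) (\<lambda>z. \<Phi> z \<tau>))
      (\<lambda>\<tau>. reg_integral \<tau> (\<lambda>z. \<Phi> z \<tau> / of_real (Im \<tau>))) \<and>
    (\<forall>\<tau>\<in>upper_half_plane.
       reg_integral \<tau> (\<lambda>z. \<Phi> z \<tau> / of_real (Im \<tau>)) =
       contour_integral (A \<tau>) (\<lambda>z. \<Phi> z \<tau>) -
       1 / (2 * \<i> * of_real (Im \<tau>)) * (2 * of_real pi * \<i> * poincare_pairing (\<lambda>z. \<Phi> z \<tau>) (R \<tau>)))"
proof -
  interpret modular_elliptic_family \<Phi> k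
    using fibres elliptic modular second_kind
    by unfold_locales (auto simp: upper_half_plane_def)
  define CI where "CI = (\<lambda>\<tau>. contour_integral (A \<tau>) (\<lambda>z. \<Phi> z \<tau>))"
  define RI where "RI = (\<lambda>\<tau>. reg_integral \<tau> (\<lambda>z. \<Phi> z \<tau> / of_real (Im \<tau>)))"
  \<comment> \<open>The same function is the correction term of the transformation law and, divided
    by \<open>2 * \<i>\<close>, the coefficient of \<open>1 / Im \<tau>\<close> in the completion.
    By Legendre's relation it is \<open>- 2 * pi * \<i>\<close> times the residue pairing.\<close>
  define Q where "Q = (\<lambda>\<tau>. per \<tau> \<tau> - \<tau> * per \<tau> 1)"
  \<comment> \<open>The paths \<open>A \<tau>\<close> and the representatives
    \<open>R \<tau>\<close> may vary with \<tau> in any way whatever; holomorphy in \<tau> is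
    available only after the integrals have been replaced by periods.\<close>
  have CI: "CI \<tau> = per \<tau> 1" and RI: "RI \<tau> = completed \<tau>"
    and pairing: "RI \<tau> = CI \<tau> - 1 / (2 * \<i> * of_real (Im \<tau>)) * (2 * of_real pi * \<i> * poincare_pairing (\<lambda>z. \<Phi> z \<tau>) (R \<tau>))"
    if \<tau>: "\<tau> \<in> upper_half_plane" for \<tau>
  proof -
    have "Im \<tau> > 0" using \<tau> by (simp add: upper_half_plane_def)
    then interpret E: elliptic_second_kind \<tau> "\<lambda>z. \<Phi> z \<tau>" by (rule fibre)
    have R: "pole_representatives \<tau> (\<lambda>z. \<Phi> z \<tau>) (R \<tau>)" using pole_reps \<tau> by blast
    show CI: "CI \<tau> = per \<tau> 1" using E.A_cycle_integral A_cycle \<tau> by (simp add: CI_def per_def)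
    have *: "RI \<tau> = E.\<alpha>" unfolding RI_def by (rule E.reg_integral_eq_\<alpha>[OF R])
    then show "RI \<tau> = completed \<tau>" by (simp add: E.\<alpha>_def completed_def per_def)
    show "RI \<tau> = CI \<tau> - 1 / (2 * \<i> * of_real (Im \<tau>)) * (2 * of_real pi * \<i> * poincare_pairing (\<lambda>z. \<Phi> z \<tau>) (R \<tau>))"
      unfolding * CI per_def by (rule E.\<alpha>_eq[OF R])
  qed
  have orbit: "(of_int a * \<tau> + of_int b) / (of_int c * \<tau> + of_int d) \<in> upper_half_plane"
    if "a * d - b * c = 1" "\<tau> \<in> upper_half_plane" for a b c d :: int and \<tau>
    using modular_denominator(3)[OF that(1), of \<tau>] that(2) by (simp add: upper_half_plane_def)
  have holCI: "CI holomorphic_on upper_half_plane"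
    using holomorphic_per_1 by (rule holomorphic_transform) (simp add: CI)
  have holQ: "Q holomorphic_on upper_half_plane"
    unfolding Q_def by (intro holomorphic_intros holomorphic_per_1 holomorphic_per_\<tau>)
  have nice: "F nicely_meromorphic_on upper_half_plane" if "F holomorphic_on upper_half_plane" for F
    using that open_upper_half_plane by (intro analytic_on_imp_nicely_meromorphic_on) (simp add: analytic_on_open)
  have "quasi_modular k CI"
    unfolding quasi_modular_def
  proof (intro conjI nice holCI exI[of _ 1] exI[of _ "\<lambda>_. Q"] ballI allI impI)
    fix a b c d :: int and \<tau> assume det: "a * d - b * c = 1" and \<tau>: "\<tau> \<in> upper_half_plane"
    then have im: "Im \<tau> > 0" by (simp add: upper_half_plane_def)
    show "CI ((of_int a * \<tau> + of_int b) / (of_int c * \<tau> + of_int d)) =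
        (of_int c * \<tau> + of_int d) powi k * CI \<tau> +
        (\<Sum>i=1..1. of_int c ^ i * (of_int c * \<tau> + of_int d) powi (k - int i) * Q \<tau>)"
      using per_1_quasi_modular[OF det im] by (simp add: CI orbit det \<tau> Q_def)
  qed (rule holQ)
  moreover have "is_modular_completion k CI RI"
    unfolding is_modular_completion_def
  proof (intro conjI)
    show "modular k RI"
      unfolding modular_def
    proof (intro allI impI ballI)
      fix a b c d :: int and \<tau> assume det: "a * d - b * c = 1" and \<tau>: "\<tau> \<in> upper_half_plane"
      then have im: "Im \<tau> > 0" by (simp add: upper_half_plane_def)
      show "RI ((of_int a * \<tau> + of_int b) / (of_int c * \<tau> + of_int d)) = (of_int c * \<tau> + of_int d) powi k * RI \<tau>"
        using completed_modular[OF det im] by (simp add: RI orbit det \<tau>)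
    qed
    \<comment> \<open>The completion has \<open>N = 1\<close>, with the integral over the A-cycle in
      degree 0.\<close>
    let ?F = "\<lambda>i. if i = 0 then CI else (\<lambda>\<tau>. Q \<tau> / (2 * \<i>))"
    have "?F i nicely_meromorphic_on upper_half_plane" for i :: nat
      using holCI holQ by (cases "i = 0") (auto intro!: nice holomorphic_intros)
    moreover have "RI \<tau> = (\<Sum>i\<le>1. ?F i \<tau> / of_real (Im \<tau>) ^ i)" if "\<tau> \<in> upper_half_plane" for \<tau>
      using that completed_eq[of \<tau>] by (simp add: RI CI Q_def upper_half_plane_def)
    ultimately show "\<exists>N F. (\<forall>i\<le>N. F i nicely_meromorphic_on upper_half_plane) \<and>
        (\<forall>\<tau>\<in>upper_half_plane. (\<forall>i\<le>N. \<not> is_pole (F i) \<tau>) \<longrightarrow>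
           RI \<tau> = (\<Sum>i\<le>N. F i \<tau> / of_real (Im \<tau>) ^ i)) \<and>
        (\<forall>\<tau>\<in>upper_half_plane. F 0 \<tau> = CI \<tau>)"
      by (intro exI[of _ 1] exI[of _ ?F]) auto
  qed
  ultimately show ?thesis using pairing unfolding CI_def RI_def by blast
qed

end
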